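(* Let $\beta\in(0,2)$ and assume that either $N$ is an integer with $6<N<\infty$, or $N=\infty$. Then there exists a weak self-similar solution $g=(g_n)_{2\le n\le N}$ to the Fradkov model (in the sense defined in the context) that is nontrivial (not identically zero), nonnegative, has finite area $A=\sum_{n=2}^N Y_n<\infty$, and satisfies $$\sum_{n=2}^N\Big(e^{\lambda n}X_n+\int_0^\infty e^{\lambda\xi}g_n(\xi)\,d\xi\Big)<\infty$$ for all $0<\lambda<\ln(1+1/\beta)$. Moreover, if $N<\infty$, then all functions $g_n$ are supported in $[0,N-6]$.
   Context: For $N=\infty$ the index $n$ ranges over all integers $n\ge2$, and sums $\sum_{n=2}^N$ are infinite series. For a sequence $f=(f_n)_{2\le n\le N}$ the coupling operator $J$ is $$(Jf)_2=3(\beta+1)f_3-2\beta f_2,$$ $$(Jf)_n=(\beta+1)(n+1)f_{n+1}-(2\beta+1)n f_n+\beta(n-1)f_{n-1}\quad\text{for }2<n<N,$$ and, only if $N<\infty$, $(Jf)_N=\beta(N-1)f_{N-1}-(\beta+1)Nf_N$. For a sequence $g=(g_n)_{2\le n\le N}$ of integrable functions on $(0,\infty)$ put $X_n=\int_0^\infty g_n(\xi)\,d\xi$ and $Y_n=\int_0^\infty\xi g_n(\xi)\,d\xi$; the area is $A=\sum_{n=2}^NY_n$. The coupling weight is $\Gamma(g)=\Gamma_{\rm num}(g)/\Gamma_{\rm den}(g)$ with $$\Gamma_{\rm num}(g)=\sum_{n=2}^5(n-6)^2g_n(0),\qquad \Gamma_{\rm den}(g)=\beta N X_N-2(\beta+1)X_2+\sum_{n=2}^N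 nX_n,$$ with the convention $NX_N=0$ if $N=\infty$. A weak self-similar solution to the Fradkov model is a sequence $g=(g_n)_{2\le n\le N}$ with $g_n\in L^1(0,\infty)$, such that for $2\le n\le5$ the function $g_n$ is continuous at $\xi=0$ (so that $g_n(0)$ makes sense), $\Gamma(g)$ is well defined and positive, and for each $n$ $$\int_0^\infty g_n\big((\xi+6-n)\phi'-\phi\big)\,d\xi+(6-n)_+\,g_n(0)\phi(0)=\Gamma(g)\int_0^\infty (Jg)_n\,\phi\,d\xi$$ for all smooth test functions $\phi$ with compact support in $[0,\infty)$. Here $x_+=\max\{x,0\}$, and the term $(6-n)_+g_n(0)\phi(0)$ is read as $0$ for $n\ge6$. (This is the weak form of $-2g_n-(\xi+6-n)g_n'=\Gamma(g)(Jg)_n$ with $g_n(0)=0$ for $n>6$, obtained from the ansatz $f_n(a,t)=t^{-2}g_n(a/t)$.) *)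

theory Defs
  imports "HOL-Analysis.Analysis" "HOL-Library.Extended_Nat"
begin

text \<open>The maximal index \<open>N\<close> is an extended natural number, so that \<open>N = \<infinity>\<close> is admitted.\<close>

definition idx :: "enat \<Rightarrow> nat set" where
  "idx N = {n. 2 \<le> n \<and> enat n \<le> N}"

text \<open>Sums from \<open>2\<close> to \<open>N\<close> are (ordered) series of the terms extended by zero outside \<open>idx N\<close>;
  for finite \<open>N\<close> they have only finitely many nonzero terms.\<close>

definition summable_idx :: "enat \<Rightarrow> (nat \<Rightarrow> real) \<Rightarrow> bool" where
  "summable_idx N F \<longleftrightarrow> summable (\<lambda>n. if n \<in> idx N then F n else 0)"

definition sum_idx :: "enat \<Rightarrow> (nat \<Rightarrow> real) \<Rightarrow> real" where
  "sum_idx N F = (\<Sum>n. if n \<in> idx N then F n else 0)"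

definition coupling :: "real \<Rightarrow> enat \<Rightarrow> (nat \<Rightarrow> real) \<Rightarrow> nat \<Rightarrow> real" where
  "coupling \<beta> N f n =
    (if n = 2 then 3 * (\<beta> + 1) * f 3 - 2 * \<beta> * f 2
     else if enat n = N then \<beta> * (real n - 1) * f (n - 1) - (\<beta> + 1) * real n * f n
     else (\<beta> + 1) * (real n + 1) * f (n + 1) - (2 * \<beta> + 1) * real n * f n
            + \<beta> * (real n - 1) * f (n - 1))"

definition X_mom :: "(nat \<Rightarrow> real \<Rightarrow> real) \<Rightarrow> nat \<Rightarrow> real" where
  "X_mom g n = (LBINT \<xi>:{0<..}. g n \<xi>)"

definition Y_mom :: "(nat \<Rightarrow> real \<Rightarrow> real) \<Rightarrow> nat \<Rightarrow> real" where
  "Y_mom g n = (LBINT \<xi>:{0<..}. \<xi> * g n \<xi>)"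

definition finite_area :: "enat \<Rightarrow> (nat \<Rightarrow> real \<Rightarrow> real) \<Rightarrow> bool" where
  "finite_area N g \<longleftrightarrow>
     (\<forall>n\<in>idx N. set_integrable lborel {0<..} (\<lambda>\<xi>. \<xi> * g n \<xi>)) \<and> summable_idx N (Y_mom g)"

definition Gamma_num :: "(nat \<Rightarrow> real \<Rightarrow> real) \<Rightarrow> real" where
  "Gamma_num g = (\<Sum>n=2..5. (real n - 6)\<^sup>2 * g n 0)"

definition Gamma_den :: "real \<Rightarrow> enat \<Rightarrow> (nat \<Rightarrow> real \<Rightarrow> real) \<Rightarrow> real" where
  "Gamma_den \<beta> N g =
     \<beta> * (case N of enat M \<Rightarrow> real M * X_mom g M | \<infinity> \<Rightarrow> 0)
       - 2 * (\<beta> + 1) * X_mom g 2 + sum_idx N (\<lambda>n. real n * X_mom g n)"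

definition Gamma_weight :: "real \<Rightarrow> enat \<Rightarrow> (nat \<Rightarrow> real \<Rightarrow> real) \<Rightarrow> real" where
  "Gamma_weight \<beta> N g = Gamma_num g / Gamma_den \<beta> N g"

definition Gamma_well_defined :: "real \<Rightarrow> enat \<Rightarrow> (nat \<Rightarrow> real \<Rightarrow> real) \<Rightarrow> bool" where
  "Gamma_well_defined \<beta> N g \<longleftrightarrow>
     summable_idx N (\<lambda>n. real n * X_mom g n) \<and> Gamma_den \<beta> N g \<noteq> 0"

text \<open>Test functions are smooth up to the boundary of \<open>[0,\<infinity>)\<close>, with one-sided derivatives at \<open>0\<close>,
  and need not vanish at \<open>0\<close>. Their values on the negative half-line are irrelevant.\<close>

definition test_function :: "(real \<Rightarrow> real) \<Rightarrow> bool" where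
  "test_function \<phi> \<longleftrightarrow>
     (\<exists>D :: nat \<Rightarrow> real \<Rightarrow> real. D 0 = \<phi> \<and>
        (\<forall>k. \<forall>x\<ge>0. (D k has_real_derivative D (Suc k) x) (at x within {0..}))) \<and>
     (\<exists>R. \<forall>x>R. \<phi> x = 0)"

text \<open>Only the values of \<open>g n\<close> on \<open>(0,\<infinity>)\<close> and, for \<open>n \<le> 5\<close>, at \<open>0\<close> are relevant:
  \<open>g n 0\<close> is then the limit from the right, and for \<open>n \<ge> 6\<close> the boundary term has coefficient \<open>0\<close>.\<close>

definition weak_self_similar_solution ::
    "real \<Rightarrow> enat \<Rightarrow> (nat \<Rightarrow> real \<Rightarrow> real) \<Rightarrow> bool" where
  "weak_self_similar_solution \<beta> N g \<longleftrightarrow>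
     (\<forall>n\<in>idx N. set_integrable lborel {0<..} (g n)) \<and>
     (\<forall>n\<in>{2..5}. continuous (at 0 within {0..}) (g n)) \<and>
     Gamma_well_defined \<beta> N g \<and> Gamma_weight \<beta> N g > 0 \<and>
     (\<forall>n\<in>idx N. \<forall>\<phi>. test_function \<phi> \<longrightarrow>
        (LBINT \<xi>:{0<..}. g n \<xi> * ((\<xi> + 6 - real n) * deriv \<phi> \<xi> - \<phi> \<xi>))
            + max (6 - real n) 0 * g n 0 * \<phi> 0
          = Gamma_weight \<beta> N g * (LBINT \<xi>:{0<..}. coupling \<beta> N (\<lambda>m. g m \<xi>) n * \<phi> \<xi>))"

end

theory Submission
  imports Defs "HOL-Complex_Analysis.Great_Picard"
begin

text \<open>
  For a fixed value \<open>\<gamma>\<close> of the coupling weight the problem is linear and has a probabilistic reading.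
  A grain with \<open>n\<close> sides and area \<open>\<xi>\<close> moves with velocity \<open>n - 6 - \<xi>\<close>, changes its number of sides at the
  rates \<open>\<gamma> * \<beta> * n\<close> (upwards, for \<open>n < N\<close>) and \<open>\<gamma> * (\<beta> + 1) * n\<close> (downwards, for \<open>n > 2\<close>), dies when its area
  vanishes, and gives birth to a copy of itself at rate one. A self-similar profile is a stationary measure of
  this process, in other words a quasi-stationary distribution whose death rate is exactly one, and the task
  is to find the \<open>\<gamma>\<close> for which there is one. No condition on \<open>\<gamma>\<close> besides stationarity has to be imposed: testing
  stationarity with \<open>\<xi>\<close> yields the polyhedral formula, that the sum of \<open>(n - 6) * X_n\<close> vanishes, and testing it
  with \<open>n - 6\<close> then yields \<open>\<gamma> = \<Gamma>(g)\<close>.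

  The areas are discretised with mesh \<open>1 / m\<close>, drift being replaced by jumps to the neighbouring mesh point; for
  \<open>N = \<infinity>\<close> the number of sides is truncated as well. On the resulting finite state space the right \<open>\<gamma>\<close> is the
  largest value for which some nonzero measure \<open>w \<ge> 0\<close> is not decreased anywhere by the dynamics. The set of
  such \<open>\<gamma>\<close> is not empty, since for small \<open>\<gamma>\<close> the unit mass in the rest state \<open>n = 7\<close>, \<open>\<xi> = 1\<close> qualifies; it is
  bounded, since for large \<open>\<gamma>\<close> the positive function \<open>\<xi> + n / \<gamma>\<close> decreases in the mean in every state, births
  included, which is where \<open>\<beta> < 2\<close> enters; and at the supremum irreducibility turns the inequality into stationarity
  (\<open>critical_coupling\<close>, \<open>discrete_equilibrium_exists\<close>).

  Bounds uniform in the mesh come from testing stationarity. The test functions \<open>1\<close>, \<open>\<xi>\<close> and \<open>n - 6\<close> confine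
  \<open>\<gamma>\<close> to a compact interval, again because \<open>\<beta> < 2\<close> keeps \<open>\<Gamma>_den\<close> away from zero (\<open>\<gamma>_bounds\<close>);
  \<open>exp (\<mu> * n)\<close> and \<open>exp (\<mu> * \<xi>)\<close> give exponential moments for all \<open>\<mu> < ln (1 + 1 / \<beta>)\<close>. Indicators of
  \<open>{n} \<times> [0, \<xi>]\<close> express the density as a bounded quantity \<open>R n \<xi>\<close>, an affine function of the
  distribution functions \<open>G n \<xi>\<close>, divided by \<open>\<xi> - (n - 6)\<close> (\<open>flux\<close>). Away from the rest point \<open>n - 6\<close> the
  distribution functions are therefore equi-Lipschitz, a subsequence converges pointwise, and the limit satisfies
  \<open>(\<xi> - (n - 6)) * G' = R\<close>.

  At the rest point mass might concentrate. There the bounded increasing function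
  \<open>H(\<epsilon>) = G(n - 6 + \<epsilon>) - G(n - 6 - \<epsilon>)\<close> satisfies \<open>\<epsilon> * H' = (\<gamma> * d - 1) * H + O(\<epsilon>)\<close>, where \<open>d\<close> is the diagonal
  coefficient of the coupling. The bound \<open>\<gamma> \<ge> 1 / (6 + 6 * \<beta>)\<close>, valid in the limit, makes \<open>\<gamma> * d > 1\<close>; an
  atom would force \<open>H' \<ge> c / \<epsilon>\<close>, and \<open>H\<close> would be unbounded (\<open>no_atom\<close>). So all \<open>G n\<close> are continuous, their
  derivatives \<open>g n\<close> are integrable densities, and integrating \<open>R n * \<phi>\<close> by parts gives the weak equation
  (\<open>g_weak\<close>).
\<close>

section \<open>The critical coupling of a finite irreducible system\<close>

text \<open>
  The equation asks for a vanishing eigenvalue of \<open>A + \<gamma> * B\<close> with a nonnegative left eigenvector, so \<open>\<gamma>\<close> is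
  part of the unknown. It is found as the largest \<open>\<gamma>\<close> that admits a probability vector \<open>w\<close> with
  \<open>w (A + \<gamma> * B) \<ge> 0\<close>; compactness of the simplex shows that the supremum is attained. If some component of
  \<open>w (A + \<gamma> * B)\<close> were positive there, irreducibility would allow \<open>w\<close> to be changed until all components
  are positive, and then a slightly larger \<open>\<gamma>\<close> would do as well.
\<close>

lemma critical_coupling:
  fixes A B :: "'s \<Rightarrow> 's \<Rightarrow> real"
  assumes fin: "finite S"
    and A_off: "\<And>s t. s \<in> S \<Longrightarrow> t \<in> S \<Longrightarrow> s \<noteq> t \<Longrightarrow> 0 \<le> A s t"
    and B_off: "\<And>s t. s \<in> S \<Longrightarrow> t \<in> S \<Longrightarrow> s \<noteq> t \<Longrightarrow> 0 \<le> B s t"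
    and irreducible: "\<And>P. P \<subset> S \<Longrightarrow> P \<noteq> {} \<Longrightarrow> \<exists>s\<in>P. \<exists>t\<in>S - P. 0 < A s t \<or> 0 < B s t"
    and start: "0 < \<gamma>0" "\<And>s. s \<in> S \<Longrightarrow> 0 \<le> w0 s" "sum w0 S = 1"
       "\<And>t. t \<in> S \<Longrightarrow> 0 \<le> (\<Sum>s\<in>S. w0 s * (A s t + \<gamma>0 * B s t))"
    and bound: "\<And>\<gamma>. \<gamma>1 \<le> \<gamma> \<Longrightarrow>
       \<exists>\<phi>. (\<forall>s\<in>S. 0 \<le> \<phi> s) \<and> (\<forall>s\<in>S. (\<Sum>t\<in>S. (A s t + \<gamma> * B s t) * \<phi> t) < 0)"
  obtains \<gamma> w where "\<gamma>0 \<le> \<gamma>" "\<And>s. s \<in> S \<Longrightarrow> 0 \<le> w s" "sum w S = 1"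
    "\<And>t. t \<in> S \<Longrightarrow> (\<Sum>s\<in>S. w s * (A s t + \<gamma> * B s t)) = (0::real)"
proof -
  define mass where "mass \<gamma> w t = (\<Sum>s\<in>S. w s * (A s t + \<gamma> * B s t))" for \<gamma> w t
  define super where "super \<gamma> w \<longleftrightarrow> (\<forall>s\<in>S. 0 \<le> w s) \<and> (\<forall>t\<in>S. 0 \<le> mass \<gamma> w t)" for \<gamma> w
  define Z where "Z = {\<gamma>. \<gamma>0 \<le> \<gamma> \<and> (\<exists>w. super \<gamma> w \<and> sum w S = 1)}"
  have "\<gamma>0 \<in> Z"
    unfolding Z_def super_def mass_def using start by auto
  have below: "\<gamma> < \<gamma>1" if \<gamma>Z: "\<gamma> \<in> Z" for \<gamma>
  proof (rule ccontr)
    assume "\<not> \<gamma> < \<gamma>1"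
    then obtain \<phi> where \<phi>: "\<And>s. s \<in> S \<Longrightarrow> 0 \<le> \<phi> s"
      "\<And>s. s \<in> S \<Longrightarrow> (\<Sum>t\<in>S. (A s t + \<gamma> * B s t) * \<phi> t) < 0"
      using bound[of \<gamma>] by auto
    obtain w where w: "super \<gamma> w" "sum w S = 1"
      using \<gamma>Z by (auto simp: Z_def)
    have "\<exists>s\<in>S. w s \<noteq> 0"
      using w(2) by (metis sum.neutral zero_neq_one)
    then obtain s0 where s0: "s0 \<in> S" "0 < w s0"
      using w(1) by (force simp: super_def)
    have "0 \<le> (\<Sum>t\<in>S. mass \<gamma> w t * \<phi> t)"
      using w(1) \<phi>(1) by (intro sum_nonneg) (auto simp: super_def)
    also have "\<dots> = (\<Sum>s\<in>S. w s * (\<Sum>t\<in>S. (A s t + \<gamma> * B s t) * \<phi> t))"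
      unfolding mass_def sum_distrib_right sum_distrib_left
      by (subst sum.swap) (simp add: mult.assoc)
    also have "\<dots> < (\<Sum>s\<in>S. 0)"
    proof (rule sum_strict_mono_ex1[OF fin])
      show "\<forall>s\<in>S. w s * (\<Sum>t\<in>S. (A s t + \<gamma> * B s t) * \<phi> t) \<le> 0"
        using \<phi>(2) w(1) by (auto simp: super_def mult_le_0_iff dest!: less_imp_le)
      show "\<exists>s\<in>S. w s * (\<Sum>t\<in>S. (A s t + \<gamma> * B s t) * \<phi> t) < 0"
        using s0 \<phi>(2) by (auto intro!: bexI[of _ s0] mult_pos_neg)
    qed
    finally show False by simp
  qed
  have bdd: "bdd_above Z"
    using below by (meson bdd_aboveI less_imp_le)
  define gs where "gs = Sup Z"
  have gs_ge: "\<gamma>0 \<le> gs"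
    unfolding gs_def by (rule cSup_upper[OF \<open>\<gamma>0 \<in> Z\<close> bdd])
  have "\<exists>\<gamma>\<in>Z. gs - 1 / real (Suc i) < \<gamma>" for i
    using less_cSup_iff[OF _ bdd, of "gs - 1 / real (Suc i)"] \<open>\<gamma>0 \<in> Z\<close>
    unfolding gs_def by fastforce
  then obtain \<gamma>s where \<gamma>s: "\<And>i. \<gamma>s i \<in> Z" "\<And>i. gs - 1 / real (Suc i) < \<gamma>s i"
    by metis
  then obtain ws where ws: "\<And>i. super (\<gamma>s i) (ws i)" "\<And>i. sum (ws i) S = 1"
    unfolding Z_def by simp metis
  have ws_le: "norm (ws i s) \<le> 1" if "s \<in> S" for i s
    using member_le_sum[of s S "ws i"] that ws fin by (auto simp: super_def)
  have \<gamma>s_lim: "\<gamma>s \<longlonglongrightarrow> gs"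
  proof (rule tendsto_sandwich)
    show "(\<lambda>i. gs - 1 / real (Suc i)) \<longlonglongrightarrow> gs"
      using tendsto_diff[OF tendsto_const[of gs] LIMSEQ_inverse_real_of_nat]
      by (simp add: inverse_eq_divide)
    show "\<forall>\<^sub>F i in sequentially. \<gamma>s i \<le> gs"
      using \<gamma>s(1) cSup_upper[OF _ bdd] by (simp add: gs_def)
  qed (intro always_eventually allI less_imp_le \<gamma>s(2) tendsto_const)+
  obtain k l where k: "strict_mono (k::nat\<Rightarrow>nat)" and l: "\<And>s. s \<in> S \<Longrightarrow> (\<lambda>i. ws (k i) s) \<longlonglongrightarrow> l s"
    using function_convergent_subsequence[of S ws 1] ws_le countable_finite[OF fin] by metis
  have \<gamma>k: "(\<lambda>i. \<gamma>s (k i)) \<longlonglongrightarrow> gs"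
    using LIMSEQ_subseq_LIMSEQ[OF \<gamma>s_lim k] by (simp add: o_def)
  have mass_lim: "(\<lambda>i. mass (\<gamma>s (k i)) (ws (k i)) t) \<longlonglongrightarrow> mass gs l t" for t
    unfolding mass_def by (intro tendsto_intros l \<gamma>k)
  have sl: "super gs l"
    unfolding super_def
  proof (intro conjI ballI)
    show "0 \<le> l s" if "s \<in> S" for s
      using LIMSEQ_le_const[OF l[OF that]] ws that by (auto simp: super_def)
    show "0 \<le> mass gs l t" if "t \<in> S" for t
      using LIMSEQ_le_const[OF mass_lim] ws that by (auto simp: super_def)
  qed
  have suml: "sum l S = 1"
  proof (rule LIMSEQ_unique)
    show "(\<lambda>i. sum (ws (k i)) S) \<longlonglongrightarrow> sum l S"
      by (intro tendsto_sum l)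
  qed (simp add: ws)
  define pos where "pos w = {t\<in>S. 0 < mass gs w t}" for w
  have "mass gs l t = 0" if "t \<in> S" for t
  proof (rule ccontr)
    assume "mass gs l t \<noteq> 0"
    then have "pos l \<noteq> {}"
      using sl that by (force simp: super_def pos_def)
    \<comment> \<open>Maximising the number of positive components replaces powers of the matrix: adding a little
      mass at \<open>s\<close> keeps the positive components positive and makes one more of them positive.\<close>
    let ?Q = "\<lambda>w. super gs w \<and> pos w \<noteq> {}"
    have "\<exists>w. ?Q w \<and> (\<forall>y. ?Q y \<longrightarrow> card (pos y) \<le> card (pos w))"
      by (rule ex_has_greatest_nat[where b = "Suc (card S)" and k = l])
        (use sl \<open>pos l \<noteq> {}\<close> in simp, intro allI impI le_imp_less_Suc card_mono fin, simp add: pos_def)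
    then obtain w where w: "super gs w" "pos w \<noteq> {}" "\<And>y. ?Q y \<Longrightarrow> card (pos y) \<le> card (pos w)"
      by blast
    have "pos w = S"
    proof (rule ccontr)
      assume "pos w \<noteq> S"
      then have "pos w \<subset> S" by (auto simp: pos_def)
      from irreducible[OF this w(2)]
      obtain s t where st: "s \<in> pos w" "t \<in> S - pos w" "0 < A s t \<or> 0 < B s t" by blast
      have sS: "s \<in> S" and sp: "0 < mass gs w s" using st(1) by (auto simp: pos_def)
      define M where "M t = A s t + gs * B s t" for t
      have Mt: "0 < M t"
      proof -
        have "0 \<le> A s t" "0 \<le> B s t" "0 < gs" using A_off B_off st sS gs_ge start(1) by auto
        then show ?thesis using st(3) by (auto simp: M_def add_pos_nonneg add_nonneg_pos)
      qed
      have Moff: "0 \<le> M x" if "x \<in> S" "x \<noteq> s" for x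
        using A_off B_off sS gs_ge start(1) that by (auto simp: M_def)
      define e where "e = mass gs w s / (2 * (\<bar>M s\<bar> + 1))"
      have e: "0 < e" using sp by (simp add: e_def)
      have eM: "0 < mass gs w s + e * M s"
      proof -
        have "e * \<bar>M s\<bar> \<le> e * (\<bar>M s\<bar> + 1)" using e by simp
        also have "\<dots> = mass gs w s / 2" by (simp add: e_def field_simps)
        finally have "e * \<bar>M s\<bar> < mass gs w s" using sp by simp
        moreover have "- (e * \<bar>M s\<bar>) \<le> e * M s"
          using e abs_ge_minus_self[of "e * M s"] by (simp add: abs_mult)
        ultimately show ?thesis by linarith
      qed
      define w' where "w' x = w x + (if x = s then e else 0)" for x
      have mass': "mass gs w' x = mass gs w x + e * M x" for x
      proof -
        have "mass gs w' x = mass gs w x + (\<Sum>y\<in>S. if y = s then e * (A y x + gs * B y x) else 0)"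
          unfolding mass_def w'_def sum.distrib[symmetric] by (intro sum.cong) (auto simp: algebra_simps)
        then show ?thesis using fin sS by (simp add: M_def)
      qed
      have *: "0 \<le> mass gs w x" if "x \<in> S" for x using w(1) that by (auto simp: super_def)
      have ge: "mass gs w x \<le> mass gs w' x" if "x \<in> S" "x \<noteq> s" for x
        using mass'[of x] Moff[OF that] e by simp
      have "super gs w'"
        unfolding super_def
      proof (intro conjI ballI)
        show "0 \<le> w' x" if "x \<in> S" for x using w(1) e that by (auto simp: super_def w'_def)
        show "0 \<le> mass gs w' x" if "x \<in> S" for x
          using *[OF that] ge[OF that] eM mass'[of s] by (cases "x = s") auto
      qed
      moreover have "insert t (pos w) \<subseteq> pos w'"
      proof -
        have "0 < mass gs w' t" using mass'[of t] *[of t] st(2) Mt e by (simp add: add_nonneg_pos)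
        moreover have "0 < mass gs w' x" if "x \<in> pos w" for x
          using that ge[of x] eM mass'[of s] by (cases "x = s") (auto simp: pos_def)
        ultimately show ?thesis using st(2) by (auto simp: pos_def)
      qed
      ultimately have w': "super gs w'" "insert t (pos w) \<subseteq> pos w'" by blast+
      then have "card (pos w') \<le> card (pos w)"
        by (intro w(3)) blast
      moreover have "card (insert t (pos w)) \<le> card (pos w')"
        using w'(2) fin by (intro card_mono) (auto simp: pos_def)
      ultimately have "card (insert t (pos w)) \<le> card (pos w)" by simp
      moreover have "finite (pos w)" using fin by (simp add: pos_def)
      ultimately show False using st(2) by simp
    qed
    then have all_pos: "0 < mass gs w x" if "x \<in> S" for x
      using that by (auto simp: pos_def)
    \<comment> \<open>Finitely many strict inequalities persist for slightly larger values of the coupling.\<close>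
    have ev: "\<forall>\<^sub>F g in at_right gs. \<forall>x\<in>S. 0 < mass g w x"
    proof (rule eventually_ball_finite[OF fin], rule ballI)
      fix x assume "x \<in> S"
      have "((\<lambda>g. mass g w x) \<longlongrightarrow> mass gs w x) (at_right gs)"
        unfolding mass_def by (intro tendsto_intros)
      from order_tendstoD(1)[OF this all_pos[OF \<open>x \<in> S\<close>]]
      show "\<forall>\<^sub>F g in at_right gs. 0 < mass g w x" .
    qed
    have "\<forall>\<^sub>F g in at_right gs. (\<forall>x\<in>S. 0 < mass g w x) \<and> gs < g"
      using ev eventually_at_right_less[of gs] by eventually_elim auto
    from eventually_happens'[OF trivial_limit_at_right_real this]
    obtain g where g: "\<And>x. x \<in> S \<Longrightarrow> 0 < mass g w x" "gs < g" by blast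
    define W where "W = sum w S"
    have wn: "0 \<le> w x" if "x \<in> S" for x using w(1) that by (auto simp: super_def)
    have "W \<noteq> 0"
    proof
      assume "W = 0"
      then have "\<forall>x\<in>S. w x = 0" using wn fin by (simp add: W_def sum_nonneg_eq_0_iff)
      then have "mass g w t = 0" by (simp add: mass_def)
      then show False using g(1)[OF that] by simp
    qed
    then have "0 < W" using wn by (simp add: W_def sum_nonneg less_le)
    have mW: "mass g (\<lambda>x. w x / W) t = mass g w t / W" for t
      by (simp add: mass_def sum_divide_distrib)
    have "super g (\<lambda>x. w x / W)"
      using wn g(1) \<open>0 < W\<close> by (auto simp: super_def mW intro: less_imp_le)
    moreover have "(\<Sum>x\<in>S. w x / W) = 1"
      using \<open>W \<noteq> 0\<close> by (simp add: W_def sum_divide_distrib[symmetric])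
    ultimately have "g \<in> Z" using g(2) gs_ge by (auto simp: Z_def)
    then have "g \<le> gs" unfolding gs_def by (rule cSup_upper[OF _ bdd])
    then show False using g(2) by simp
  qed
  then show ?thesis
    using that[OF gs_ge, of l] sl suml by (auto simp: super_def mass_def)
qed

section \<open>The discretised process\<close>

text \<open>
  The state \<open>(n, k)\<close> stands for grains with \<open>n\<close> sides and area \<open>k / m\<close>. No grain can grow beyond the area \<open>N - 6\<close>.
\<close>

definition states :: "nat \<Rightarrow> nat \<Rightarrow> (nat \<times> nat) set" where
  "states N m = {2..N} \<times> {0..m * (N - 6)}"

text \<open>
  The rate at which mesh cells are crossed, that is \<open>m\<close> times the velocity \<open>n - 6 - k / m\<close>. It is an integer that
  drops by one from cell to cell, so it vanishes in a mesh point before it changes sign.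
\<close>

definition drift :: "nat \<Rightarrow> nat \<Rightarrow> nat \<Rightarrow> real" where
  "drift m n k = real m * (real n - 6) - real k"

text \<open>
  Generator of transport, birth and death, acting on test functions: a grain jumps one cell in the direction of
  its drift, the value \<open>0\<close> to the left of cell \<open>0\<close> encodes its death, and the last summand its birth rate one.
\<close>

definition move :: "nat \<Rightarrow> (nat \<Rightarrow> nat \<Rightarrow> real) \<Rightarrow> nat \<Rightarrow> nat \<Rightarrow> real" where
  "move m \<phi> n k = max (drift m n k) 0 * (\<phi> n (Suc k) - \<phi> n k)
     + max (- drift m n k) 0 * ((if k = 0 then 0 else \<phi> n (k - 1)) - \<phi> n k) + \<phi> n k"

text \<open>
  Adjoint of the coupling operator: at \<open>n = 2\<close> and \<open>n = N\<close> the missing neighbour is taken into account by switching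
  off the corresponding rate.
\<close>

definition jump :: "real \<Rightarrow> nat \<Rightarrow> (nat \<Rightarrow> nat \<Rightarrow> real) \<Rightarrow> nat \<Rightarrow> nat \<Rightarrow> real" where
  "jump \<beta> N \<phi> n k = (if n < N then \<beta> * real n else 0) * (\<phi> (Suc n) k - \<phi> n k)
     + (if 2 < n then (\<beta> + 1) * real n else 0) * (\<phi> (n - 1) k - \<phi> n k)"

definition discrete_equilibrium ::
    "real \<Rightarrow> nat \<Rightarrow> nat \<Rightarrow> real \<Rightarrow> (nat \<Rightarrow> nat \<Rightarrow> real) \<Rightarrow> bool" where
  "discrete_equilibrium \<beta> N m \<gamma> w \<longleftrightarrow> 0 < \<gamma> \<and> (\<forall>n k. 0 \<le> w n k) \<and>
     (\<forall>n k. (n, k) \<notin> states N m \<longrightarrow> w n k = 0) \<and> (\<Sum>(n, k)\<in>states N m. w n k) = 1 \<and>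
     (\<forall>\<phi>. (\<Sum>(n, k)\<in>states N m. w n k * (move m \<phi> n k + \<gamma> * jump \<beta> N \<phi> n k)) = 0)"

definition unit_mass :: "nat \<times> nat \<Rightarrow> nat \<Rightarrow> nat \<Rightarrow> real" where
  "unit_mass t n k = of_bool ((n, k) = t)"

lemma finite_states [simp]: "finite (states N m)"
  by (simp add: states_def)

lemma sum_unit_mass:
  assumes "(n, k) \<in> states N m"
  shows "(\<Sum>t\<in>states N m. unit_mass t n k * F t) = F (n, k)"
proof -
  have "(\<Sum>t\<in>states N m. unit_mass t n k * F t) = (\<Sum>t\<in>states N m. if (n, k) = t then F t else 0)"
    by (intro sum.cong) (auto simp: unit_mass_def)
  then show ?thesis using assms by simp
qed

text \<open>
  Grains do not leave the state space through its upper end.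
\<close>

lemma drift_nonpos_at_end:
  assumes "(n, k) \<in> states N m" "(n, Suc k) \<notin> states N m" "6 \<le> N"
  shows "drift m n k \<le> 0"
proof -
  have "k = m * (N - 6)" "n \<le> N" using assms by (auto simp: states_def)
  then have "real k = real m * (real N - 6)" using assms(3) by (simp add: of_nat_diff)
  moreover have "real m * (real n - 6) \<le> real m * (real N - 6)"
    using \<open>n \<le> N\<close> by (intro mult_left_mono) auto
  ultimately show ?thesis by (simp add: drift_def)
qed

lemma move_expand:
  assumes s: "(n, k) \<in> states N m" and "6 \<le> N"
  shows "(\<Sum>t\<in>states N m. move m (unit_mass t) n k * \<phi> (fst t) (snd t)) = move m \<phi> n k"
proof -
  define E where "E n k = (\<Sum>t\<in>states N m. unit_mass t n k * \<phi> (fst t) (snd t))" for n k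
  have E: "E n k = \<phi> n k" if "(n, k) \<in> states N m" for n k
    unfolding E_def using sum_unit_mass[OF that, of "\<lambda>t. \<phi> (fst t) (snd t)"] by simp
  have up: "max (drift m n k) 0 * E n (Suc k) = max (drift m n k) 0 * \<phi> n (Suc k)"
    using E drift_nonpos_at_end[OF s _ assms(2)] by (cases "(n, Suc k) \<in> states N m") auto
  have dn: "E n (k - 1) = \<phi> n (k - 1)" "E n k = \<phi> n k"
    using s by (auto intro!: E simp: states_def)
  have "(\<Sum>t\<in>states N m. move m (unit_mass t) n k * \<phi> (fst t) (snd t)) =
      max (drift m n k) 0 * (E n (Suc k) - E n k)
     + max (- drift m n k) 0 * ((if k = 0 then 0 else E n (k - 1)) - E n k) + E n k"
    unfolding E_def move_def
    by (simp add: sum.distrib sum_subtractf sum_distrib_left algebra_simps)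
  also have "\<dots> = move m \<phi> n k"
    unfolding move_def right_diff_distrib up dn by simp
  finally show ?thesis .
qed

lemma jump_expand:
  assumes s: "(n, k) \<in> states N m"
  shows "(\<Sum>t\<in>states N m. jump \<beta> N (unit_mass t) n k * \<phi> (fst t) (snd t)) = jump \<beta> N \<phi> n k"
proof -
  define E where "E n k = (\<Sum>t\<in>states N m. unit_mass t n k * \<phi> (fst t) (snd t))" for n k
  have E: "E n k = \<phi> n k" if "(n, k) \<in> states N m" for n k
    unfolding E_def using sum_unit_mass[OF that, of "\<lambda>t. \<phi> (fst t) (snd t)"] by simp
  have up: "(if n < N then \<beta> * real n else 0) * (E (Suc n) k - E n k)
      = (if n < N then \<beta> * real n else 0) * (\<phi> (Suc n) k - \<phi> n k)"
    using s E by (auto simp: states_def)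
  have dn: "(if 2 < n then (\<beta> + 1) * real n else 0) * (E (n - 1) k - E n k)
      = (if 2 < n then (\<beta> + 1) * real n else 0) * (\<phi> (n - 1) k - \<phi> n k)"
  proof (cases "2 < n")
    case True
    then have "(n - 1, k) \<in> states N m" using s by (auto simp: states_def)
    from E[OF this] E[OF s] show ?thesis by simp
  qed simp
  have "(\<Sum>t\<in>states N m. jump \<beta> N (unit_mass t) n k * \<phi> (fst t) (snd t)) =
      (if n < N then \<beta> * real n else 0) * (E (Suc n) k - E n k)
     + (if 2 < n then (\<beta> + 1) * real n else 0) * (E (n - 1) k - E n k)"
    unfolding E_def jump_def
    by (simp add: sum.distrib sum_subtractf sum_distrib_left algebra_simps)
  also have "\<dots> = jump \<beta> N \<phi> n k"
    unfolding jump_def up dn by simp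
  finally show ?thesis .
qed

text \<open>
  Changing the number of sides reaches the extreme rows \<open>n = 2\<close>, where areas only shrink, and \<open>n = N\<close>, where they
  only grow; hence every state can be reached from every other one.
\<close>

lemma states_irreducible:
  assumes P: "P \<subset> states N m" "P \<noteq> {}" and "6 \<le> N" "0 < \<beta>" "0 < m"
  shows "\<exists>s\<in>P. \<exists>t\<in>states N m - P. 0 < move m (unit_mass t) (fst s) (snd s)
     \<or> 0 < jump \<beta> N (unit_mass t) (fst s) (snd s)"
proof (rule ccontr)
  assume "\<not> ?thesis"
  then have closed: "t \<in> P" if "s \<in> P" "t \<in> states N m"
      "0 < move m (unit_mass t) (fst s) (snd s) \<or> 0 < jump \<beta> N (unit_mass t) (fst s) (snd s)" for s t
    using that by blast
  have sub: "(n, k) \<in> states N m" if "(n, k) \<in> P" for n k using P that by auto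
  have up: "(Suc n, k) \<in> P" if "(n, k) \<in> P" "n < N" for n k
  proof -
    have st: "(Suc n, k) \<in> states N m"
      using sub[OF that(1)] that(2) by (auto simp: states_def)
    have "0 < \<beta> * real n" using sub[OF that(1)] \<open>0 < \<beta>\<close> by (auto simp: states_def)
    then have "0 < jump \<beta> N (unit_mass (Suc n, k)) n k"
      using that(2) \<open>0 < \<beta>\<close> by (auto simp: jump_def unit_mass_def)
    then show ?thesis
      by (intro closed[OF that(1) st] disjI2) simp
  qed
  have down: "(n - 1, k) \<in> P" if "(n, k) \<in> P" "2 < n" for n k
  proof -
    have st: "(n - 1, k) \<in> states N m"
      using sub[OF that(1)] that(2) by (auto simp: states_def)
    have ne: "n \<noteq> n - Suc 0" "Suc n \<noteq> n - Suc 0" using that(2) by linarith+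
    have "0 < (\<beta> + 1) * real n" using that(2) \<open>0 < \<beta>\<close> by simp
    then have "0 < jump \<beta> N (unit_mass (n - 1, k)) n k"
      using that(2) by (simp add: jump_def unit_mass_def ne)
    then show ?thesis
      by (intro closed[OF that(1) st] disjI2) simp
  qed
  have right: "(N, Suc k) \<in> P" if "(N, k) \<in> P" "k < m * (N - 6)" for k
  proof -
    have st: "(N, Suc k) \<in> states N m"
      using sub[OF that(1)] that(2) by (auto simp: states_def)
    have "real k < real (m * (N - 6))" using that(2) by (simp only: of_nat_less_iff)
    also have "\<dots> = real m * (real N - 6)" using \<open>6 \<le> N\<close> by (simp add: of_nat_diff)
    finally have "0 < drift m N k" by (simp add: drift_def)
    then have "0 < move m (unit_mass (N, Suc k)) N k"
      by (auto simp: move_def unit_mass_def)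
    then show ?thesis
      by (intro closed[OF that(1) st] disjI1) simp
  qed
  have left: "(2, k - 1) \<in> P" if "(2, k) \<in> P" "0 < k" for k
  proof -
    have st: "(2, k - 1) \<in> states N m"
      using sub[OF that(1)] that(2) by (auto simp: states_def)
    have ne: "k \<noteq> k - Suc 0" "Suc k \<noteq> k - Suc 0" using that(2) by linarith+
    have "drift m 2 k < 0" using \<open>0 < m\<close> by (simp add: drift_def)
    then have "0 < move m (unit_mass (2, k - 1)) 2 k"
      using that(2) by (simp add: move_def unit_mass_def ne)
    then show ?thesis
      by (intro closed[OF that(1) st] disjI1) simp
  qed
  have raise: "(n + j, k) \<in> P" if "(n, k) \<in> P" "n + j \<le> N" for n k j
    using that(2) by (induction j) (use that(1) up in auto)
  have lower: "(n - j, k) \<in> P" if "(n, k) \<in> P" "2 \<le> n - j" for n k j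
    using that(2)
  proof (induction j)
    case (Suc j)
    then show ?case using down[of "n - j" k] by auto
  qed (use that(1) in auto)
  have row: "(n', k) \<in> P" if "(n, k) \<in> P" "2 \<le> n'" "n' \<le> N" for n n' k
    using raise[OF that(1), of "n' - n"] lower[OF that(1), of "n - n'"] that(2,3)
    by (cases "n \<le> n'") auto
  obtain n0 k0 where nk: "(n0, k0) \<in> P" using P(2) by auto
  have "(2, k0 - j) \<in> P" for j
  proof (induction j)
    case 0
    show ?case using row[OF nk, of 2] \<open>6 \<le> N\<close> by simp
  next
    case (Suc j)
    show ?case using left[OF Suc.IH] Suc.IH by (cases "k0 - j = 0") (auto simp: diff_Suc split: nat.splits)
  qed
  from this[of k0] have "(N, 0) \<in> P" using row[of 2 0 N] \<open>6 \<le> N\<close> by simp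
  have "(N, k) \<in> P" if "k \<le> m * (N - 6)" for k
    using that by (induction k) (use \<open>(N, 0) \<in> P\<close> right in auto)
  then have "states N m \<subseteq> P" using row[of N] by (auto simp: states_def)
  then show False using P by auto
qed

text \<open>
  Two explicit test objects make \<open>critical_coupling\<close> applicable. In the rest state \<open>(7, m)\<close> the birth rate one
  outweighs the jumps if \<open>\<gamma>\<close> is small. For large \<open>\<gamma>\<close> the function \<open>\<phi> = k + 1 + n * m / \<gamma>\<close> is a strict
  supersolution: the birth term compensates the drift term \<open>- k\<close>, and the jumps contribute at most \<open>- m * n\<close>, except that at
  \<open>n = 2\<close> they contribute \<open>2 * \<beta> * m\<close>. What remains there is close to \<open>m * (2 * \<beta> - 4) < 0\<close>.
\<close>

lemma discrete_equilibrium_exists: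
  assumes "0 < \<beta>" "7 \<le> N" "0 < m" and small: "1 / real m < 4 - 2 * \<beta>"
  obtains \<gamma> w where "discrete_equilibrium \<beta> N m \<gamma> w"
proof -
  define S where "S = states N m"
  define A where "A s t = move m (unit_mass t) (fst s) (snd s)" for s t
  define B where "B s t = jump \<beta> N (unit_mass t) (fst s) (snd s)" for s t
  define s0 where "s0 = (7::nat, m)"
  define \<gamma>0 where "\<gamma>0 = 1 / (14 * \<beta> + 7)"
  have \<gamma>0: "0 < \<gamma>0" using \<open>0 < \<beta>\<close> by (simp add: \<gamma>0_def)
  have "m * 1 \<le> m * (N - 6)" using assms by (intro mult_left_mono) auto
  then have s0: "s0 \<in> S" using assms by (auto simp: s0_def S_def states_def)
  have AB: "(\<Sum>t\<in>S. (A s t + \<gamma> * B s t) * \<phi> (fst t) (snd t))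
      = move m \<phi> (fst s) (snd s) + \<gamma> * jump \<beta> N \<phi> (fst s) (snd s)" if "s \<in> S" for s \<phi> \<gamma>
  proof -
    have "(\<Sum>t\<in>S. A s t * \<phi> (fst t) (snd t)) = move m \<phi> (fst s) (snd s)"
      unfolding A_def S_def using that assms by (intro move_expand) (auto simp: S_def)
    moreover have "(\<Sum>t\<in>S. B s t * \<phi> (fst t) (snd t)) = jump \<beta> N \<phi> (fst s) (snd s)"
      unfolding B_def S_def using that assms by (intro jump_expand) (auto simp: S_def)
    ultimately show ?thesis
      by (simp add: distrib_right sum.distrib mult.assoc flip: sum_distrib_left)
  qed
  have A_off: "0 \<le> A s t" if "s \<noteq> t" for s t
    using that by (auto simp: A_def move_def unit_mass_def)
  have B_off: "0 \<le> B s t" if "s \<noteq> t" for s t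
    using that \<open>0 < \<beta>\<close> by (auto simp: B_def jump_def unit_mass_def)
  have irr: "\<exists>s\<in>P. \<exists>t\<in>S - P. 0 < A s t \<or> 0 < B s t" if "P \<subset> S" "P \<noteq> {}" for P
    using states_irreducible[of P N m \<beta>] that assms by (simp add: A_def B_def S_def)
  have start: "0 \<le> (\<Sum>s\<in>S. of_bool (s = s0) * (A s t + \<gamma>0 * B s t))" if "t \<in> S" for t
  proof -
    have "(\<Sum>s\<in>S. of_bool (s = s0) * (A s t + \<gamma>0 * B s t))
        = (\<Sum>s\<in>S. if s = s0 then A s t + \<gamma>0 * B s t else 0)"
      by (intro sum.cong) auto
    also have "\<dots> = A s0 t + \<gamma>0 * B s0 t" using s0 by (simp add: S_def)
    also have "0 \<le> \<dots>"
    proof (cases "t = s0")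
      case True
      have "A s0 s0 = 1" by (auto simp: A_def s0_def move_def unit_mass_def drift_def)
      moreover have "- (14 * \<beta> + 7) \<le> B s0 s0"
        using \<open>0 < \<beta>\<close> by (auto simp: B_def s0_def jump_def unit_mass_def algebra_simps)
      then have "- 1 \<le> \<gamma>0 * B s0 s0"
        using \<open>0 < \<beta>\<close> by (simp add: \<gamma>0_def divide_simps)
      ultimately show ?thesis using True by simp
    next
      case False
      then show ?thesis using A_off[of s0 t] B_off[of s0 t] \<gamma>0 by simp
    qed
    finally show ?thesis .
  qed
  define \<delta> where "\<delta> = 4 - 2 * \<beta> - 1 / real m"
  have \<delta>: "0 < \<delta>" using small by (simp add: \<delta>_def)
  have bound: "\<exists>\<phi>. (\<forall>s\<in>S. 0 \<le> \<phi> s) \<and> (\<forall>s\<in>S. (\<Sum>t\<in>S. (A s t + \<gamma> * B s t) * \<phi> t) < 0)"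
    if \<gamma>: "2 * real N / \<delta> \<le> \<gamma>" for \<gamma>
  proof -
    have "0 < 2 * real N / \<delta>" using \<delta> assms by simp
    then have \<gamma>p: "0 < \<gamma>" using \<gamma> by linarith
    define \<phi> where "\<phi> n k = real k + 1 + real n * (real m / \<gamma>)" for n k :: nat
    have "move m \<phi> n k + \<gamma> * jump \<beta> N \<phi> n k < 0" if "(n, k) \<in> S" for n k
    proof -
      have n: "2 \<le> n" "n \<le> N" using that by (auto simp: S_def states_def)
      have "move m \<phi> n k \<le> real m * (real n - 6) + 1 + real n * (real m / \<gamma>)"
      proof (cases "k = 0")
        case True
        have "0 \<le> max (- drift m n 0) 0 * (real n * (real m / \<gamma>))" using \<gamma>p by simp
        moreover have "max (drift m n 0) 0 - max (- drift m n 0) 0 = drift m n 0" by simp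
        moreover have "move m \<phi> n 0 = max (drift m n 0) 0 - max (- drift m n 0) 0
            - max (- drift m n 0) 0 * (real n * (real m / \<gamma>)) + 1 + real n * (real m / \<gamma>)"
          by (simp add: move_def \<phi>_def algebra_simps)
        ultimately show ?thesis using True by (simp add: drift_def)
      next
        case False
        have "max (drift m n k) 0 - max (- drift m n k) 0 = drift m n k" by simp
        moreover have "move m \<phi> n k = max (drift m n k) 0 - max (- drift m n k) 0
            + real k + 1 + real n * (real m / \<gamma>)"
          using False by (simp add: move_def \<phi>_def algebra_simps of_nat_diff)
        ultimately show ?thesis by (simp add: drift_def)
      qed
      moreover have "jump \<beta> N \<phi> n k \<le> (real m / \<gamma>) * (- real n + (if n = 2 then 2 * (\<beta> + 1) else 0))"
      proof -
        have "jump \<beta> N \<phi> n k = (real m / \<gamma>) *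
          ((if n < N then \<beta> * real n else 0) - (if 2 < n then (\<beta> + 1) * real n else 0))"
        proof -
          have f1: "\<phi> (Suc n) k - \<phi> n k = real m / \<gamma>"
            and f2: "2 < n \<Longrightarrow> \<phi> (n - 1) k - \<phi> n k = - (real m / \<gamma>)"
            by (simp_all add: \<phi>_def of_nat_diff left_diff_distrib distrib_right add_divide_distrib diff_divide_distrib)
          show ?thesis
            by (cases "2 < n")
              (simp_all only: jump_def f1 f2 if_True if_False, simp_all add: algebra_simps)
        qed
        also have "\<dots> \<le> (real m / \<gamma>) * (- real n + (if n = 2 then 2 * (\<beta> + 1) else 0))"
          using n \<gamma>p \<open>0 < \<beta>\<close> by (intro mult_left_mono) (auto simp: algebra_simps)
        finally show ?thesis .
      qed
      then have "\<gamma> * jump \<beta> N \<phi> n k \<le> real m * (- real n + (if n = 2 then 2 * (\<beta> + 1) else 0))"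
        using mult_left_mono[of "jump \<beta> N \<phi> n k" "(real m / \<gamma>) * (- real n + (if n = 2 then 2 * (\<beta> + 1) else 0))" \<gamma>] \<gamma>p
        by (simp only: mult.assoc[symmetric]) simp
      moreover have "(if n = 2 then 2 * (\<beta> + 1) else 0) \<le> 2 * (\<beta> + 1)" using \<open>0 < \<beta>\<close> by simp
      then have "real m * (- real n + (if n = 2 then 2 * (\<beta> + 1) else 0)) \<le> real m * (- real n + 2 * (\<beta> + 1))"
        by (intro mult_left_mono) auto
      moreover have "real n / \<gamma> < \<delta>"
      proof -
        have "real n * 2 \<le> real N * 2" using n by simp
        also have "\<dots> \<le> \<gamma> * \<delta>" using \<gamma> \<delta> by (simp add: field_simps)
        finally show ?thesis using \<gamma>p n by (simp add: field_simps)
      qed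
      then have "real m * (real n / \<gamma>) < real m * \<delta>"
        using \<open>0 < m\<close> by (intro mult_strict_left_mono) auto
      moreover have "real m * \<delta> = real m * (4 - 2 * \<beta>) - 1"
        using \<open>0 < m\<close> by (simp add: \<delta>_def field_simps)
      ultimately show ?thesis by (simp add: algebra_simps)
    qed
    moreover have "0 \<le> \<phi> n k" for n k using \<gamma>p by (simp add: \<phi>_def)
    ultimately show ?thesis
      using AB[of _ \<gamma> \<phi>] by (intro exI[of _ "\<lambda>t. \<phi> (fst t) (snd t)"]) auto
  qed
  have s1: "(\<Sum>s\<in>S. of_bool (s = s0)) = (1::real)"
    using s0 by (simp add: S_def of_bool_def)
  have S: "finite S" "\<And>s. s \<in> S \<Longrightarrow> (0::real) \<le> of_bool (s = s0)" by (simp_all add: S_def)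
  obtain \<gamma> w where w: "\<gamma>0 \<le> \<gamma>" "\<And>s. s \<in> S \<Longrightarrow> 0 \<le> w s" "sum w S = 1"
    "\<And>t. t \<in> S \<Longrightarrow> (\<Sum>s\<in>S. w s * (A s t + \<gamma> * B s t)) = 0"
    by (rule critical_coupling[OF S(1) A_off B_off irr \<gamma>0 S(2) s1 start bound];
        (assumption | rule that; assumption))
  define v where "v n k = (if (n, k) \<in> S then w (n, k) else 0)" for n k
  have "(\<Sum>(n, k)\<in>S. v n k * (move m \<phi> n k + \<gamma> * jump \<beta> N \<phi> n k)) = 0" for \<phi>
  proof -
    have "(\<Sum>(n, k)\<in>S. v n k * (move m \<phi> n k + \<gamma> * jump \<beta> N \<phi> n k))
        = (\<Sum>s\<in>S. w s * (\<Sum>t\<in>S. (A s t + \<gamma> * B s t) * \<phi> (fst t) (snd t)))"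
      by (intro sum.cong) (auto simp: v_def AB)
    also have "\<dots> = (\<Sum>t\<in>S. (\<Sum>s\<in>S. w s * (A s t + \<gamma> * B s t)) * \<phi> (fst t) (snd t))"
      unfolding sum_distrib_right sum_distrib_left by (subst sum.swap) (simp add: mult.assoc)
    also have "\<dots> = 0" by (simp add: w(4))
    finally show ?thesis .
  qed
  moreover have "(\<Sum>(n, k)\<in>S. v n k) = sum w S"
    by (intro sum.cong) (auto simp: v_def)
  ultimately have "discrete_equilibrium \<beta> N m \<gamma> v"
    using w \<gamma>0 by (auto simp: discrete_equilibrium_def v_def S_def)
  then show ?thesis by (rule that)
qed

section \<open>Balance laws and bounds for the coupling weight\<close>

definition cumul :: "(nat \<Rightarrow> nat \<Rightarrow> real) \<Rightarrow> nat \<Rightarrow> nat \<Rightarrow> real" where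
  "cumul w n k = (\<Sum>j\<le>k. w n j)"

text \<open>
  The condition \<open>1 / m \<le> 2 - \<beta>\<close> keeps the denominator of the coupling weight uniformly positive.
\<close>

locale equilibrium =
  fixes \<beta> :: real and N m :: nat and \<gamma> :: real and w :: "nat \<Rightarrow> nat \<Rightarrow> real"
  assumes \<beta>: "0 < \<beta>" "\<beta> < 2" and N: "7 \<le> N" and m: "2 \<le> m" "1 / real m \<le> 2 - \<beta>"
    and equilibrium: "discrete_equilibrium \<beta> N m \<gamma> w"
begin

definition X :: "nat \<Rightarrow> real" where "X n = cumul w n (m * (N - 6))"

text \<open>
  The discrete counterpart of the boundary value \<open>g n 0\<close>.
\<close>

definition b :: "nat \<Rightarrow> real" where "b n = real m * w n 0"

lemma \<gamma>_pos: "0 < \<gamma>" and w_nonneg: "0 \<le> w n k"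
  and w_outside: "(n, k) \<notin> states N m \<Longrightarrow> w n k = 0"
  using equilibrium by (auto simp: discrete_equilibrium_def)

lemma X_nonneg: "0 \<le> X n" and b_nonneg: "0 \<le> b n"
  by (simp_all add: X_def b_def cumul_def sum_nonneg w_nonneg)

lemma cumul_mono: "j \<le> k \<Longrightarrow> cumul w n j \<le> cumul w n k"
  unfolding cumul_def by (intro sum_mono2) (auto simp: w_nonneg)

lemma cumul_beyond: "m * (N - 6) \<le> k \<Longrightarrow> cumul w n k = X n"
  unfolding X_def cumul_def
  by (intro sum.mono_neutral_right) (auto simp: states_def intro!: w_outside)

lemma cumul_le_X: "cumul w n k \<le> X n"
  using cumul_mono[of k "max k (m * (N - 6))" n] cumul_beyond[of "max k (m * (N - 6))" n] by simp

lemma cumul_truncate: "(\<Sum>j\<le>m * (N - 6). w n j * of_bool (j \<le> k)) = cumul w n k"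
proof -
  have "(\<Sum>j\<le>m * (N - 6). w n j * of_bool (j \<le> k)) = (\<Sum>j\<in>{..m * (N - 6)} \<inter> {..k}. w n j)"
    by (rule sum.mono_neutral_cong_right) auto
  also have "\<dots> = cumul w n k"
    unfolding cumul_def by (intro sum.mono_neutral_left) (auto simp: states_def intro!: w_outside)
  finally show ?thesis .
qed

lemma pick: "(\<Sum>j\<le>m * (N - 6). w n j * (if j = k then F else 0)) = w n k * F" for F :: real
  using w_outside[of n k] by (auto simp: if_distrib[of "\<lambda>x. w n _ * x"] sum.delta states_def cong: if_cong)

lemma X_outside: "n \<notin> {2..N} \<Longrightarrow> X n = 0"
  unfolding X_def cumul_def by (auto simp: states_def intro!: sum.neutral w_outside)

lemma test: "(\<Sum>n=2..N. \<Sum>k\<le>m * (N - 6). w n k * (move m \<phi> n k + \<gamma> * jump \<beta> N \<phi> n k)) = 0"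
  using equilibrium
  by (simp add: discrete_equilibrium_def states_def sum.cartesian_product atLeast0AtMost)

lemma total_mass: "(\<Sum>n=2..N. X n) = 1"
  using equilibrium
  by (simp add: discrete_equilibrium_def states_def sum.cartesian_product atLeast0AtMost X_def cumul_def)

text \<open>
  Stationarity tested with a function of the number of sides. The only effect of transport on such a test function
  is the loss of grains that vanish at area zero.
\<close>

lemma size_balance:
  "(\<Sum>n=2..N. X n * \<phi> n) - (\<Sum>n=2..N. max (6 - real n) 0 * b n * \<phi> n)
   + \<gamma> * (\<Sum>n=2..N. X n * jump \<beta> N (\<lambda>n k. \<phi> n) n 0) = 0"
proof -
  have mv: "move m (\<lambda>n k. \<phi> n) n k
      = \<phi> n - (if k = 0 then real m * max (6 - real n) 0 * \<phi> n else 0)" for n k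
    by (auto simp: move_def drift_def max_mult_distrib_left algebra_simps)
  define J where "J n = jump \<beta> N (\<lambda>n k. \<phi> n) n 0" for n
  have jp: "jump \<beta> N (\<lambda>n k. \<phi> n) n k = J n" for n k
    by (simp add: J_def jump_def)
  have "(\<Sum>k\<le>m * (N - 6). w n k * (move m (\<lambda>n k. \<phi> n) n k + \<gamma> * jump \<beta> N (\<lambda>n k. \<phi> n) n k))
     = X n * \<phi> n - max (6 - real n) 0 * b n * \<phi> n + \<gamma> * (X n * J n)" for n
  proof -
    have "(\<Sum>k\<le>m * (N - 6). w n k * (move m (\<lambda>n k. \<phi> n) n k + \<gamma> * jump \<beta> N (\<lambda>n k. \<phi> n) n k))
      = (\<Sum>k\<le>m * (N - 6). w n k * \<phi> n)
        - (\<Sum>k\<le>m * (N - 6). w n k * (if k = 0 then real m * max (6 - real n) 0 * \<phi> n else 0))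
        + (\<Sum>k\<le>m * (N - 6). w n k * (\<gamma> * J n))"
      unfolding mv jp by (simp only: distrib_left right_diff_distrib sum.distrib sum_subtractf)
    then show ?thesis
      unfolding pick sum_distrib_right[symmetric] by (simp add: X_def cumul_def b_def)
  qed
  then show ?thesis
    using test[of "\<lambda>n k. \<phi> n"] by (simp add: sum.distrib sum_subtractf sum_distrib_left J_def)
qed

lemma position_balance: "(\<Sum>n=2..N. \<Sum>k\<le>m * (N - 6). w n k * move m (\<lambda>n. \<psi>) n k) = 0"
  using test[of "\<lambda>n. \<psi>"] by (simp add: jump_def)

text \<open>
  Discrete polyhedral formula, from conservation of area: the test function \<open>k + 1\<close> makes births and the drift
  term \<open>- k\<close> cancel up to one mesh cell. The shift by one is chosen because \<open>k + 1\<close> vanishes where the dead grains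
  are, so that no boundary term arises.
\<close>

lemma first_moment: "(\<Sum>n=2..N. (real n - 6) * X n) = - 1 / real m"
proof -
  have mv: "move m (\<lambda>n k. real k + 1) n k = real m * (real n - 6) + 1" for n k
  proof -
    have "max (drift m n k) 0 - max (- drift m n k) 0 = drift m n k" by simp
    moreover have "move m (\<lambda>n k. real k + 1) n k = max (drift m n k) 0 - max (- drift m n k) 0 + real k + 1"
      by (cases "k = 0") (simp_all add: move_def of_nat_diff algebra_simps)
    ultimately show ?thesis by (simp add: drift_def)
  qed
  have "(\<Sum>n=2..N. X n * (real m * (real n - 6) + 1)) = 0"
    using position_balance[of "\<lambda>k. real k + 1"] unfolding mv X_def cumul_def sum_distrib_right .
  then have "real m * (\<Sum>n=2..N. (real n - 6) * X n) + (\<Sum>n=2..N. X n) = 0"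
    unfolding sum_distrib_left sum.distrib[symmetric] by (simp add: algebra_simps)
  then show ?thesis
    using m total_mass by (simp add: field_simps add_eq_0_iff)
qed

lemma mean_size: "(\<Sum>n=2..N. real n * X n) = 6 - 1 / real m"
proof -
  have "(\<Sum>n=2..N. (real n - 6) * X n) = (\<Sum>n=2..N. real n * X n) - 6 * (\<Sum>n=2..N. X n)"
    by (simp add: left_diff_distrib sum_subtractf sum_distrib_left)
  then show ?thesis using first_moment total_mass by simp
qed

lemma split_small: "(\<Sum>n=2..N. max (6 - real n) 0 * F n) = (\<Sum>n=2..5. (6 - real n) * F n)"
proof -
  have "(\<Sum>n=2..N. max (6 - real n) 0 * F n) = (\<Sum>n=2..5. max (6 - real n) 0 * F n)"
    using N by (intro sum.mono_neutral_right) auto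
  then show ?thesis by (auto intro!: sum.cong)
qed

text \<open>
  Grains die at total rate one, in balance with the births.
\<close>

lemma outflow_total: "(\<Sum>n=2..5. (6 - real n) * b n) = 1"
  using size_balance[of "\<lambda>n. 1"] total_mass split_small[of b] by (simp add: jump_def)

definition den :: real where
  "den = \<beta> * (real N * X N) - 2 * (\<beta> + 1) * X 2 + (\<Sum>n=2..N. real n * X n)"

definition num :: real where
  "num = (\<Sum>n=2..5. (real n - 6)\<^sup>2 * b n)"

text \<open>
  The discrete coupling weight is \<open>\<gamma>\<close> up to the mesh size. The test function \<open>n - 6\<close> produces the squares in the
  numerator through the deaths and the denominator through the jumps.
\<close>

lemma num_den: "num = \<gamma> * den + 1 / real m"
proof -
  let ?J = "\<lambda>n. jump \<beta> N (\<lambda>n k. real n - 6) n 0"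
  have J: "?J n = - real n + (if n = 2 then 2 * (\<beta> + 1) else 0) - (if n = N then \<beta> * real N else 0)"
    if "n \<in> {2..N}" for n
    using that N by (auto simp: jump_def of_nat_diff algebra_simps)
  have "(\<Sum>n=2..N. X n * ?J n) = (\<Sum>n=2..N. - (real n * X n)
     + (if n = 2 then X n * (2 * (\<beta> + 1)) else 0) - (if n = N then X n * (\<beta> * real N) else 0))"
    using N by (intro sum.cong refl) (auto simp: J algebra_simps)
  also have "\<dots> = - den"
    using N by (simp add: den_def sum.distrib sum_subtractf sum_negf)
  finally have 1: "(\<Sum>n=2..N. X n * ?J n) = - den" .
  have 2: "(\<Sum>n=2..N. max (6 - real n) 0 * b n * (real n - 6)) = - num"
    using split_small[of "\<lambda>n. b n * (real n - 6)"]
    by (simp add: num_def power2_eq_square algebra_simps flip: sum_negf)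
  show ?thesis
    using size_balance[of "\<lambda>n. real n - 6"] first_moment unfolding 1 2 by (simp add: mult.commute)
qed

lemma X_le_1: "X n \<le> 1"
  using member_le_sum[of n "{2..N}" X] X_nonneg total_mass X_outside[of n]
  by (cases "n \<in> {2..N}") auto

text \<open>
  The mean number of sides is about six and the total mass is one, so the negative summand
  \<open>2 * (\<beta> + 1) * X 2\<close> cannot use up the mean if \<open>\<beta> < 2\<close>.
\<close>

lemma den_bounds: "4 - 2 * \<beta> - 1 / real m \<le> den" "den \<le> 6 + 6 * \<beta>"
proof -
  have "real N * X N \<le> (\<Sum>n=2..N. real n * X n)"
    using N by (intro member_le_sum) (auto simp: X_nonneg)
  also have "\<dots> \<le> 6" by (simp add: mean_size)
  finally have "\<beta> * (real N * X N) \<le> \<beta> * 6" using \<beta> by (intro mult_left_mono) auto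
  moreover have "0 \<le> \<beta> * (real N * X N)" using \<beta> X_nonneg by simp
  moreover have "2 * (\<beta> + 1) * X 2 \<le> 2 * (\<beta> + 1) * 1"
    using \<beta> X_le_1 by (intro mult_left_mono) auto
  moreover have "0 \<le> 2 * (\<beta> + 1) * X 2" using \<beta> X_nonneg by simp
  moreover have "0 \<le> 1 / real m" by simp
  ultimately show "4 - 2 * \<beta> - 1 / real m \<le> den" "den \<le> 6 + 6 * \<beta>"
    unfolding den_def mean_size by (simp_all only: mult.commute[of _ 6] mult_1_right distrib_left)
qed

text \<open>
  Compare the weight \<open>(n - 6)\<^sup>2\<close> with \<open>6 - n\<close>, whose sum is the total death rate one.
\<close>

lemma num_bounds: "1 \<le> num" "num \<le> 4"
proof -
  have "(\<Sum>n=2..5. (6 - real n) * b n) \<le> num"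
    unfolding num_def
  proof (rule sum_mono, rule mult_right_mono[OF _ b_nonneg])
    fix n :: nat assume "n \<in> {2..5}"
    then show "6 - real n \<le> (real n - 6)\<^sup>2"
      using mult_left_mono[of 1 "6 - real n" "6 - real n"] by (simp add: power2_eq_square algebra_simps)
  qed
  then show "1 \<le> num" by (simp add: outflow_total)
  have "num \<le> (\<Sum>n=2..5. 4 * ((6 - real n) * b n))"
    unfolding num_def mult.assoc[symmetric]
  proof (rule sum_mono, rule mult_right_mono[OF _ b_nonneg])
    fix n :: nat assume "n \<in> {2..5}"
    then show "(real n - 6)\<^sup>2 \<le> 4 * (6 - real n)"
      using mult_right_mono[of "6 - real n" 4 "6 - real n"] by (simp add: power2_eq_square algebra_simps)
  qed
  then show "num \<le> 4" using outflow_total by (simp flip: sum_distrib_left)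
qed

lemma \<gamma>_lower: "1 - 1 / real m \<le> \<gamma> * (6 + 6 * \<beta>)"
proof -
  have "1 \<le> \<gamma> * den + 1 / real m" using num_den num_bounds(1) by simp
  moreover have "\<gamma> * den \<le> \<gamma> * (6 + 6 * \<beta>)"
    using den_bounds(2) \<gamma>_pos by (intro mult_left_mono) auto
  ultimately show ?thesis by linarith
qed

lemma \<gamma>_bounds: "1 / (12 * (1 + \<beta>)) \<le> \<gamma>" "\<gamma> \<le> 4 / (2 - \<beta>)"
proof -
  have "1 / real m \<le> 1 / 2" using m by (simp add: field_simps)
  then have "1 / 2 \<le> \<gamma> * (6 + 6 * \<beta>)" using \<gamma>_lower by linarith
  then show "1 / (12 * (1 + \<beta>)) \<le> \<gamma>" using \<beta> by (simp add: field_simps)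
  have "2 - \<beta> \<le> den" using den_bounds(1) m(2) by linarith
  then have "\<gamma> * (2 - \<beta>) \<le> \<gamma> * den" using \<gamma>_pos by (intro mult_left_mono) auto
  also have "\<dots> \<le> 4" using num_den num_bounds(2) by (simp add: field_simps) (smt (verit) divide_nonneg_nonneg of_nat_0_le_iff)
  finally show "\<gamma> \<le> 4 / (2 - \<beta>)" using \<beta> by (simp add: field_simps)
qed

end

section \<open>Exponential moments and the flux identity\<close>

context equilibrium
begin

definition size_moment :: "real \<Rightarrow> real" where
  "size_moment \<mu> = (\<Sum>n=2..N. exp (\<mu> * real n) * (real n * X n))"

definition area_moment :: "real \<Rightarrow> nat \<Rightarrow> real" where
  "area_moment \<mu> n = (\<Sum>k\<le>m * (N - 6). w n k * exp (\<mu> * (real k / real m)))"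

text \<open>
  For the test function \<open>exp (\<mu> * n)\<close> the jumps contribute \<open>- \<gamma> * \<delta> * n * exp (\<mu> * n)\<close> apart from a correction
  at \<open>n = 2\<close>, and \<open>\<delta> > 0\<close> holds precisely if \<open>exp \<mu> < 1 + 1 / \<beta>\<close>. Because of the factor \<open>n\<close> this dominates the birth
  term for large \<open>n\<close>. The right-hand side contains the bounds for \<open>\<gamma>\<close> only and so does not depend on \<open>N\<close> and \<open>m\<close>.
\<close>

lemma size_exponential_moment:
  assumes "0 < \<mu>" and "\<beta> * exp \<mu> < \<beta> + 1"
  defines "\<delta> \<equiv> (1 - exp (- \<mu>)) * (\<beta> + 1 - \<beta> * exp \<mu>)"
    and "g0 \<equiv> 1 / (12 * (1 + \<beta>))" and "g1 \<equiv> 4 / (2 - \<beta>)"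
  shows "size_moment \<mu>
    \<le> 2 / (g0 * \<delta>) * (exp (2 * \<mu> / (g0 * \<delta>)) + g1 * (2 * (\<beta> + 1) * exp (2 * \<mu>)))"
proof -
  define S where "S = (\<Sum>n=2..N. exp (\<mu> * real n) * (real n * X n))"
  have \<delta>: "0 < \<delta>" unfolding \<delta>_def using assms(1,2) by (intro mult_pos_pos) auto
  have g0: "0 < g0" "g0 \<le> \<gamma>" "\<gamma> \<le> g1" using \<beta> \<gamma>_bounds by (auto simp: g0_def g1_def)
  have S0: "0 \<le> S" unfolding S_def by (intro sum_nonneg) (auto simp: X_nonneg)
  let ?J = "\<lambda>n. jump \<beta> N (\<lambda>n k. exp (\<mu> * real n)) n 0"
  have J: "?J n \<le> - (\<delta> * (real n * exp (\<mu> * real n))) + (if n = 2 then 2 * (\<beta> + 1) * exp (2 * \<mu>) else 0)"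
    if "n \<in> {2..N}" for n
  proof -
    have n: "2 \<le> n" using that by simp
    define q where "q = exp (\<mu> * real n)"
    have q: "0 < q" by (simp add: q_def)
    have e1: "exp (\<mu> * real (Suc n)) = q * exp \<mu>"
      by (simp add: q_def exp_add[symmetric] algebra_simps)
    have e2: "exp (\<mu> * real (n - 1)) = q * exp (- \<mu>)"
      using n by (simp add: q_def exp_add[symmetric] algebra_simps of_nat_diff)
    have "?J n = (if n < N then \<beta> * real n else 0) * (q * (exp \<mu> - 1))
        - (if 2 < n then (\<beta> + 1) * real n else 0) * (q * (1 - exp (- \<mu>)))"
      unfolding jump_def e1 e2 q_def[symmetric] by (simp add: algebra_simps)
    moreover have "(if n < N then \<beta> * real n else 0) * (q * (exp \<mu> - 1)) \<le> \<beta> * real n * (q * (exp \<mu> - 1))"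
      using \<beta> q assms(1) by (intro mult_right_mono) auto
    moreover have "(\<beta> + 1) * real n * (q * (1 - exp (- \<mu>))) - (if n = 2 then 2 * (\<beta> + 1) * exp (2 * \<mu>) else 0)
        \<le> (if 2 < n then (\<beta> + 1) * real n else 0) * (q * (1 - exp (- \<mu>)))"
    proof (cases "n = 2")
      case True
      then have "q = exp (2 * \<mu>)" by (simp add: q_def mult.commute)
      moreover have "2 * (\<beta> + 1) * q * (1 - exp (- \<mu>)) \<le> 2 * (\<beta> + 1) * q * 1"
        using \<beta> q by (intro mult_left_mono) auto
      ultimately show ?thesis using True by (simp add: algebra_simps)
    qed (use n in simp)
    moreover have "\<beta> * real n * (q * (exp \<mu> - 1)) - (\<beta> + 1) * real n * (q * (1 - exp (- \<mu>)))
        = - (\<delta> * (real n * q))"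
    proof -
      have "exp \<mu> * exp (- \<mu>) = 1" by (simp flip: exp_add)
      then have "exp \<mu> - 1 = exp \<mu> * (1 - exp (- \<mu>))" by (simp add: algebra_simps)
      then show ?thesis by (simp add: \<delta>_def algebra_simps)
    qed
    ultimately show ?thesis unfolding q_def by linarith
  qed
  have "(\<Sum>n=2..N. X n * ?J n)
      \<le> (\<Sum>n=2..N. X n * (- (\<delta> * (real n * exp (\<mu> * real n))) + (if n = 2 then 2 * (\<beta> + 1) * exp (2 * \<mu>) else 0)))"
    by (intro sum_mono mult_left_mono J X_nonneg)
  also have "\<dots> = - (\<delta> * S) + (\<Sum>n=2..N. (if n = 2 then X n * (2 * (\<beta> + 1) * exp (2 * \<mu>)) else 0))"
    unfolding S_def sum_distrib_left sum_negf[symmetric] sum.distrib[symmetric]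
    by (intro sum.cong) (auto simp: algebra_simps)
  also have "\<dots> = - (\<delta> * S) + X 2 * (2 * (\<beta> + 1) * exp (2 * \<mu>))" using N by simp
  also have "\<dots> \<le> - (\<delta> * S) + 1 * (2 * (\<beta> + 1) * exp (2 * \<mu>))"
    using X_le_1 \<beta> by (intro add_left_mono mult_right_mono) auto
  finally have "\<gamma> * (\<Sum>n=2..N. X n * ?J n) \<le> \<gamma> * (- (\<delta> * S) + 2 * (\<beta> + 1) * exp (2 * \<mu>))"
    using \<gamma>_pos by (intro mult_left_mono) auto
  moreover have "0 \<le> (\<Sum>n=2..N. max (6 - real n) 0 * b n * exp (\<mu> * real n))"
    by (intro sum_nonneg) (auto simp: b_nonneg)
  ultimately have "\<gamma> * (\<delta> * S) \<le> (\<Sum>n=2..N. X n * exp (\<mu> * real n)) + \<gamma> * (2 * (\<beta> + 1) * exp (2 * \<mu>))"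
    using size_balance[of "\<lambda>n. exp (\<mu> * real n)"] by (simp add: algebra_simps)
  also have "(\<Sum>n=2..N. X n * exp (\<mu> * real n))
      \<le> (\<Sum>n=2..N. X n * (g0 * \<delta> / 2 * (real n * exp (\<mu> * real n)) + exp (2 * \<mu> / (g0 * \<delta>))))"
  proof (intro sum_mono mult_left_mono X_nonneg)
    fix n
    show "exp (\<mu> * real n) \<le> g0 * \<delta> / 2 * (real n * exp (\<mu> * real n)) + exp (2 * \<mu> / (g0 * \<delta>))"
    proof (cases "2 \<le> g0 * \<delta> * real n")
      case True
      then have "2 * exp (\<mu> * real n) \<le> (g0 * \<delta> * real n) * exp (\<mu> * real n)"
        by (intro mult_right_mono) auto
      then have "exp (\<mu> * real n) \<le> g0 * \<delta> / 2 * (real n * exp (\<mu> * real n))" by (simp add: algebra_simps)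
      then show ?thesis by (meson add_increasing2 exp_ge_zero)
    next
      case False
      then have "real n \<le> 2 / (g0 * \<delta>)" using g0 \<delta> by (simp add: field_simps)
      then have "\<mu> * real n \<le> \<mu> * (2 / (g0 * \<delta>))" using assms(1) by (intro mult_left_mono) auto
      then have "exp (\<mu> * real n) \<le> exp (2 * \<mu> / (g0 * \<delta>))" by (simp add: mult.commute)
      moreover have "0 \<le> g0 * \<delta> / 2 * (real n * exp (\<mu> * real n))" using g0 \<delta> by simp
      ultimately show ?thesis by linarith
    qed
  qed
  also have "\<dots> = g0 * \<delta> / 2 * S + exp (2 * \<mu> / (g0 * \<delta>))"
    unfolding distrib_left sum.distrib sum_distrib_right[symmetric] total_mass S_def sum_distrib_left
    by (simp add: algebra_simps)
  finally have "\<gamma> * (\<delta> * S) \<le> g0 * \<delta> / 2 * S + exp (2 * \<mu> / (g0 * \<delta>)) + \<gamma> * (2 * (\<beta> + 1) * exp (2 * \<mu>))"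
    by simp
  moreover have "g0 * (\<delta> * S) \<le> \<gamma> * (\<delta> * S)"
    using g0 \<delta> S0 by (intro mult_right_mono) auto
  moreover have "\<gamma> * (2 * (\<beta> + 1) * exp (2 * \<mu>)) \<le> g1 * (2 * (\<beta> + 1) * exp (2 * \<mu>))"
    using g0 \<beta> by (intro mult_right_mono) auto
  ultimately have "g0 * \<delta> / 2 * S \<le> exp (2 * \<mu> / (g0 * \<delta>)) + g1 * (2 * (\<beta> + 1) * exp (2 * \<mu>))"
    by (simp add: algebra_simps)
  then show ?thesis
    unfolding size_moment_def S_def[symmetric] using g0 \<delta> by (simp add: field_simps)
qed

text \<open>
  Where \<open>x = k / m\<close> exceeds \<open>n - 6\<close> by more than \<open>D\<close>, the inward drift makes \<open>exp (\<mu> * x)\<close> decay faster than births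
  can compensate. In the remaining states \<open>exp (\<mu> * x)\<close> is at most a constant times \<open>exp (\<mu> * n)\<close>, for which the
  previous moment is available.
\<close>

lemma area_exponential_moment:
  assumes \<mu>: "0 < \<mu>"
  defines "D \<equiv> 2 * exp \<mu> / \<mu>"
  shows "(\<Sum>n=2..N. area_moment \<mu> n) \<le> (\<mu> * exp \<mu> + 2 * exp (\<mu> * D)) * size_moment \<mu>"
proof -
  define K where "K = m * (N - 6)"
  define S where "S = (\<Sum>n=2..N. exp (\<mu> * real n) * (real n * X n))"
  define t where "t = \<mu> / real m"
  define E where "E k = exp (\<mu> * (real k / real m))" for k
  define d where "d n k = real n - 6 - real k / real m" for n k
  have E0: "0 \<le> E k" for k by (simp add: E_def)
  have mp: "0 < real m" using m by simp
  have t: "0 < t" "t \<le> \<mu>" using \<mu> m by (auto simp: t_def field_simps)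
  have drift: "drift m n k = real m * d n k" for n k
    using m by (simp add: drift_def d_def field_simps)
  have up: "exp t - 1 \<le> t * exp \<mu>"
  proof -
    have "1 - t \<le> exp (- t)" using exp_ge_add_one_self[of "- t"] by simp
    then have "exp t * (1 - t) \<le> exp t * exp (- t)" by (intro mult_left_mono) auto
    then have "exp t - 1 \<le> t * exp t" by (simp add: algebra_simps flip: exp_add)
    also have "\<dots> \<le> t * exp \<mu>" using t by (intro mult_left_mono) auto
    finally show ?thesis .
  qed
  have dn: "t * exp (- \<mu>) \<le> 1 - exp (- t)"
  proof -
    have "1 + t \<le> exp t" by (rule exp_ge_add_one_self)
    then have "exp (- t) * (1 + t) \<le> exp (- t) * exp t" by (intro mult_left_mono) auto
    then have "t * exp (- t) \<le> 1 - exp (- t)" by (simp add: algebra_simps flip: exp_add)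
    moreover have "t * exp (- \<mu>) \<le> t * exp (- t)" using t by (intro mult_left_mono) auto
    ultimately show ?thesis by simp
  qed
  have tm: "t * real m = \<mu>" using mp by (simp add: t_def)
  have mv: "move m (\<lambda>n. E) n k
     \<le> E k * (\<mu> * exp \<mu> * max (d n k) 0) - E k * (\<mu> * exp (- \<mu>) * max (- d n k) 0 - 1)" for n k
  proof -
    have pos: "max (drift m n k) 0 = real m * max (d n k) 0"
      and neg: "max (- drift m n k) 0 = real m * max (- d n k) 0"
      using mp by (simp_all add: drift max_mult_distrib_left)
    have E1: "E (Suc k) = E k * exp t" for k
      by (simp add: E_def t_def exp_add[symmetric] add_divide_distrib algebra_simps)
    have "max (drift m n k) 0 * (E (Suc k) - E k) = max (drift m n k) 0 * (E k * (exp t - 1))"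
      by (simp add: E1 algebra_simps)
    also have "\<dots> \<le> max (drift m n k) 0 * (E k * (t * exp \<mu>))"
      by (intro mult_left_mono up E0) auto
    also have "\<dots> = E k * (t * real m * exp \<mu> * max (d n k) 0)"
      unfolding pos by (simp add: algebra_simps)
    finally have a: "max (drift m n k) 0 * (E (Suc k) - E k) \<le> E k * (\<mu> * exp \<mu> * max (d n k) 0)"
      unfolding tm .
    have "(if k = 0 then 0 else E (k - 1)) \<le> E k * exp (- t)"
    proof (cases k)
      case (Suc j)
      moreover have "exp t * exp (- t) = 1" by (simp flip: exp_add)
      ultimately show ?thesis using E1[of j] by (simp add: mult.assoc)
    qed (simp add: E0)
    then have "(if k = 0 then 0 else E (k - 1)) - E k \<le> - (E k * (1 - exp (- t)))"
      by (simp add: algebra_simps)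
    also have "\<dots> \<le> - (E k * (t * exp (- \<mu>)))"
      by (intro le_imp_neg_le mult_left_mono dn E0)
    finally have "max (- drift m n k) 0 * ((if k = 0 then 0 else E (k - 1)) - E k)
        \<le> max (- drift m n k) 0 * - (E k * (t * exp (- \<mu>)))"
      by (intro mult_left_mono) auto
    also have "\<dots> = - (E k * (t * real m * exp (- \<mu>) * max (- d n k) 0))"
      unfolding neg by (simp add: algebra_simps)
    finally have b: "max (- drift m n k) 0 * ((if k = 0 then 0 else E (k - 1)) - E k)
        \<le> - (E k * (\<mu> * exp (- \<mu>) * max (- d n k) 0))"
      unfolding tm .
    show ?thesis unfolding move_def using a b by (simp add: algebra_simps)
  qed
  have split: "E k \<le> E k * (\<mu> * exp (- \<mu>) * max (- d n k) 0 - 1) + 2 * exp (\<mu> * D) * exp (\<mu> * real n)" for n k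
  proof (cases "D \<le> - d n k")
    case True
    have "2 = \<mu> * exp (- \<mu>) * D" using \<mu> by (simp add: D_def exp_minus field_simps)
    also have "\<dots> \<le> \<mu> * exp (- \<mu>) * max (- d n k) 0" using True \<mu> by (intro mult_left_mono) auto
    finally have "E k * 1 \<le> E k * (\<mu> * exp (- \<mu>) * max (- d n k) 0 - 1)"
      by (intro mult_left_mono E0) auto
    then show ?thesis by (simp add: add_increasing2)
  next
    case False
    then have "\<mu> * (real k / real m) \<le> \<mu> * (D + real n)" using \<mu> by (intro mult_left_mono) (auto simp: d_def)
    then have "E k \<le> exp (\<mu> * D) * exp (\<mu> * real n)"
      unfolding E_def by (simp add: distrib_left flip: exp_add)
    moreover have "0 \<le> E k * (\<mu> * exp (- \<mu>) * max (- d n k) 0)"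
      using \<mu> E0 by simp
    ultimately show ?thesis by (simp add: algebra_simps)
  qed
  have n1: "2 * exp (\<mu> * D) * exp (\<mu> * real n) * X n \<le> 2 * exp (\<mu> * D) * (exp (\<mu> * real n) * (real n * X n))"
    if "n \<in> {2..N}" for n
    using that X_nonneg[of n] mult_right_mono[of 1 "real n" "X n"] by simp
  have far: "E k * (\<mu> * exp \<mu> * max (d n k) 0) \<le> \<mu> * exp \<mu> * (exp (\<mu> * real n) * real n)" for n k
  proof (cases "0 \<le> d n k")
    case True
    have "real k / real m \<le> real n" using True by (simp add: d_def)
    then have "E k \<le> exp (\<mu> * real n)" unfolding E_def using \<mu> by (simp only: exp_le_cancel_iff mult_le_cancel_left_pos)
    moreover have "0 \<le> real k / real m" by simp
    then have "max (d n k) 0 \<le> real n" unfolding d_def by linarith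
    ultimately have "E k * max (d n k) 0 \<le> exp (\<mu> * real n) * real n"
      by (intro mult_mono) auto
    then have "\<mu> * exp \<mu> * (E k * max (d n k) 0) \<le> \<mu> * exp \<mu> * (exp (\<mu> * real n) * real n)"
      using \<mu> by (intro mult_left_mono) auto
    then show ?thesis by (simp add: algebra_simps)
  qed (use \<mu> in simp)
  define F where "F n k = E k * (\<mu> * exp (- \<mu>) * max (- d n k) 0 - 1)" for n k
  have "(\<Sum>n=2..N. \<Sum>k\<le>K. w n k * E k) \<le> (\<Sum>n=2..N. \<Sum>k\<le>K. w n k * F n k + w n k * (2 * exp (\<mu> * D) * exp (\<mu> * real n)))"
    unfolding F_def distrib_left[symmetric] by (intro sum_mono mult_left_mono split w_nonneg)
  also have "\<dots> = (\<Sum>n=2..N. \<Sum>k\<le>K. w n k * F n k) + (\<Sum>n=2..N. 2 * exp (\<mu> * D) * exp (\<mu> * real n) * X n)"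
    by (simp add: sum.distrib X_def cumul_def K_def sum_distrib_left sum_distrib_right algebra_simps)
  also have "(\<Sum>n=2..N. 2 * exp (\<mu> * D) * exp (\<mu> * real n) * X n) \<le> (\<Sum>n=2..N. 2 * exp (\<mu> * D) * (exp (\<mu> * real n) * (real n * X n)))"
    by (intro sum_mono n1)
  also have "\<dots> = 2 * exp (\<mu> * D) * S" by (simp add: S_def sum_distrib_left)
  also have "(\<Sum>n=2..N. \<Sum>k\<le>K. w n k * F n k) \<le> (\<Sum>n=2..N. \<Sum>k\<le>K. w n k * (\<mu> * exp \<mu> * (exp (\<mu> * real n) * real n)) - w n k * move m (\<lambda>n. E) n k)"
  proof (intro sum_mono)
    fix n k
    have "F n k \<le> \<mu> * exp \<mu> * (exp (\<mu> * real n) * real n) - move m (\<lambda>n. E) n k"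
      using mv[of n k] far[of k n] unfolding F_def by linarith
    from mult_left_mono[OF this w_nonneg[of n k]]
    show "w n k * F n k \<le> w n k * (\<mu> * exp \<mu> * (exp (\<mu> * real n) * real n)) - w n k * move m (\<lambda>n. E) n k"
      by (simp add: right_diff_distrib)
  qed
  also have "\<dots> = (\<Sum>n=2..N. \<mu> * exp \<mu> * (exp (\<mu> * real n) * (real n * X n)))"
    using position_balance[of E]
    by (simp add: sum_subtractf X_def cumul_def K_def sum_distrib_left sum_distrib_right algebra_simps)
  also have "\<dots> = \<mu> * exp \<mu> * S" by (simp add: S_def sum_distrib_left)
  finally show ?thesis by (simp add: area_moment_def size_moment_def E_def K_def S_def algebra_simps)
qed

text \<open>
  Balance for the set of grains with \<open>n\<close> sides and area at most \<open>k / m\<close>: the discrete form of the profile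
  equation, integrated once. Only one of the two jump terms on the left is present, the one that goes with the
  direction of the drift, so the identity determines the density.
\<close>

lemma flux:
  assumes n: "n \<in> {2..N}"
  shows "max (drift m n k) 0 * w n k - max (- drift m n (Suc k)) 0 * w n (Suc k) + max (6 - real n) 0 * b n
    = cumul w n k + \<gamma> * coupling \<beta> (enat N) (\<lambda>j. cumul w j k) n"
proof -
  define K where "K = m * (N - 6)"
  define \<phi> where "\<phi> n' j = (of_bool (n' = n \<and> j \<le> k) :: real)" for n' j
  define up where "up n = (if n < N then \<beta> * real n else 0)" for n
  define dn where "dn n = (if 2 < n then (\<beta> + 1) * real n else 0)" for n
  have mv: "move m \<phi> n j = of_bool (j \<le> k) - (if j = k then max (drift m n k) 0 else 0)
       + (if j = Suc k then max (- drift m n (Suc k)) 0 else 0)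
       - (if j = 0 then real m * max (6 - real n) 0 else 0)" for j
  proof -
    have "max (- drift m n 0) 0 = real m * max (6 - real n) 0"
      by (simp add: drift_def max_mult_distrib_left algebra_simps)
    then show ?thesis by (cases j) (auto simp: move_def \<phi>_def)
  qed
  have "(\<Sum>j\<le>K. w n j * move m \<phi> n j) = cumul w n k - max (drift m n k) 0 * w n k
      + max (- drift m n (Suc k)) 0 * w n (Suc k) - max (6 - real n) 0 * b n"
    unfolding mv distrib_left right_diff_distrib sum.distrib sum_subtractf K_def pick cumul_truncate
    by (simp add: b_def algebra_simps)
  moreover have "(\<Sum>j\<le>K. w n' j * move m \<phi> n' j) = 0" if "n' \<noteq> n" for n'
  proof -
    have "move m \<phi> n' j = 0" for j
      using that by (cases j) (simp_all add: move_def \<phi>_def)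
    then show ?thesis by simp
  qed
  then have "(\<Sum>n'=2..N. \<Sum>j\<le>K. w n' j * move m \<phi> n' j) = (\<Sum>j\<le>K. w n j * move m \<phi> n j)"
    using n by (subst sum.remove[of _ n]) auto
  moreover have "(\<Sum>n'=2..N. \<Sum>j\<le>K. w n' j * jump \<beta> N \<phi> n' j) = coupling \<beta> (enat N) (\<lambda>j. cumul w j k) n"
  proof -
    have jp: "jump \<beta> N \<phi> n' j = (of_bool (Suc n' = n) * up n' + of_bool (n' = Suc n) * dn n'
        - of_bool (n' = n) * (up n + dn n)) * of_bool (j \<le> k)" if "n' \<in> {2..N}" for n' j
    proof -
      have "n' - 1 = n \<longleftrightarrow> n' = Suc n" using that by auto
      then show ?thesis
        by (auto simp: jump_def \<phi>_def up_def[symmetric] dn_def[symmetric] algebra_simps)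
    qed
    have "(\<Sum>n'=2..N. \<Sum>j\<le>K. w n' j * jump \<beta> N \<phi> n' j)
       = (\<Sum>n'=2..N. (of_bool (Suc n' = n) * up n' + of_bool (n' = Suc n) * dn n'
        - of_bool (n' = n) * (up n + dn n)) * cumul w n' k)"
      unfolding cumul_truncate[symmetric] K_def sum_distrib_left
      by (intro sum.cong refl) (simp add: jp algebra_simps)
    also have "\<dots> = (\<Sum>n'=2..N. if n' = n - 1 then up n' * cumul w n' k else 0)
       + (\<Sum>n'=2..N. if n' = Suc n then dn n' * cumul w n' k else 0)
       - (\<Sum>n'=2..N. if n' = n then (up n + dn n) * cumul w n' k else 0)"
      unfolding sum.distrib[symmetric] sum_subtractf[symmetric]
      using n by (intro sum.cong refl) (auto simp: algebra_simps)
    also have "\<dots> = coupling \<beta> (enat N) (\<lambda>j. cumul w j k) n"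
    proof -
      consider "n = 2" | "n = N" | "2 < n" "n < N" using n by fastforce
      then show ?thesis
        using N n by cases (auto simp: coupling_def up_def dn_def of_nat_diff algebra_simps)
    qed
    finally show ?thesis .
  qed
  ultimately show ?thesis
    using test[of \<phi>] unfolding K_def
    by (simp add: distrib_left sum.distrib mult.left_commute[of _ \<gamma>] flip: sum_distrib_left)
qed

end

section \<open>Regularity of the discrete distribution functions\<close>

text \<open>
  An explicit bound for both the flux and its Lipschitz constant as a function of the distribution functions; the
  factor \<open>4 / (2 - \<beta>)\<close> is the upper bound for \<open>\<gamma>\<close>.
\<close>

definition flux_bound :: "real \<Rightarrow> nat \<Rightarrow> real" where
  "flux_bound \<beta> n = 2 + 4 / (2 - \<beta>) * ((4 * \<beta> + 4) * (real n + 1))"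

lemma abs_coupling_le:
  assumes "0 < \<beta>" "2 \<le> n"
    and f: "\<bar>f (n - 1)\<bar> \<le> M" "\<bar>f n\<bar> \<le> M" "\<bar>f (Suc n)\<bar> \<le> M"
  shows "\<bar>coupling \<beta> N f n\<bar> \<le> (4 * \<beta> + 4) * (real n + 1) * M"
proof -
  have M: "0 \<le> M" using f(1) by linarith
  have c: "\<bar>c * f j\<bar> \<le> c * M" if "0 \<le> c" "\<bar>f j\<bar> \<le> M" for c j
    using that by (simp add: abs_mult mult_left_mono)
  have 1: "\<bar>(\<beta> + 1) * (real n + 1) * f (Suc n)\<bar> \<le> (\<beta> + 1) * (real n + 1) * M"
    using assms by (intro c) auto
  have 2: "\<bar>(2 * \<beta> + 1) * real n * f n\<bar> \<le> (2 * \<beta> + 1) * real n * M"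
    using assms by (intro c) auto
  have 3: "\<bar>\<beta> * (real n - 1) * f (n - 1)\<bar> \<le> \<beta> * (real n - 1) * M"
    using assms by (intro c) auto
  have 4: "\<bar>(\<beta> + 1) * real n * f n\<bar> \<le> (\<beta> + 1) * real n * M"
    using assms by (intro c) auto
  have 5: "\<bar>2 * \<beta> * f n\<bar> \<le> 2 * \<beta> * M"
    using assms by (intro c) auto
  have nM: "0 \<le> real n * M" "0 \<le> \<beta> * M" "0 \<le> \<beta> * (real n * M)" using M assms by auto
  consider "n = 2" | "n \<noteq> 2" "enat n = N" | "n \<noteq> 2" "enat n \<noteq> N" by blast
  then show ?thesis
  proof cases
    case 1
    have "\<bar>3 * (\<beta> + 1) * f 3 - 2 * \<beta> * f 2\<bar> \<le> 3 * (\<beta> + 1) * M + 2 * \<beta> * M"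
      using 5 \<open>\<bar>(\<beta> + 1) * (real n + 1) * f (Suc n)\<bar> \<le> _\<close> 1
      by (simp add: eval_nat_numeral algebra_simps)
    also have "\<dots> \<le> (4 * \<beta> + 4) * 3 * M" using nM M by (simp add: algebra_simps)
    finally show ?thesis using 1 by (simp add: coupling_def)
  next
    case 2
    have "\<bar>coupling \<beta> N f n\<bar> \<le> \<beta> * (real n - 1) * M + (\<beta> + 1) * real n * M"
      using 2 3 4 by (simp add: coupling_def)
    also have "\<dots> \<le> (4 * \<beta> + 4) * (real n + 1) * M" using nM M by (simp add: algebra_simps)
    finally show ?thesis .
  next
    case 3
    have "\<bar>coupling \<beta> N f n\<bar> \<le> (\<beta> + 1) * (real n + 1) * M + (2 * \<beta> + 1) * real n * M + \<beta> * (real n - 1) * M"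
      using 3 \<open>\<bar>\<beta> * (real n - 1) * f (n - 1)\<bar> \<le> _\<close> 1 2 by (simp add: coupling_def)
    also have "\<dots> \<le> (4 * \<beta> + 4) * (real n + 1) * M" using nM M by (simp add: algebra_simps)
    finally show ?thesis .
  qed
qed

lemma coupling_diff: "coupling \<beta> N f n - coupling \<beta> N g n = coupling \<beta> N (\<lambda>j. f j - g j) n"
  by (simp add: coupling_def algebra_simps)

text \<open>
  Truncating the natural number \<open>\<lfloor>m * x\<rfloor> + 1\<close> at zero makes this the distribution function on the whole line.
\<close>

definition cdf :: "nat \<Rightarrow> (nat \<Rightarrow> nat \<Rightarrow> real) \<Rightarrow> nat \<Rightarrow> real \<Rightarrow> real" where
  "cdf m w n x = (\<Sum>k<nat (\<lfloor>real m * x\<rfloor> + 1). w n k)"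

lemma cdf_negative: "x < 0 \<Longrightarrow> 0 < m \<Longrightarrow> cdf m w n x = 0"
proof -
  assume "x < 0" "0 < m"
  then have "\<lfloor>real m * x\<rfloor> < 0" using mult_pos_neg[of "real m" x] by (simp only: floor_less_zero of_nat_0_less_iff)
  then have "\<lfloor>real m * x\<rfloor> + 1 \<le> 0" by linarith
  then have "nat (\<lfloor>real m * x\<rfloor> + 1) = 0" by (rule nat_0_iff[THEN iffD2])
  then show ?thesis by (simp add: cdf_def)
qed

lemma cdf_cumul: "0 \<le> x \<Longrightarrow> cdf m w n x = cumul w n (nat \<lfloor>real m * x\<rfloor>)"
  by (simp add: cdf_def cumul_def nat_add_distrib lessThan_Suc_atMost)

context equilibrium
begin

text \<open>
  The discrete version of \<open>(\<xi> - (n - 6)) * g n \<xi>\<close>.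
\<close>

definition rhs :: "nat \<Rightarrow> nat \<Rightarrow> real" where
  "rhs n k = max (6 - real n) 0 * b n - cumul w n k - \<gamma> * coupling \<beta> (enat N) (\<lambda>j. cumul w j k) n"

lemma m_pos: "0 < m" "0 < real m" using m by auto

text \<open>
  As the drift is an integer, no cell of the mesh contains a sign change of the velocity in its interior.
\<close>

lemma drift_cases: "drift m n k \<le> -1 \<or> drift m n k = 0 \<or> 1 \<le> drift m n k"
proof -
  define i where "i = int m * (int n - 6) - int k"
  have "drift m n k = of_int i" by (simp add: drift_def i_def)
  moreover have "i \<le> - 1 \<or> i = 0 \<or> 1 \<le> i" by arith
  ultimately show ?thesis by force
qed

lemma drift_Suc: "drift m n (Suc k) = drift m n k - 1"
  by (simp add: drift_def)

lemma drift_position: "drift m n k = - (real m * (real k / real m - (real n - 6)))"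
  using m_pos by (simp add: drift_def field_simps)

lemma flux_left:
  assumes "n \<in> {2..N}" "0 < drift m n k"
  shows "drift m n k * w n k = - rhs n k"
  using flux[OF assms(1), of k] drift_cases[of n k] assms(2)
  by (auto simp: rhs_def drift_Suc)

lemma flux_right:
  assumes "n \<in> {2..N}" "drift m n k \<le> 0"
  shows "- drift m n (Suc k) * w n (Suc k) = rhs n k"
  using flux[OF assms(1), of k] assms(2) by (simp add: rhs_def drift_Suc algebra_simps)

lemma cumul_bounds: "0 \<le> cumul w n k" "cumul w n k \<le> 1"
  using cumul_le_X[of n k] X_le_1[of n] by (auto simp: cumul_def sum_nonneg w_nonneg)

text \<open>
  A single summand of the total death rate.
\<close>

lemma outflow_le_1: "2 \<le> n \<Longrightarrow> max (6 - real n) 0 * b n \<le> 1"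
proof (cases "n \<le> 5")
  case True
  assume "2 \<le> n"
  then have "(6 - real n) * b n \<le> (\<Sum>n=2..5. (6 - real n) * b n)"
    using True by (intro member_le_sum) (auto intro!: mult_nonneg_nonneg b_nonneg)
  then show ?thesis using True by (simp add: outflow_total)
qed auto

lemma rhs_bound: "2 \<le> n \<Longrightarrow> \<bar>rhs n k\<bar> \<le> flux_bound \<beta> n"
proof -
  assume n: "2 \<le> n"
  have "\<bar>coupling \<beta> (enat N) (\<lambda>j. cumul w j k) n\<bar> \<le> (4 * \<beta> + 4) * (real n + 1) * 1"
    using \<beta> n cumul_bounds by (intro abs_coupling_le) auto
  then have "\<gamma> * \<bar>coupling \<beta> (enat N) (\<lambda>j. cumul w j k) n\<bar> \<le> 4 / (2 - \<beta>) * ((4 * \<beta> + 4) * (real n + 1))"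
    using \<gamma>_bounds(2) \<gamma>_pos \<beta> by (intro mult_mono) auto
  then have "\<bar>\<gamma> * coupling \<beta> (enat N) (\<lambda>j. cumul w j k) n\<bar> \<le> 4 / (2 - \<beta>) * ((4 * \<beta> + 4) * (real n + 1))"
    using \<gamma>_pos by (simp add: abs_mult)
  moreover have "0 \<le> max (6 - real n) 0 * b n" by (simp add: b_nonneg)
  ultimately show ?thesis
    using outflow_le_1[OF n] cumul_bounds[of n k] unfolding rhs_def flux_bound_def by linarith
qed

lemma flux_bound_ge_2: "2 \<le> flux_bound \<beta> n"
  using \<beta> by (simp add: flux_bound_def)

text \<open>
  The density \<open>m * w n k\<close> is bounded by a multiple of the inverse distance to the rest point \<open>n - 6\<close>. The cell
  \<open>k = 0\<close> is not reached by the flux identity if the drift points to the left; there the density is the boundary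
  value, which the death rate bounds.
\<close>

lemma density_bound:
  assumes n: "2 \<le> n"
  shows "real m * w n k * \<bar>real k / real m - (real n - 6)\<bar> \<le> flux_bound \<beta> n"
proof (cases "n \<le> N")
  case False
  then have "w n k = 0" by (intro w_outside) (simp add: states_def)
  then show ?thesis using flux_bound_ge_2[of n] by simp
next
  case True
  then have nN: "n \<in> {2..N}" using n by simp
  have "\<bar>drift m n k\<bar> * w n k \<le> flux_bound \<beta> n"
  proof -
    consider "0 < drift m n k" | "drift m n k = 0" | "drift m n k < 0" by linarith
    then show ?thesis
    proof cases
      case 1
      then show ?thesis using flux_left[OF nN 1] rhs_bound[OF n, of k] by simp
    next
      case 2
      then show ?thesis using flux_bound_ge_2[of n] by simp
    next
      case 3
      show ?thesis
      proof (cases k)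
        case 0
        have "\<bar>drift m n k\<bar> * w n k = max (6 - real n) 0 * b n"
          using 3 0 m_pos by (simp add: drift_def b_def algebra_simps mult_less_0_iff)
        then show ?thesis using outflow_le_1[OF n] flux_bound_ge_2[of n] by simp
      next
        case (Suc j)
        then have "drift m n j \<le> 0" using 3 drift_cases[of n k] drift_Suc[of n j] by auto
        from flux_right[OF nN this] rhs_bound[OF n, of j] 3 Suc show ?thesis by simp
      qed
    qed
  qed
  moreover have "\<bar>drift m n k\<bar> = real m * \<bar>real k / real m - (real n - 6)\<bar>"
    unfolding drift_position by (simp add: abs_mult)
  ultimately show ?thesis by (simp only: mult.assoc mult.commute[of "w n k"])
qed

lemma cdf_diff:
  assumes "p \<le> q"
  shows "cdf m w n q - cdf m w n p = (\<Sum>k=nat (\<lfloor>real m * p\<rfloor> + 1)..<nat (\<lfloor>real m * q\<rfloor> + 1). w n k)"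
proof -
  have "real m * p \<le> real m * q" using assms by (intro mult_left_mono) auto
  then have "nat (\<lfloor>real m * p\<rfloor> + 1) \<le> nat (\<lfloor>real m * q\<rfloor> + 1)"
    by (intro nat_mono add_mono floor_mono) auto
  then show ?thesis
    unfolding cdf_def lessThan_atLeast0 by (intro sum_diff_nat_ivl) auto
qed

lemma cdf_mono: "p \<le> q \<Longrightarrow> cdf m w n p \<le> cdf m w n q"
  using cdf_diff[of p q n] sum_nonneg[of _ "w n"] w_nonneg by (metis diff_ge_0_iff_ge)

lemma cdf_bounds: "0 \<le> cdf m w n x" "cdf m w n x \<le> X n"
proof -
  show "0 \<le> cdf m w n x" by (simp add: cdf_def sum_nonneg w_nonneg)
  show "cdf m w n x \<le> X n"
    using cdf_cumul[of x m w n] cdf_negative[of x m w n] cumul_le_X[of n] X_nonneg[of n] m_pos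
    by (cases "0 \<le> x") auto
qed

lemma cell_range:
  assumes k: "k \<in> {nat (\<lfloor>real m * p\<rfloor> + 1)..<nat (\<lfloor>real m * q\<rfloor> + 1)}"
  shows "p < real k / real m" "real k / real m \<le> q"
proof -
  have "real m * p < real k" "real k \<le> real m * q" using k by (auto simp: nat_le_iff zless_nat_eq_int_zless) linarith+
  then show "p < real k / real m" "real k / real m \<le> q"
    using m_pos by (simp_all add: field_simps)
qed

text \<open>
  The summand \<open>1 / m\<close> accounts for the jumps of the discrete distribution function and disappears in the limit.
  The distance to the rest point only matters at nonnegative areas, so that \<open>p < 0\<close> is admitted and there is no
  atom at area zero either.
\<close>

lemma cdf_lipschitz:
  assumes n: "2 \<le> n" and "p \<le> q" "0 < \<delta>"
    and away: "\<And>t. p \<le> t \<Longrightarrow> 0 \<le> t \<Longrightarrow> t \<le> q \<Longrightarrow> \<delta> \<le> \<bar>t - (real n - 6)\<bar>"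
  shows "cdf m w n q - cdf m w n p \<le> (q - p + 1 / real m) * (flux_bound \<beta> n / \<delta>)"
proof -
  define I where "I = {nat (\<lfloor>real m * p\<rfloor> + 1)..<nat (\<lfloor>real m * q\<rfloor> + 1)}"
  have "w n k \<le> flux_bound \<beta> n / (real m * \<delta>)" if "k \<in> I" for k
  proof -
    have "\<delta> \<le> \<bar>real k / real m - (real n - 6)\<bar>"
      using cell_range[of k p q] that by (intro away) (auto simp: I_def)
    then have "real m * w n k * \<delta> \<le> real m * w n k * \<bar>real k / real m - (real n - 6)\<bar>"
      by (intro mult_left_mono) (auto simp: w_nonneg)
    also have "\<dots> \<le> flux_bound \<beta> n" by (rule density_bound[OF n])
    finally show ?thesis using m_pos \<open>0 < \<delta>\<close> by (simp add: field_simps)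
  qed
  then have "(\<Sum>k\<in>I. w n k) \<le> real (card I) * (flux_bound \<beta> n / (real m * \<delta>))"
    by (rule sum_bounded_above)
  also have "\<dots> \<le> (real m * (q - p) + 1) * (flux_bound \<beta> n / (real m * \<delta>))"
  proof (rule mult_right_mono)
    have "real m * p \<le> real m * q" using assms by (intro mult_left_mono) auto
    then have "\<lfloor>real m * p\<rfloor> \<le> \<lfloor>real m * q\<rfloor>" by (rule floor_mono)
    then have "int (card I) \<le> \<lfloor>real m * q\<rfloor> - \<lfloor>real m * p\<rfloor>" unfolding I_def card_atLeastLessThan by arith
    then have "real_of_int (int (card I)) \<le> real_of_int (\<lfloor>real m * q\<rfloor> - \<lfloor>real m * p\<rfloor>)"
      unfolding of_int_le_iff .
    also have "\<dots> \<le> real m * q - real m * p + 1" by linarith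
    finally show "real (card I) \<le> real m * (q - p) + 1" by (simp add: algebra_simps)
    show "0 \<le> flux_bound \<beta> n / (real m * \<delta>)" using flux_bound_ge_2[of n] m_pos \<open>0 < \<delta>\<close> by simp
  qed
  also have "\<dots> = (q - p + 1 / real m) * (flux_bound \<beta> n / \<delta>)"
    using m_pos \<open>0 < \<delta>\<close> by (simp add: field_simps)
  finally show ?thesis
    using cdf_diff[OF \<open>p \<le> q\<close>] by (simp add: I_def)
qed

text \<open>
  The density is read off from the flux through the right end of the cell if the drift is positive and from the
  flux through its left end otherwise.
\<close>

lemma cell_flux:
  assumes n: "n \<in> {2..N}" and k: "0 < k \<or> 0 < drift m n k" "drift m n k \<noteq> 0"
  obtains j where "j = k \<or> Suc j = k" "real m * w n k = rhs n j / (real k / real m - (real n - 6))"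
proof -
  define s where "s = real k / real m - (real n - 6)"
  have drift: "drift m n k = - (real m * s)" by (simp add: drift_position s_def)
  then have s: "s \<noteq> 0" using k by auto
  have solve: "real m * w n k = r / s" if "- drift m n k * w n k = r" for r
    using that s by (simp add: drift nonzero_eq_divide_eq mult.commute mult.left_commute)
  show ?thesis
  proof (cases "0 < drift m n k")
    case True
    show ?thesis
      using flux_left[OF n True] solve[of "rhs n k"] by (intro that[of k]) (auto simp: s_def)
  next
    case False
    then obtain j where j: "k = Suc j" using k gr0_implies_Suc by blast
    have "drift m n j \<le> 0" using drift_cases[of n k] drift_Suc[of n j] j False k by auto
    then show ?thesis
      using flux_right[OF n, of j] solve[of "rhs n j"] j by (intro that[of j]) (auto simp: s_def)
  qed
qed

lemma rhs_sign:
  assumes n: "n \<in> {2..N}"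
  shows "drift m n k \<le> 0 \<Longrightarrow> 0 \<le> rhs n k" "0 < drift m n k \<Longrightarrow> rhs n k \<le> 0"
proof -
  assume "drift m n k \<le> 0"
  then show "0 \<le> rhs n k"
    using flux_right[OF n, of k] drift_Suc[of n k] w_nonneg[of n "Suc k"]
      mult_nonneg_nonneg[of "- drift m n (Suc k)" "w n (Suc k)"] by linarith
next
  assume "0 < drift m n k"
  then show "rhs n k \<le> 0"
    using flux_left[OF n, of k] w_nonneg[of n k] mult_nonneg_nonneg[of "drift m n k" "w n k"] by linarith
qed

lemma rhs_variation:
  assumes n: "n \<in> {2..N}" and "nat \<lfloor>real m * p\<rfloor> \<le> i" "i \<le> nat \<lfloor>real m * q\<rfloor>"
    "nat \<lfloor>real m * p\<rfloor> \<le> j" "j \<le> nat \<lfloor>real m * q\<rfloor>" "0 \<le> p" "0 \<le> q"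
    and M: "\<And>l. l \<in> {n - 1, n, Suc n} \<Longrightarrow> cdf m w l q - cdf m w l p \<le> M"
  shows "\<bar>rhs n i - rhs n j\<bar> \<le> flux_bound \<beta> n * M"
proof -
  have d: "\<bar>cumul w l i - cumul w l j\<bar> \<le> M" if "l \<in> {n - 1, n, Suc n}" for l
    using M[OF that] assms(6,7) cumul_mono[OF assms(2), of l] cumul_mono[OF assms(3), of l]
      cumul_mono[OF assms(4), of l] cumul_mono[OF assms(5), of l]
    by (simp add: cdf_cumul)
  have M0: "0 \<le> M" using d[of n] by simp
  have "\<bar>coupling \<beta> (enat N) (\<lambda>l. cumul w l i - cumul w l j) n\<bar> \<le> (4 * \<beta> + 4) * (real n + 1) * M"
    using \<beta> n d by (intro abs_coupling_le) auto
  then have "\<gamma> * \<bar>coupling \<beta> (enat N) (\<lambda>l. cumul w l i - cumul w l j) n\<bar>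
      \<le> 4 / (2 - \<beta>) * ((4 * \<beta> + 4) * (real n + 1) * M)"
    using \<gamma>_bounds(2) \<gamma>_pos \<beta> by (intro mult_mono) auto
  then have "\<bar>\<gamma> * coupling \<beta> (enat N) (\<lambda>l. cumul w l i - cumul w l j) n\<bar>
      \<le> 4 / (2 - \<beta>) * ((4 * \<beta> + 4) * (real n + 1)) * M"
    using \<gamma>_pos by (simp add: abs_mult)
  moreover have "rhs n i - rhs n j = - (cumul w n i - cumul w n j)
      - \<gamma> * coupling \<beta> (enat N) (\<lambda>l. cumul w l i - cumul w l j) n"
    unfolding rhs_def coupling_diff[symmetric] by (simp add: algebra_simps)
  ultimately show ?thesis
    using d[of n] M0 unfolding flux_bound_def distrib_right by auto
qed

text \<open>
  A quantitative difference quotient, with an error that is quadratic in \<open>q - p\<close> once \<open>M\<close> is of that order. It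
  replaces convergence of the densities: only distribution functions appear in it, and they converge pointwise.
\<close>

lemma cdf_slope:
  assumes n: "n \<in> {2..N}" and pq: "0 \<le> p" "p \<le> z" "z \<le> q" and "0 < \<delta>"
    and away: "\<And>t. p \<le> t \<Longrightarrow> t \<le> q \<Longrightarrow> \<delta> \<le> \<bar>t - (real n - 6)\<bar>"
    and M: "\<And>l. l \<in> {n - 1, n, Suc n} \<Longrightarrow> cdf m w l q - cdf m w l p \<le> M"
  shows "\<bar>cdf m w n q - cdf m w n p - (q - p) * (rhs n (nat \<lfloor>real m * z\<rfloor>) / (z - (real n - 6)))\<bar>
    \<le> (q - p + 1 / real m) * (flux_bound \<beta> n * M / \<delta> + flux_bound \<beta> n * (q - p) / \<delta>\<^sup>2) + flux_bound \<beta> n / (\<delta> * real m)"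
proof -
  define I where "I = {nat (\<lfloor>real m * p\<rfloor> + 1)..<nat (\<lfloor>real m * q\<rfloor> + 1)}"
  define r where "r = rhs n (nat \<lfloor>real m * z\<rfloor>)"
  define \<rho> where "\<rho> = r / (z - (real n - 6))"
  define \<eta> where "\<eta> = flux_bound \<beta> n * M / \<delta> + flux_bound \<beta> n * (q - p) / \<delta>\<^sup>2"
  have L: "0 \<le> flux_bound \<beta> n" using flux_bound_ge_2[of n] by simp
  have r: "\<bar>r\<bar> \<le> flux_bound \<beta> n" unfolding r_def using n by (intro rhs_bound) auto
  have za: "\<delta> \<le> \<bar>z - (real n - 6)\<bar>" using pq by (intro away) auto
  have "\<bar>\<rho>\<bar> \<le> flux_bound \<beta> n / \<delta>"
    unfolding \<rho>_def abs_divide using r za \<open>0 < \<delta>\<close> by (intro frac_le) auto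
  have mpq: "real m * p \<le> real m * z" "real m * z \<le> real m * q" "0 \<le> real m * p"
    using pq by (auto intro!: mult_left_mono)
  have fl: "0 \<le> \<lfloor>real m * p\<rfloor>" "\<lfloor>real m * p\<rfloor> \<le> \<lfloor>real m * z\<rfloor>" "\<lfloor>real m * z\<rfloor> \<le> \<lfloor>real m * q\<rfloor>"
    using mpq by (auto intro: floor_mono)
  have cell: "\<bar>real m * w n k - \<rho>\<bar> \<le> \<eta>" if "k \<in> I" for k
  proof -
    have kI: "nat \<lfloor>real m * p\<rfloor> < k" "k \<le> nat \<lfloor>real m * q\<rfloor>"
      using that fl by (auto simp: I_def nat_add_distrib)
    have kr: "p < real k / real m" "real k / real m \<le> q" using cell_range[of k p q] that by (auto simp: I_def)
    define s where "s = real k / real m - (real n - 6)"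
    have s: "\<delta> \<le> \<bar>s\<bar>" unfolding s_def using kr by (intro away) auto
    have "drift m n k \<noteq> 0" using s \<open>0 < \<delta>\<close> m_pos by (auto simp: drift_position s_def)
    then obtain j where j: "j = k \<or> Suc j = k" "real m * w n k = rhs n j / s"
      using cell_flux[OF n, of k] kI unfolding s_def by (metis gr_implies_not0 neq0_conv)
    have "nat \<lfloor>real m * p\<rfloor> \<le> j" "j \<le> nat \<lfloor>real m * q\<rfloor>" using j(1) kI by auto
    then have v: "\<bar>rhs n j - r\<bar> \<le> flux_bound \<beta> n * M"
      unfolding r_def using pq fl by (intro rhs_variation[OF n, where p = p and q = q] M) (auto intro: nat_mono)
    have s0: "s \<noteq> 0" "z - (real n - 6) \<noteq> 0" using s za \<open>0 < \<delta>\<close> by auto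
    have "real m * w n k - \<rho> = (rhs n j - r) / s + r * ((z - (real n - 6)) - s) / (s * (z - (real n - 6)))"
    proof -
      have "a / s - r / y = (a - r) / s + r * (y - s) / (s * y)" if "y \<noteq> 0" for a y
        using s0(1) that by (simp add: field_simps)
      from this[OF s0(2)] show ?thesis by (simp only: j(2) \<rho>_def)
    qed
    then have "\<bar>real m * w n k - \<rho>\<bar> \<le> \<bar>(rhs n j - r) / s\<bar> + \<bar>r * ((z - (real n - 6)) - s) / (s * (z - (real n - 6)))\<bar>"
      by (simp only: abs_triangle_ineq)
    also have "\<bar>(rhs n j - r) / s\<bar> \<le> flux_bound \<beta> n * M / \<delta>"
      unfolding abs_divide using v s \<open>0 < \<delta>\<close> by (intro frac_le) (auto intro: order_trans[OF abs_ge_zero v])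
    also have "\<bar>r * ((z - (real n - 6)) - s) / (s * (z - (real n - 6)))\<bar> \<le> flux_bound \<beta> n * (q - p) / \<delta>\<^sup>2"
      unfolding abs_divide abs_mult power2_eq_square
      using r s za \<open>0 < \<delta>\<close> pq kr L by (intro frac_le mult_mono) (auto simp: s_def)
    finally show ?thesis by (simp add: \<eta>_def)
  qed
  have cI: "real (card I) = real_of_int (\<lfloor>real m * q\<rfloor> - \<lfloor>real m * p\<rfloor>)"
  proof -
    have "int (card I) = \<lfloor>real m * q\<rfloor> - \<lfloor>real m * p\<rfloor>"
      using fl unfolding I_def card_atLeastLessThan by arith
    then show ?thesis by (metis of_int_of_nat_eq)
  qed
  have \<eta>0: "0 \<le> \<eta>"
  proof -
    have "0 \<le> M" using M[of n] cdf_mono[of p q n] pq by simp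
    then show ?thesis using L pq \<open>0 < \<delta>\<close> by (simp add: \<eta>_def)
  qed
  have card: "\<bar>real (card I) - real m * (q - p)\<bar> \<le> 1"
    unfolding cI by (simp add: algebra_simps abs_if) linarith
  have "real m * (cdf m w n q - cdf m w n p) - real (card I) * \<rho> = (\<Sum>k\<in>I. real m * w n k - \<rho>)"
    using cdf_diff[of p q n] pq by (simp add: I_def sum_distrib_left sum_subtractf)
  also have "\<bar>\<dots>\<bar> \<le> (\<Sum>k\<in>I. \<bar>real m * w n k - \<rho>\<bar>)" by (rule sum_abs)
  also have "\<dots> \<le> real (card I) * \<eta>" using cell by (rule sum_bounded_above)
  also have "\<dots> \<le> (real m * (q - p) + 1) * \<eta>" using card \<eta>0 by (intro mult_right_mono) auto
  finally have 1: "\<bar>real m * (cdf m w n q - cdf m w n p) - real (card I) * \<rho>\<bar> \<le> (real m * (q - p) + 1) * \<eta>" .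
  have "\<bar>(real (card I) - real m * (q - p)) * \<rho>\<bar> \<le> 1 * (flux_bound \<beta> n / \<delta>)"
    unfolding abs_mult using card \<open>\<bar>\<rho>\<bar> \<le> flux_bound \<beta> n / \<delta>\<close> by (intro mult_mono) auto
  with 1 have "\<bar>real m * (cdf m w n q - cdf m w n p) - real m * (q - p) * \<rho>\<bar>
      \<le> (real m * (q - p) + 1) * \<eta> + flux_bound \<beta> n / \<delta>"
    unfolding left_diff_distrib by linarith
  also have "real m * (cdf m w n q - cdf m w n p) - real m * (q - p) * \<rho>
      = real m * (cdf m w n q - cdf m w n p - (q - p) * \<rho>)"
    by (simp add: algebra_simps)
  also have "(real m * (q - p) + 1) * \<eta> + flux_bound \<beta> n / \<delta>
      = real m * ((q - p + 1 / real m) * \<eta> + flux_bound \<beta> n / (\<delta> * real m))"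
    using m_pos by (simp add: field_simps)
  finally have "real m * \<bar>cdf m w n q - cdf m w n p - (q - p) * \<rho>\<bar>
      \<le> real m * ((q - p + 1 / real m) * \<eta> + flux_bound \<beta> n / (\<delta> * real m))"
    by (simp add: abs_mult)
  then show ?thesis
    using m_pos by (simp add: \<eta>_def \<rho>_def r_def)
qed

end

section \<open>The limit of vanishing mesh size\<close>

text \<open>
  The boundary values are only required to converge for \<open>n \<le> 5\<close>: the density with six sides may be unbounded at
  its rest point \<open>\<xi> = 0\<close>.
\<close>

locale scaling_limit =
  fixes \<beta> :: real and N :: enat and Ns ms :: "nat \<Rightarrow> nat" and \<gamma>s :: "nat \<Rightarrow> real"
    and ws :: "nat \<Rightarrow> nat \<Rightarrow> nat \<Rightarrow> real"
    and \<gamma> :: real and b\<^sub>0 mass :: "nat \<Rightarrow> real" and G :: "nat \<Rightarrow> real \<Rightarrow> real"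
  assumes N_gt_6: "6 < N"
    and equilibria: "\<And>i. equilibrium \<beta> (Ns i) (ms i) (\<gamma>s i) (ws i)"
    and ms: "filterlim ms at_top sequentially"
    and Ns_finite: "\<And>i M. N = enat M \<Longrightarrow> Ns i = M"
    and Ns_infinite: "N = \<infinity> \<Longrightarrow> filterlim Ns at_top sequentially"
    and \<gamma>_lim: "\<gamma>s \<longlonglongrightarrow> \<gamma>"
    and b_lim: "\<And>n. n \<in> {2..5} \<Longrightarrow> (\<lambda>i. equilibrium.b (ms i) (ws i) n) \<longlonglongrightarrow> b\<^sub>0 n"
    and mass_lim: "\<And>n. (\<lambda>i. equilibrium.X (Ns i) (ms i) (ws i) n) \<longlonglongrightarrow> mass n"
    and G_lim: "\<And>n x. (\<lambda>i. cdf (ms i) (ws i) n x) \<longlonglongrightarrow> G n x"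
begin

sublocale E: equilibrium \<beta> "Ns i" "ms i" "\<gamma>s i" "ws i" for i
  by (rule equilibria)

definition R :: "nat \<Rightarrow> real \<Rightarrow> real" where
  "R n x = max (6 - real n) 0 * b\<^sub>0 n - G n x - \<gamma> * coupling \<beta> N (\<lambda>j. G j x) n"

lemma \<beta>: "0 < \<beta>" "\<beta> < 2"
  using E.\<beta> by auto

lemma mesh_lim: "(\<lambda>i. 1 / real (ms i)) \<longlonglongrightarrow> 0"
  using filterlim_compose[OF lim_1_over_n ms] by simp

text \<open>
  If \<open>N = \<infinity>\<close>, then every fixed \<open>n\<close> eventually lies strictly below the truncation, where the truncated coupling
  operator agrees with the infinite one.
\<close>

lemma eventually_inner:
  assumes "n \<in> idx N"
  shows "\<forall>\<^sub>F i in sequentially. n \<in> {2..Ns i} \<and> (\<forall>f. coupling \<beta> (enat (Ns i)) f n = coupling \<beta> N f n)"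
proof (cases N)
  case (enat M)
  then show ?thesis using assms Ns_finite[OF enat] by (auto simp: idx_def)
next
  case infinity
  have "\<forall>\<^sub>F i in sequentially. Suc n \<le> Ns i"
    using Ns_infinite[OF infinity] by (auto simp: filterlim_at_top)
  then show ?thesis
    by eventually_elim (use assms infinity in \<open>auto simp: idx_def coupling_def\<close>)
qed

lemma outside_states: "n \<notin> idx N \<Longrightarrow> n \<notin> {2..Ns i}"
  using Ns_finite[of _ i] by (cases N) (auto simp: idx_def)

lemma G_outside: "n \<notin> idx N \<Longrightarrow> G n x = 0"
proof -
  assume n: "n \<notin> idx N"
  have "cdf (ms i) (ws i) n x = 0" for i
    unfolding cdf_def using outside_states[OF n, of i]
    by (intro sum.neutral ballI E.w_outside) (auto simp: states_def)
  then show ?thesis using LIMSEQ_unique[OF G_lim[of n x], of 0] by simp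
qed

lemma mass_outside: "n \<notin> idx N \<Longrightarrow> mass n = 0"
  using LIMSEQ_unique[OF mass_lim[of n], of 0] E.X_outside[OF outside_states] by simp

lemma G_mono: "p \<le> q \<Longrightarrow> G n p \<le> G n q"
  by (rule LIMSEQ_le[OF G_lim G_lim]) (auto intro: E.cdf_mono)

lemma G_bounds: "0 \<le> G n x" "G n x \<le> mass n" "G n x \<le> 1"
proof -
  show "0 \<le> G n x" using LIMSEQ_le_const[OF G_lim] E.cdf_bounds by blast
  show "G n x \<le> mass n" using LIMSEQ_le[OF G_lim mass_lim] E.cdf_bounds by blast
  show "G n x \<le> 1"
    using LIMSEQ_le_const2[OF G_lim] order_trans[OF E.cdf_bounds(2) E.X_le_1] by blast
qed

lemma G_negative: "x < 0 \<Longrightarrow> G n x = 0"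
  using LIMSEQ_unique[OF G_lim[of n x], of 0] cdf_negative[OF _ E.m_pos(1)] by simp

lemma G_lipschitz:
  assumes n: "2 \<le> n" and pq: "p \<le> q" "0 < \<delta>"
    and away: "\<And>t. p \<le> t \<Longrightarrow> 0 \<le> t \<Longrightarrow> t \<le> q \<Longrightarrow> \<delta> \<le> \<bar>t - (real n - 6)\<bar>"
  shows "G n q - G n p \<le> (q - p) * (flux_bound \<beta> n / \<delta>)"
proof (rule LIMSEQ_le)
  show "(\<lambda>i. cdf (ms i) (ws i) n q - cdf (ms i) (ws i) n p) \<longlonglongrightarrow> G n q - G n p"
    by (intro tendsto_intros G_lim)
  show "(\<lambda>i. (q - p + 1 / real (ms i)) * (flux_bound \<beta> n / \<delta>)) \<longlonglongrightarrow> (q - p) * (flux_bound \<beta> n / \<delta>)"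
    using tendsto_mult[OF tendsto_add[OF tendsto_const mesh_lim] tendsto_const, of "q - p" "flux_bound \<beta> n / \<delta>"]
    by simp
  show "\<exists>k. \<forall>i\<ge>k. cdf (ms i) (ws i) n q - cdf (ms i) (ws i) n p
      \<le> (q - p + 1 / real (ms i)) * (flux_bound \<beta> n / \<delta>)"
    using E.cdf_lipschitz[OF n pq away] by blast
qed

lemma R_lim:
  assumes n: "n \<in> idx N" and x: "0 \<le> x"
  shows "(\<lambda>i. E.rhs i n (nat \<lfloor>real (ms i) * x\<rfloor>)) \<longlonglongrightarrow> R n x"
proof -
  have c: "(\<lambda>i. coupling \<beta> N (\<lambda>j. cdf (ms i) (ws i) j x) n) \<longlonglongrightarrow> coupling \<beta> N (\<lambda>j. G j x) n"
    unfolding coupling_def by (auto intro!: tendsto_intros G_lim)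
  have b: "(\<lambda>i. max (6 - real n) 0 * E.b i n) \<longlonglongrightarrow> max (6 - real n) 0 * b\<^sub>0 n"
  proof (cases "n \<le> 5")
    case True
    then show ?thesis using n by (intro tendsto_intros b_lim) (simp add: idx_def)
  qed simp
  have "(\<lambda>i. max (6 - real n) 0 * E.b i n - cdf (ms i) (ws i) n x
      - \<gamma>s i * coupling \<beta> N (\<lambda>j. cdf (ms i) (ws i) j x) n) \<longlonglongrightarrow> R n x"
    unfolding R_def by (intro tendsto_intros b G_lim \<gamma>_lim c)
  moreover have "\<forall>\<^sub>F i in sequentially. max (6 - real n) 0 * E.b i n - cdf (ms i) (ws i) n x
      - \<gamma>s i * coupling \<beta> N (\<lambda>j. cdf (ms i) (ws i) j x) n = E.rhs i n (nat \<lfloor>real (ms i) * x\<rfloor>)"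
    using eventually_inner[OF n] by eventually_elim (simp add: E.rhs_def cdf_cumul[OF x])
  ultimately show ?thesis by (rule Lim_transform_eventually)
qed

text \<open>
  The sign of the discrete flux, a consequence of \<open>w \<ge> 0\<close>, is inherited by the limit; this will give \<open>g \<ge> 0\<close> in
  every point.
\<close>

lemma R_nonneg:
  assumes n: "n \<in> idx N" and x: "0 \<le> x" "real n - 6 \<le> x"
  shows "0 \<le> R n x"
proof (rule tendsto_lowerbound[OF R_lim[OF n x(1)]])
  show "\<forall>\<^sub>F i in sequentially. 0 \<le> E.rhs i n (nat \<lfloor>real (ms i) * x\<rfloor>)"
    using eventually_inner[OF n]
  proof eventually_elim
    case (elim i)
    have "real (ms i) * (real n - 6) \<le> real (ms i) * x" using x by (intro mult_left_mono) auto
    moreover have "real (ms i) * (real n - 6) = of_int (int (ms i) * (int n - 6))" by simp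
    ultimately have "int (ms i) * (int n - 6) \<le> \<lfloor>real (ms i) * x\<rfloor>" by (metis le_floor_iff)
    moreover have "0 \<le> \<lfloor>real (ms i) * x\<rfloor>" using x by simp
    ultimately have "real (ms i) * (real n - 6) \<le> real (nat \<lfloor>real (ms i) * x\<rfloor>)"
      by (simp add: \<open>_ = of_int _\<close> del: of_int_mult of_int_diff)
    then have "drift (ms i) n (nat \<lfloor>real (ms i) * x\<rfloor>) \<le> 0" by (simp add: drift_def)
    then show ?case using E.rhs_sign(1) elim by blast
  qed
qed simp

lemma R_nonpos:
  assumes n: "n \<in> idx N" and x: "0 \<le> x" "x < real n - 6"
  shows "R n x \<le> 0"
proof (rule tendsto_upperbound[OF R_lim[OF n x(1)]])
  show "\<forall>\<^sub>F i in sequentially. E.rhs i n (nat \<lfloor>real (ms i) * x\<rfloor>) \<le> 0"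
    using eventually_inner[OF n]
  proof eventually_elim
    case (elim i)
    have "real (nat \<lfloor>real (ms i) * x\<rfloor>) \<le> real (ms i) * x" using x by simp
    also have "\<dots> < real (ms i) * (real n - 6)"
      using x E.m_pos[of i] by (intro mult_strict_left_mono) auto
    finally have "0 < drift (ms i) n (nat \<lfloor>real (ms i) * x\<rfloor>)" by (simp add: drift_def)
    then show ?case using E.rhs_sign(2) elim by blast
  qed
qed simp

text \<open>
  At areas beyond \<open>M - 6\<close> there is no mass, hence no flux.
\<close>

lemma R_support:
  assumes n: "n \<in> idx N" and N: "N = enat M" and x: "0 \<le> x" "real M - 6 \<le> x"
  shows "R n x = 0"
proof (rule LIMSEQ_unique[OF R_lim[OF n x(1)]])
  have "E.rhs i n (nat \<lfloor>real (ms i) * x\<rfloor>) = 0" for i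
  proof -
    define k where "k = nat \<lfloor>real (ms i) * x\<rfloor>"
    have M: "Ns i = M" "7 \<le> M" using Ns_finite[OF N] E.N[of i] by auto
    have "real (ms i) * (real M - 6) \<le> real (ms i) * x" using x by (intro mult_left_mono) auto
    moreover have "real (ms i) * (real M - 6) = real (ms i * (M - 6))" using M by (simp add: of_nat_diff)
    ultimately have k: "ms i * (M - 6) \<le> k" unfolding k_def by (simp add: le_nat_floor)
    have nM: "n \<in> {2..Ns i}" using n N M by (auto simp: idx_def)
    have "n - 6 \<le> M - 6" using nM M by auto
    then have "ms i * (n - 6) \<le> ms i * (M - 6)" by (rule mult_le_mono2)
    then have "ms i * (n - 6) \<le> k" using k by (rule order_trans)
    then have "real (ms i * (n - 6)) \<le> real k" by (rule of_nat_mono)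
    moreover have "real (ms i) * (real n - 6) \<le> real (ms i * (n - 6))" by (simp add: mult_left_mono)
    ultimately have "drift (ms i) n k \<le> 0" unfolding drift_def by linarith
    moreover have "ws i n (Suc k) = 0"
      using k M by (intro E.w_outside) (auto simp: states_def)
    ultimately show ?thesis
      using E.flux_right[OF nM, of k] by (simp add: k_def)
  qed
  then show "(\<lambda>i. E.rhs i n (nat \<lfloor>real (ms i) * x\<rfloor>)) \<longlonglongrightarrow> 0" by simp
qed

lemma G_slope:
  assumes n: "n \<in> idx N" and pq: "0 \<le> p" "p \<le> z" "z \<le> q" and "0 < \<delta>"
    and away: "\<And>t. p \<le> t \<Longrightarrow> t \<le> q \<Longrightarrow> \<delta> \<le> \<bar>t - (real n - 6)\<bar>"
    and M: "\<And>l. l \<in> {n - 1, n, Suc n} \<Longrightarrow> G l q - G l p < M"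
  shows "\<bar>G n q - G n p - (q - p) * (R n z / (z - (real n - 6)))\<bar>
    \<le> (q - p) * (flux_bound \<beta> n * M / \<delta> + flux_bound \<beta> n * (q - p) / \<delta>\<^sup>2)"
proof (rule tendsto_le)
  let ?\<eta> = "flux_bound \<beta> n * M / \<delta> + flux_bound \<beta> n * (q - p) / \<delta>\<^sup>2"
  have z0: "0 \<le> z" and za: "z - (real n - 6) \<noteq> 0" using pq away[of z] \<open>0 < \<delta>\<close> by auto
  show "(\<lambda>i. \<bar>cdf (ms i) (ws i) n q - cdf (ms i) (ws i) n p
      - (q - p) * (E.rhs i n (nat \<lfloor>real (ms i) * z\<rfloor>) / (z - (real n - 6)))\<bar>)
      \<longlonglongrightarrow> \<bar>G n q - G n p - (q - p) * (R n z / (z - (real n - 6)))\<bar>"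
    using za by (intro tendsto_intros G_lim R_lim[OF n z0]) auto
  show "(\<lambda>i. (q - p + 1 / real (ms i)) * ?\<eta> + flux_bound \<beta> n / \<delta> * (1 / real (ms i))) \<longlonglongrightarrow> (q - p) * ?\<eta>"
    using tendsto_add[OF tendsto_mult[OF tendsto_add[OF tendsto_const mesh_lim] tendsto_const]
        tendsto_mult[OF tendsto_const mesh_lim], of "q - p" ?\<eta> "flux_bound \<beta> n / \<delta>"] by simp
  have d: "\<forall>\<^sub>F i in sequentially. cdf (ms i) (ws i) l q - cdf (ms i) (ws i) l p < M"
    if "l \<in> {n - 1, n, Suc n}" for l
    by (rule order_tendstoD(2)[OF tendsto_diff[OF G_lim G_lim] M[OF that]])
  have "\<forall>\<^sub>F i in sequentially. \<forall>l\<in>{n - 1, n, Suc n}. cdf (ms i) (ws i) l q - cdf (ms i) (ws i) l p < M"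
    by (rule eventually_ball_finite) (use d in auto)
  then show "\<forall>\<^sub>F i in sequentially. \<bar>cdf (ms i) (ws i) n q - cdf (ms i) (ws i) n p
      - (q - p) * (E.rhs i n (nat \<lfloor>real (ms i) * z\<rfloor>) / (z - (real n - 6)))\<bar>
     \<le> (q - p + 1 / real (ms i)) * ?\<eta> + flux_bound \<beta> n / \<delta> * (1 / real (ms i))"
    using eventually_inner[OF n]
  proof eventually_elim
    case (elim i)
    then have nN: "n \<in> {2..Ns i}" by simp
    have "cdf (ms i) (ws i) l q - cdf (ms i) (ws i) l p \<le> M" if "l \<in> {n - 1, n, Suc n}" for l
      using elim that by (meson less_imp_le)
    from E.cdf_slope[OF nN pq \<open>0 < \<delta>\<close> away this] show ?case by simp
  qed
qed simp

lemma G_lipschitz_off_integers: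
  assumes e: "0 < e" "\<And>l t. p \<le> t \<Longrightarrow> t \<le> q \<Longrightarrow> e \<le> \<bar>t - (real l - 6)\<bar>" and "p \<le> q"
  shows "G l q - G l p \<le> (q - p) * (flux_bound \<beta> l / e)"
proof (cases "2 \<le> l")
  case True
  then show ?thesis using assms by (intro G_lipschitz) auto
next
  case False
  then have "l \<notin> idx N" by (simp add: idx_def)
  then show ?thesis using E.flux_bound_ge_2[of l] assms by (simp add: G_outside)
qed

text \<open>
  Integers are avoided because the distribution functions of the neighbouring rows enter the error term of
  \<open>G_slope\<close>, and these are known to be Lipschitz only away from their own rest points.
\<close>

lemma G_deriv:
  assumes n: "n \<in> idx N" and z: "0 < z" "z \<notin> \<int>"
  shows "(G n has_real_derivative R n z / (z - (real n - 6))) (at z)"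
proof -
  define e where "e = min (z - of_int \<lfloor>z\<rfloor>) (of_int \<lfloor>z\<rfloor> + 1 - z) / 2"
  have fl: "of_int \<lfloor>z\<rfloor> < z" "z < of_int \<lfloor>z\<rfloor> + 1" "0 \<le> (of_int \<lfloor>z\<rfloor> :: real)"
  proof -
    have "z \<noteq> of_int \<lfloor>z\<rfloor>" using z by (metis Ints_of_int)
    then show "of_int \<lfloor>z\<rfloor> < z" by linarith
    show "z < of_int \<lfloor>z\<rfloor> + 1" by linarith
    show "0 \<le> (of_int \<lfloor>z\<rfloor> :: real)" using z by simp
  qed
  have e2: "2 * e \<le> z - of_int \<lfloor>z\<rfloor>" "2 * e \<le> of_int \<lfloor>z\<rfloor> + 1 - z" by (auto simp: e_def)
  have e: "0 < e" using fl by (auto simp: e_def)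
  then have "e \<le> z" using fl e2 by linarith
  have away: "e \<le> \<bar>t - (real l - 6)\<bar>" if "z - e \<le> t" "t \<le> z + e" for t l
  proof -
    define j where "j = int l - 6"
    have j: "real l - 6 = of_int j" by (simp add: j_def)
    have "j \<le> \<lfloor>z\<rfloor> \<or> \<lfloor>z\<rfloor> + 1 \<le> j" by arith
    then have "of_int j \<le> (of_int \<lfloor>z\<rfloor> :: real) \<or> of_int \<lfloor>z\<rfloor> + 1 \<le> (of_int j :: real)"
      by (metis of_int_1 of_int_add of_int_le_iff)
    then show ?thesis using that e2 unfolding j by linarith
  qed
  define L where "L = (flux_bound \<beta> (n - 1) + flux_bound \<beta> n + flux_bound \<beta> (Suc n)) / e + 1"
  define C where "C = flux_bound \<beta> n * L / e + flux_bound \<beta> n / e\<^sup>2"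
  define \<rho> where "\<rho> = R n z / (z - (real n - 6))"
  have key: "\<bar>G n q - G n p - (q - p) * \<rho>\<bar> \<le> (q - p) * (q - p) * C"
    if "z - e \<le> p" "p \<le> z" "z \<le> q" "q \<le> z + e" "p < q" for p q
  proof -
    have M: "G l q - G l p < (q - p) * L" if l: "l \<in> {n - 1, n, Suc n}" for l
    proof -
      have "G l q - G l p \<le> (q - p) * (flux_bound \<beta> l / e)"
        using \<open>p < q\<close> \<open>z - e \<le> p\<close> \<open>q \<le> z + e\<close>
        by (intro G_lipschitz_off_integers e away) auto
      also have "\<dots> < (q - p) * L"
      proof (rule mult_strict_left_mono)
        have "flux_bound \<beta> l \<le> flux_bound \<beta> (n - 1) + flux_bound \<beta> n + flux_bound \<beta> (Suc n)"
          using l E.flux_bound_ge_2[of "n - 1"] E.flux_bound_ge_2[of n] E.flux_bound_ge_2[of "Suc n"] by auto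
        then show "flux_bound \<beta> l / e < L" using e by (simp add: L_def divide_right_mono le_less_trans[OF divide_right_mono])
      qed (use \<open>p < q\<close> in simp)
      finally show ?thesis .
    qed
    have "\<bar>G n q - G n p - (q - p) * \<rho>\<bar> \<le> (q - p) * (flux_bound \<beta> n * ((q - p) * L) / e + flux_bound \<beta> n * (q - p) / e\<^sup>2)"
      unfolding \<rho>_def using that e \<open>e \<le> z\<close> by (intro G_slope[OF n _ _ _ _ _ M] away) auto
    also have "\<dots> = (q - p) * (q - p) * C"
    proof -
      have "D * (l * (D * L) / e + l * D / e\<^sup>2) = D * D * (l * L / e + l / e\<^sup>2)" for D l :: real
        by (simp add: algebra_simps)
      then show ?thesis unfolding C_def .
    qed
    finally show ?thesis .
  qed
  have bound: "\<bar>(G n (z + h) - G n z) / h - \<rho>\<bar> \<le> C * \<bar>h\<bar>" if h: "h \<noteq> 0" "\<bar>h\<bar> < e" for h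
  proof -
    have "\<bar>G n (z + h) - G n z - h * \<rho>\<bar> \<le> h * h * C"
    proof (cases "0 < h")
      case True
      then show ?thesis using key[of z "z + h"] h by simp
    next
      case False
      then have "\<bar>G n z - G n (z + h) - (- h) * \<rho>\<bar> \<le> (- h) * (- h) * C"
        using key[of "z + h" z] h by simp
      then show ?thesis by (simp add: abs_minus_commute algebra_simps)
    qed
    also have "G n (z + h) - G n z - h * \<rho> = h * ((G n (z + h) - G n z) / h - \<rho>)"
    proof -
      have "h * (Y / h) = Y" for Y using h(1) by simp
      then show ?thesis by (simp only: right_diff_distrib[of h])
    qed
    also have "h * h * C = \<bar>h\<bar> * (C * \<bar>h\<bar>)" by (simp add: abs_mult_self_eq mult.left_commute)
    finally have "\<bar>h\<bar> * \<bar>(G n (z + h) - G n z) / h - \<rho>\<bar> \<le> \<bar>h\<bar> * (C * \<bar>h\<bar>)"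
      by (simp only: abs_mult)
    then show ?thesis using h by simp
  qed
  have "((\<lambda>h. (G n (z + h) - G n z) / h - \<rho>) \<longlongrightarrow> 0) (at 0)"
  proof (rule Lim_null_comparison)
    show "\<forall>\<^sub>F h in at 0. norm ((G n (z + h) - G n z) / h - \<rho>) \<le> C * \<bar>h\<bar>"
      using bound e by (auto simp: eventually_at dist_real_def intro!: exI[of _ e])
    show "((\<lambda>h. C * \<bar>h\<bar>) \<longlongrightarrow> 0) (at 0)"
      by (rule tendsto_eq_intros refl | simp)+
  qed
  then show ?thesis
    unfolding DERIV_def \<rho>_def[symmetric] by (simp add: LIM_zero_iff)
qed

text \<open>
  Both sides are zero. The formula is needed to the left of the rest point \<open>\<xi> = 0\<close> of the row \<open>n = 6\<close>.
\<close>

lemma G_deriv_negative: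
  assumes n: "6 \<le> n" and z: "z < 0"
  shows "(G n has_real_derivative R n z / (z - (real n - 6))) (at z)"
proof -
  have "R n z = 0"
    using n z by (simp add: R_def G_negative coupling_def)
  moreover have "(G n has_real_derivative 0) (at z)"
  proof (rule has_field_derivative_transform_within_open[of "\<lambda>_. 0" _ _ "{..<0}"])
  qed (use z in \<open>auto simp: G_negative\<close>)
  ultimately show ?thesis by simp
qed

lemma \<gamma>_lower: "1 \<le> \<gamma> * (6 + 6 * \<beta>)"
proof (rule LIMSEQ_le)
  show "(\<lambda>i. 1 - 1 / real (ms i)) \<longlonglongrightarrow> 1"
    using tendsto_diff[OF tendsto_const mesh_lim, of 1] by simp
  show "(\<lambda>i. \<gamma>s i * (6 + 6 * \<beta>)) \<longlonglongrightarrow> \<gamma> * (6 + 6 * \<beta>)"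
    by (intro tendsto_intros \<gamma>_lim)
qed (use E.\<gamma>_lower in auto)

lemma \<gamma>_pos: "0 < \<gamma>"
  using \<gamma>_lower \<beta> by (metis add_pos_pos less_le_trans mult_pos_pos zero_less_mult_pos2 zero_less_numeral zero_less_one)

text \<open>
  An atom at the rest point would be fed by the births and drained by the jumps. The latter occur at rate
  \<open>\<gamma> * d > 1\<close>, and the neighbouring rows have no atom there that could compensate the loss. In terms of \<open>H\<close>, the
  mass in the interval of radius \<open>e\<close> around the rest point, the loss shows up as \<open>e * H' \<ge> \<kappa> / 2 > 0\<close>, so that \<open>H\<close>
  would grow logarithmically as the interval is enlarged from a tiny one, contradicting \<open>H \<le> 1\<close>.
\<close>

lemma no_atom:
  assumes n: "n \<in> idx N" "6 \<le> n" and h: "0 < h"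
  shows "\<exists>e>0. G n (real n - 6 + e) - G n (real n - 6 - e) < h"
proof (rule ccontr)
  define a where "a = real n - 6"
  define H where "H e = G n (a + e) - G n (a - e)" for e
  assume "\<not> ?thesis"
  then have H: "h \<le> H e" if "0 < e" for e using that by (force simp: H_def a_def)
  define d where "d = (if enat n = N then (\<beta> + 1) * real n else (2 * \<beta> + 1) * real n)"
  have d: "1 < \<gamma> * d"
  proof -
    have n7: "7 \<le> n" if "enat n = N"
      using that N_gt_6 by (metis enat_ord_simps(2) numeral_eq_enat Suc_leI eval_nat_numeral(3) semiring_norm(27) semiring_norm(28))
    have "6 + 6 * \<beta> < d"
    proof (cases "enat n = N")
      case True
      have "(\<beta> + 1) * 6 < (\<beta> + 1) * real n" using n7[OF True] \<beta> by (intro mult_strict_left_mono) auto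
      then show ?thesis using True by (simp add: d_def algebra_simps)
    next
      case False
      have "(2 * \<beta> + 1) * 6 \<le> (2 * \<beta> + 1) * real n" using n \<beta> by (intro mult_left_mono) auto
      moreover have "6 + 6 * \<beta> < (2 * \<beta> + 1) * 6" using \<beta> by simp
      ultimately show ?thesis using False by (simp add: d_def)
    qed
    then have "\<gamma> * (6 + 6 * \<beta>) < \<gamma> * d" using \<gamma>_pos by simp
    then show ?thesis using \<gamma>_lower by simp
  qed
  define L where "L = \<gamma> * ((\<beta> + 1) * (real n + 1) * (4 * flux_bound \<beta> (Suc n)) + \<beta> * (real n - 1) * (4 * flux_bound \<beta> (n - 1)))"
  have L: "0 \<le> L" unfolding L_def using \<gamma>_pos \<beta> n E.flux_bound_ge_2[of "Suc n"] E.flux_bound_ge_2[of "n - 1"]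
    by (intro mult_nonneg_nonneg add_nonneg_nonneg) auto
  have near: "G l (a + e) - G l (a - e) \<le> 4 * flux_bound \<beta> l * e"
    if l: "l = Suc n \<or> l = n - 1" and e: "0 < e" "e \<le> 1 / 2" for l e
  proof -
    have "G l (a + e) - G l (a - e) \<le> (a + e - (a - e)) * (flux_bound \<beta> l / (1 / 2))"
    proof (rule G_lipschitz)
      show "2 \<le> l" using l n by auto
      fix t assume t: "a - e \<le> t" "t \<le> a + e"
      have "real l - 6 = a + 1 \<or> real l - 6 = a - 1" using l n by (auto simp: a_def of_nat_diff)
      then show "1 / 2 \<le> \<bar>t - (real l - 6)\<bar>" using t e by linarith
    qed (use e in auto)
    then show ?thesis by (simp add: algebra_simps)
  qed
  have drop: "(\<gamma> * d - 1) * H e - L * e \<le> R n (a + e) - R n (a - e)" if e: "0 < e" "e \<le> 1 / 2" for e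
  proof -
    have "R n (a + e) - R n (a - e) = - H e - \<gamma> * coupling \<beta> N (\<lambda>j. G j (a + e) - G j (a - e)) n"
      unfolding R_def H_def coupling_diff[symmetric] by (simp add: algebra_simps)
    moreover have "\<gamma> * coupling \<beta> N (\<lambda>j. G j (a + e) - G j (a - e)) n \<le> - (\<gamma> * d) * H e + L * e"
    proof -
      have u: "(\<beta> + 1) * (real n + 1) * (G (Suc n) (a + e) - G (Suc n) (a - e))
          \<le> (\<beta> + 1) * (real n + 1) * (4 * flux_bound \<beta> (Suc n) * e)"
        using \<beta> e by (intro mult_left_mono near) auto
      have v: "\<beta> * (real n - 1) * (G (n - 1) (a + e) - G (n - 1) (a - e))
          \<le> \<beta> * (real n - 1) * (4 * flux_bound \<beta> (n - 1) * e)"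
        using \<beta> e n by (intro mult_left_mono near) auto
      have u0: "0 \<le> (\<beta> + 1) * (real n + 1) * (4 * flux_bound \<beta> (Suc n) * e)"
        using \<beta> e E.flux_bound_ge_2[of "Suc n"] by (intro mult_nonneg_nonneg) auto
      have "coupling \<beta> N (\<lambda>j. G j (a + e) - G j (a - e)) n \<le> - d * H e
          + ((\<beta> + 1) * (real n + 1) * (4 * flux_bound \<beta> (Suc n) * e) + \<beta> * (real n - 1) * (4 * flux_bound \<beta> (n - 1) * e))"
      proof -
        have "coupling \<beta> N (\<lambda>j. G j (a + e) - G j (a - e)) n = - d * H e
          + (if enat n = N then 0 else (\<beta> + 1) * (real n + 1) * (G (Suc n) (a + e) - G (Suc n) (a - e)))
          + \<beta> * (real n - 1) * (G (n - 1) (a + e) - G (n - 1) (a - e))"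
          using n by (auto simp: coupling_def d_def H_def)
        moreover have "(if enat n = N then 0 else (\<beta> + 1) * (real n + 1) * (G (Suc n) (a + e) - G (Suc n) (a - e)))
            \<le> (\<beta> + 1) * (real n + 1) * (4 * flux_bound \<beta> (Suc n) * e)"
          by (split if_split) (use u u0 in blast)
        ultimately show ?thesis using v by linarith
      qed
      from mult_left_mono[OF this, of \<gamma>] show ?thesis
        using \<gamma>_pos by (simp add: L_def algebra_simps)
    qed
    ultimately show ?thesis by (simp add: algebra_simps)
  qed
  have deriv: "(H has_real_derivative (R n (a + e) - R n (a - e)) / e) (at e)"
    if e: "0 < e" "e \<le> 1 / 2" for e
  proof -
    have a_int: "a = of_int (int n - 6)" "0 \<le> a" using n by (auto simp: a_def)
    have ni: "a + e \<notin> \<int>" "a - e \<notin> \<int>"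
    proof -
      have "e \<notin> \<int>" using e by (auto elim!: Ints_cases)
      moreover have "a \<in> \<int>" using a_int by simp
      ultimately show "a + e \<notin> \<int>" "a - e \<notin> \<int>"
        by (metis Ints_diff add_diff_cancel_left', metis Ints_diff diff_diff_eq2 add_diff_cancel_left')
    qed
    have 1: "(G n has_real_derivative R n (a + e) / e) (at (a + e))"
      using G_deriv[OF n(1) _ ni(1)] a_int e by (simp add: a_def)
    have 2: "(G n has_real_derivative R n (a - e) / (- e)) (at (a - e))"
    proof (cases "0 < a - e")
      case True
      then show ?thesis using G_deriv[OF n(1) _ ni(2)] by (simp add: a_def)
    next
      case False
      then have "a - e < 0" using ni by (metis Ints_0 linorder_cases)
      then show ?thesis using G_deriv_negative[OF n(2), of "a - e"] by (simp add: a_def)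
    qed
    have "((\<lambda>e. G n (a + e)) has_real_derivative R n (a + e) / e * 1) (at e)"
      by (rule DERIV_chain2[where f = "G n" and g = "\<lambda>e. a + e", OF 1]) (auto intro!: derivative_eq_intros)
    moreover have "((\<lambda>e. G n (a - e)) has_real_derivative R n (a - e) / (- e) * (- 1)) (at e)"
      by (rule DERIV_chain2[where f = "G n" and g = "\<lambda>e. a - e", OF 2]) (auto intro!: derivative_eq_intros)
    ultimately have "((\<lambda>e. G n (a + e) - G n (a - e)) has_real_derivative
        R n (a + e) / e * 1 - R n (a - e) / (- e) * (- 1)) (at e)"
      by (rule DERIV_diff)
    then show ?thesis by (simp add: H_def[abs_def] diff_divide_distrib)
  qed
  define \<kappa> where "\<kappa> = (\<gamma> * d - 1) * h"
  have \<kappa>: "0 < \<kappa>" using d h by (simp add: \<kappa>_def)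
  define e1 where "e1 = min (1 / 2) (\<kappa> / (2 * (L + 1)))"
  have e1: "0 < e1" using \<kappa> L by (simp add: e1_def)
  have e1_half: "e1 \<le> 1 / 2" unfolding e1_def by (rule min.cobounded1)
  have Le: "L * e \<le> \<kappa> / 2" if "0 < e" "e \<le> e1" for e
  proof -
    have "L * e \<le> (L + 1) * (\<kappa> / (2 * (L + 1)))"
      using that L e1 by (intro mult_mono) (auto simp: e1_def)
    also have "\<dots> = \<kappa> / 2" using L by (simp add: field_simps)
    finally show ?thesis .
  qed
  \<comment> \<open>On the interval from \<open>s\<close> to \<open>e1\<close> the function \<open>\<kappa> / 2 * ln\<close> increases by two.\<close>
  define s where "s = e1 * exp (- (4 / \<kappa>))"
  have s: "0 < s" "s \<le> e1" using e1 \<kappa> by (auto simp: s_def mult_le_cancel_left1)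
  have "H s - \<kappa> / 2 * ln s \<le> H e1 - \<kappa> / 2 * ln e1"
  proof (rule DERIV_nonneg_imp_nondecreasing[OF s(2)])
    fix e assume e: "s \<le> e" "e \<le> e1"
    then have e0: "0 < e" "e \<le> 1 / 2" using s e1_half by auto
    have "((\<lambda>e. H e - \<kappa> / 2 * ln e) has_real_derivative
        (R n (a + e) - R n (a - e)) / e - \<kappa> / 2 * (1 / e)) (at e)"
      using e0 by (auto intro!: derivative_eq_intros deriv)
    moreover have "0 \<le> (R n (a + e) - R n (a - e)) / e - \<kappa> / 2 * (1 / e)"
    proof -
      have "\<kappa> \<le> (\<gamma> * d - 1) * H e" unfolding \<kappa>_def using H[OF e0(1)] d by (intro mult_left_mono) auto
      then have "\<kappa> / 2 \<le> R n (a + e) - R n (a - e)" using drop[OF e0] Le[OF e0(1) e(2)] by linarith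
      then have "0 \<le> (R n (a + e) - R n (a - e) - \<kappa> / 2) / e" using e0 by (intro divide_nonneg_pos) auto
      then show ?thesis by (simp add: diff_divide_distrib)
    qed
    ultimately show "\<exists>y. ((\<lambda>e. H e - \<kappa> / 2 * ln e) has_real_derivative y) (at e) \<and> 0 \<le> y" by blast
  qed
  moreover have "ln s = ln e1 - 4 / \<kappa>" using e1 by (simp add: s_def ln_mult)
  moreover have "H e1 \<le> 1" using G_bounds[of n] by (simp add: H_def) (smt (verit) G_bounds)
  moreover have "h \<le> H s" by (rule H[OF s(1)])
  moreover have "\<kappa> / 2 * (4 / \<kappa>) = 2" using \<kappa> by simp
  ultimately show False using h by (simp add: right_diff_distrib)
qed

text \<open>
  For a monotone function continuity means that small intervals around the point carry little mass.
\<close>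

lemma G_isCont:
  assumes n: "n \<in> idx N"
  shows "isCont (G n) x"
proof -
  have n2: "2 \<le> n" using n by (simp add: idx_def)
  have "\<exists>e>0. G n (x + e) - G n (x - e) < h" if h: "0 < h" for h
  proof -
    consider "x < 0" | "0 \<le> x" "x \<noteq> real n - 6" | "0 \<le> x" "x = real n - 6" by linarith
    then show ?thesis
    proof cases
      case 1
      then show ?thesis using h by (intro exI[of _ "- x / 2"]) (simp add: G_negative)
    next
      case 2
      define \<delta> where "\<delta> = \<bar>x - (real n - 6)\<bar> / 2"
      define C where "C = flux_bound \<beta> n / \<delta>"
      have \<delta>: "0 < \<delta>" using 2 by (simp add: \<delta>_def)
      have C: "0 < C" using E.flux_bound_ge_2[of n] \<delta> by (simp add: C_def)
      define e where "e = min \<delta> (h / (4 * C))"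
      have e: "0 < e" "e \<le> \<delta>" using \<delta> C h by (auto simp: e_def)
      have "G n (x + e) - G n (x - e) \<le> (x + e - (x - e)) * (flux_bound \<beta> n / \<delta>)"
      proof (rule G_lipschitz[OF n2 _ \<delta>])
        show "\<delta> \<le> \<bar>t - (real n - 6)\<bar>" if "x - e \<le> t" "t \<le> x + e" for t
        proof -
          have "\<bar>x - (real n - 6)\<bar> \<le> \<bar>x - t\<bar> + \<bar>t - (real n - 6)\<bar>" by linarith
          moreover have "\<bar>x - t\<bar> \<le> e" using that by linarith
          moreover have "A / 2 \<le> C" if "A \<le> B + C" "B \<le> e" "e \<le> A / 2" for A B C :: real
            using that by linarith
          ultimately show ?thesis using e unfolding \<delta>_def by blast
        qed
      qed (use e in auto)
      also have "\<dots> = 2 * e * C" by (simp add: C_def)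
      also have "\<dots> \<le> 2 * (h / (4 * C)) * C" using C by (intro mult_right_mono) (auto simp: e_def)
      also have "\<dots> < h" using C h by simp
      finally show ?thesis using e by blast
    next
      case 3
      then have "6 \<le> n" by simp
      from no_atom[OF n this h] 3(2) show ?thesis by simp
    qed
  qed
  then show ?thesis
    unfolding continuous_at_eps_delta
  proof (intro allI impI)
    fix h :: real assume h: "0 < h" and H: "\<And>h. 0 < h \<Longrightarrow> \<exists>e>0. G n (x + e) - G n (x - e) < h"
    then obtain e where e: "0 < e" "G n (x + e) - G n (x - e) < h" by blast
    have "dist (G n y) (G n x) < h" if "dist y x < e" for y
    proof -
      have "G n (x - e) \<le> G n y" "G n y \<le> G n (x + e)" "G n (x - e) \<le> G n x" "G n x \<le> G n (x + e)"
        using that e by (auto intro!: G_mono simp: dist_real_def)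
      then show ?thesis using e(2) by (simp add: dist_real_def)
    qed
    then show "\<exists>d>0. \<forall>x'. dist x' x < d \<longrightarrow> dist (G n x') (G n x) < h" using e by blast
  qed
qed

end

section \<open>Tightness and existence of the limit\<close>

context equilibrium
begin

lemma exponential_tail:
  assumes "0 < \<mu>" "0 \<le> x"
  shows "X n - cdf m w n x \<le> exp (- (\<mu> * x)) * area_moment \<mu> n"
proof -
  define K where "K = m * (N - 6)"
  define i where "i = nat \<lfloor>real m * x\<rfloor>"
  have "X n - cdf m w n x = (\<Sum>k\<le>K. w n k - w n k * of_bool (k \<le> i))"
    unfolding cdf_cumul[OF assms(2)] sum_subtractf K_def cumul_truncate by (simp add: X_def cumul_def i_def)
  also have "\<dots> \<le> (\<Sum>k\<le>K. exp (- (\<mu> * x)) * (w n k * exp (\<mu> * (real k / real m))))"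
  proof (rule sum_mono)
    fix k
    show "w n k - w n k * of_bool (k \<le> i) \<le> exp (- (\<mu> * x)) * (w n k * exp (\<mu> * (real k / real m)))"
    proof (cases "k \<le> i")
      case False
      then have "real m * x \<le> real k" unfolding i_def by linarith
      then have "x \<le> real k / real m" using m_pos by (simp add: field_simps)
      then have "\<mu> * x \<le> \<mu> * (real k / real m)" using assms by (intro mult_left_mono) auto
      then have "1 \<le> exp (- (\<mu> * x)) * exp (\<mu> * (real k / real m))" by (simp flip: exp_add)
      then have "w n k * 1 \<le> w n k * (exp (- (\<mu> * x)) * exp (\<mu> * (real k / real m)))"
        by (intro mult_left_mono w_nonneg) auto
      then show ?thesis using False by (simp add: mult.left_commute)
    qed (simp add: w_nonneg)
  qed
  finally show ?thesis by (simp add: area_moment_def K_def sum_distrib_left)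
qed

text \<open>
  A Riemann-Stieltjes sum over unit intervals is comparable with the exponential moment and, unlike the latter,
  passes to the limit together with the distribution functions.
\<close>

lemma unit_cell_moment:
  assumes "0 < \<mu>"
  shows "(\<Sum>j<T. exp (\<mu> * (real j + 1)) * (cdf m w n (real j + 1) - cdf m w n (real j)))
    \<le> exp \<mu> * area_moment \<mu> n"
proof -
  define F where "F k = w n k * exp (\<mu> * (real k / real m))" for k
  have F0: "0 \<le> F k" for k by (simp add: F_def w_nonneg)
  have "(\<Sum>j<T. exp (\<mu> * (real j + 1)) * (cdf m w n (real j + 1) - cdf m w n (real j)))
     \<le> exp \<mu> * (\<Sum>k<m * T + 1. F k)"
  proof (induction T)
    case 0
    show ?case by (simp add: F_def w_nonneg)
  next
    case (Suc T)
    have fl: "nat (\<lfloor>real m * real j\<rfloor> + 1) = m * j + 1" for j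
    proof -
      have "\<lfloor>real m * real j\<rfloor> = int (m * j)" by (metis floor_of_nat of_nat_mult)
      then have "\<lfloor>real m * real j\<rfloor> + 1 = int (m * j + 1)" by simp
      then show ?thesis by (simp only: nat_int)
    qed
    have "cdf m w n (real T + 1) - cdf m w n (real T) = (\<Sum>k=m * T + 1..<m * Suc T + 1. w n k)"
      using cdf_diff[of "real T" "real T + 1" n] fl[of T] fl[of "Suc T"] by (simp add: add.commute)
    then have "exp (\<mu> * (real T + 1)) * (cdf m w n (real T + 1) - cdf m w n (real T))
       = (\<Sum>k=m * T + 1..<m * Suc T + 1. exp (\<mu> * (real T + 1)) * w n k)"
      by (simp only: sum_distrib_left)
    also have "\<dots> \<le> (\<Sum>k=m * T + 1..<m * Suc T + 1. exp \<mu> * F k)"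
    proof (rule sum_mono)
      fix k assume "k \<in> {m * T + 1..<m * Suc T + 1}"
      then have "m * T \<le> k" by simp
      then have "real (m * T) \<le> real k" by (rule of_nat_mono)
      then have "real T \<le> real k / real m" using m_pos by (simp add: field_simps)
      then have "\<mu> * (real T + 1) \<le> \<mu> * (real k / real m) + \<mu>"
        using assms mult_left_mono[of "real T" "real k / real m" \<mu>] by (simp add: distrib_left)
      then have "exp (\<mu> * (real T + 1)) \<le> exp (\<mu> * (real k / real m)) * exp \<mu>" by (simp flip: exp_add)
      then have "exp (\<mu> * (real T + 1)) * w n k \<le> exp (\<mu> * (real k / real m)) * exp \<mu> * w n k"
        by (intro mult_right_mono w_nonneg)
      then show "exp (\<mu> * (real T + 1)) * w n k \<le> exp \<mu> * F k" by (simp add: F_def mult_ac)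
    qed
    finally have "exp (\<mu> * (real T + 1)) * (cdf m w n (real T + 1) - cdf m w n (real T))
       \<le> exp \<mu> * (\<Sum>k=m * T + 1..<m * Suc T + 1. F k)" by (simp only: sum_distrib_left)
    moreover have "(\<Sum>k<m * Suc T + 1. F k) = (\<Sum>k<m * T + 1. F k) + (\<Sum>k=m * T + 1..<m * Suc T + 1. F k)"
      unfolding lessThan_atLeast0 by (rule sum.atLeastLessThan_concat[symmetric]) auto
    ultimately show ?case using Suc.IH by (simp add: distrib_left)
  qed
  also have "(\<Sum>k<m * T + 1. F k) \<le> (\<Sum>k\<le>m * (N - 6). F k)"
  proof -
    have "(\<Sum>k<m * T + 1. F k) = (\<Sum>k\<in>{..<m * T + 1} \<inter> {..m * (N - 6)}. F k)"
      by (rule sum.mono_neutral_right) (auto simp: F_def states_def intro!: w_outside)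
    also have "\<dots> \<le> (\<Sum>k\<le>m * (N - 6). F k)" by (rule sum_mono2) (auto simp: F0)
    finally show ?thesis .
  qed
  finally show ?thesis by (simp add: area_moment_def F_def)
qed

end

text \<open>
  This is how the admissible range of exponents in the theorem arises.
\<close>

lemma subcritical_rate:
  assumes "0 < \<beta>" "\<mu> < ln (1 + 1 / \<beta>)"
  shows "\<beta> * exp \<mu> < \<beta> + (1::real)"
proof -
  have "exp \<mu> < exp (ln (1 + 1 / \<beta>))" using assms by simp
  also have "\<dots> = 1 + 1 / \<beta>" using assms by (simp add: add_pos_pos)
  finally have "\<beta> * exp \<mu> < \<beta> * (1 + 1 / \<beta>)" using assms by (intro mult_strict_left_mono)
  then show ?thesis using assms by (simp add: distrib_left)
qed

context scaling_limit
begin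

lemma exponential_bounds:
  assumes "0 < \<mu>" "\<mu> < ln (1 + 1 / \<beta>)"
  obtains C where "0 \<le> C"
    "\<And>i. E.size_moment i \<mu> \<le> C"
    "\<And>i. (\<Sum>n=2..Ns i. E.area_moment i \<mu> n) \<le> C"
proof -
  note \<mu> = assms(1) subcritical_rate[OF \<beta>(1) assms(2)]
  obtain C1 where C1: "\<And>i. E.size_moment i \<mu> \<le> C1"
    using E.size_exponential_moment[OF \<mu>] by blast
  define c where "c = \<mu> * exp \<mu> + 2 * exp (\<mu> * (2 * exp \<mu> / \<mu>))"
  have c: "0 \<le> c" using \<mu> by (simp add: c_def)
  have C10: "0 \<le> C1"
    by (rule order_trans[OF sum_nonneg C1[of 0, unfolded E.size_moment_def]]) (simp add: E.X_nonneg)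
  have "(\<Sum>n=2..Ns i. E.area_moment i \<mu> n) \<le> c * C1" for i
    using order_trans[OF E.area_exponential_moment[OF \<mu>(1)] mult_left_mono[OF C1 c[unfolded c_def]]]
    by (simp add: c_def)
  then show ?thesis
    using C1 c C10 by (intro that[of "max C1 (c * C1)"]) (auto simp: le_max_iff_disj)
qed

lemma rate_exists: obtains \<mu> where "0 < \<mu>" "\<mu> < ln (1 + 1 / \<beta>)"
  using \<beta> dense[of 0 "ln (1 + 1 / \<beta>)"] by (auto simp: ln_gt_zero)

lemma area_moment_le:
  assumes C: "\<And>i. (\<Sum>n=2..Ns i. E.area_moment i \<mu> n) \<le> C"
    and J: "finite J"
  shows "(\<Sum>n\<in>J. E.area_moment i \<mu> n) \<le> C"
proof -
  define F where "F n = E.area_moment i \<mu> n" for n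
  have "sum F J = sum F (J \<inter> {2..Ns i})"
    using J by (intro sum.mono_neutral_right)
      (auto simp: F_def E.area_moment_def states_def intro!: sum.neutral E.w_outside)
  also have "\<dots> \<le> sum F {2..Ns i}"
    by (intro sum_mono2) (auto simp: F_def E.area_moment_def E.w_nonneg intro!: sum_nonneg)
  also have "\<dots> \<le> C" unfolding F_def by (rule C)
  finally show ?thesis by (simp add: F_def)
qed

lemma mass_moment:
  assumes "0 < \<mu>" "\<mu> < ln (1 + 1 / \<beta>)"
  shows "summable (\<lambda>n. exp (\<mu> * real n) * (real n * mass n))"
proof -
  obtain C where C: "\<And>i. E.size_moment i \<mu> \<le> C"
    by (rule exponential_bounds[OF assms]; rule that; assumption)
  show ?thesis
  proof (rule summableI_nonneg_bounded)
    show "0 \<le> exp (\<mu> * real n) * (real n * mass n)" for n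
      using G_bounds(1,2)[of n 0] by simp
    fix J
    show "(\<Sum>n<J. exp (\<mu> * real n) * (real n * mass n)) \<le> C"
    proof (rule LIMSEQ_le_const2)
      show "(\<lambda>i. \<Sum>n<J. exp (\<mu> * real n) * (real n * E.X i n)) \<longlonglongrightarrow> (\<Sum>n<J. exp (\<mu> * real n) * (real n * mass n))"
        by (intro tendsto_intros mass_lim)
      have "(\<Sum>n<J. exp (\<mu> * real n) * (real n * E.X i n)) \<le> C" for i
      proof -
        have "(\<Sum>n<J. exp (\<mu> * real n) * (real n * E.X i n))
            = (\<Sum>n\<in>{..<J} \<inter> {2..Ns i}. exp (\<mu> * real n) * (real n * E.X i n))"
          by (rule sum.mono_neutral_right) (auto simp: E.X_outside)
        also have "\<dots> \<le> (\<Sum>n=2..Ns i. exp (\<mu> * real n) * (real n * E.X i n))"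
          by (rule sum_mono2) (auto simp: E.X_nonneg)
        finally show ?thesis using C[of i] by (simp add: E.size_moment_def)
      qed
      then show "\<exists>N. \<forall>i\<ge>N. (\<Sum>n<J. exp (\<mu> * real n) * (real n * E.X i n)) \<le> C" by blast
    qed
  qed
qed

text \<open>
  Tightness: the exponential moment controls the mass at large areas uniformly in the mesh, so none of it escapes
  in the limit.
\<close>

lemma G_at_top: "(G n \<longlongrightarrow> mass n) at_top"
proof -
  obtain \<mu> where \<mu>: "0 < \<mu>" "\<mu> < ln (1 + 1 / \<beta>)" by (rule rate_exists)
  obtain C where C: "0 \<le> C" "\<And>i. (\<Sum>n=2..Ns i. E.area_moment i \<mu> n) \<le> C"
    by (rule exponential_bounds[OF \<mu>]; rule that; assumption)
  have tail: "mass n - C * exp (- (\<mu> * x)) \<le> G n x" if x: "0 \<le> x" for x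
  proof -
    have "E.X i n - cdf (ms i) (ws i) n x \<le> exp (- (\<mu> * x)) * C" for i
      using area_moment_le[OF C(2), of "{n}" i]
      by (intro order_trans[OF E.exponential_tail[OF \<mu>(1) x]] mult_left_mono) auto
    then have "mass n - G n x \<le> exp (- (\<mu> * x)) * C"
      by (intro LIMSEQ_le_const2[OF tendsto_diff[OF mass_lim G_lim]]) blast
    then show ?thesis by (simp add: mult.commute)
  qed
  show ?thesis
  proof (rule tendsto_sandwich)
    show "\<forall>\<^sub>F x in at_top. mass n - C * exp (- (\<mu> * x)) \<le> G n x"
      using eventually_ge_at_top[of 0] by eventually_elim (rule tail)
    show "\<forall>\<^sub>F x in at_top. G n x \<le> mass n" by (simp add: G_bounds)
    have "filterlim (\<lambda>x. \<mu> * x) at_top at_top"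
      by (rule filterlim_tendsto_pos_mult_at_top[OF tendsto_const \<mu>(1) filterlim_ident])
    then have "((\<lambda>x. exp (- (\<mu> * x))) \<longlongrightarrow> 0) at_top"
      by (intro filterlim_compose[OF exp_at_bot]) (simp add: filterlim_uminus_at_bot)
    from tendsto_diff[OF tendsto_const tendsto_mult[OF tendsto_const this], of "mass n" C]
    show "((\<lambda>x. mass n - C * exp (- (\<mu> * x))) \<longlongrightarrow> mass n) at_top" by simp
  qed simp
qed

lemma unit_cell_moments:
  assumes "0 < \<mu>" "\<mu> < ln (1 + 1 / \<beta>)"
  obtains C where "\<And>J T. (\<Sum>n<J. \<Sum>j<T. exp (\<mu> * (real j + 1)) * (G n (real j + 1) - G n (real j))) \<le> C"
proof -
  obtain C where C: "\<And>i. (\<Sum>n=2..Ns i. E.area_moment i \<mu> n) \<le> C"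
    by (rule exponential_bounds[OF assms]; rule that; assumption)
  have "(\<Sum>n<J. \<Sum>j<T. exp (\<mu> * (real j + 1)) * (G n (real j + 1) - G n (real j))) \<le> exp \<mu> * C" for J T
  proof (rule LIMSEQ_le_const2)
    let ?c = "\<lambda>i n x. cdf (ms i) (ws i) n x"
    show "(\<lambda>i. \<Sum>n<J. \<Sum>j<T. exp (\<mu> * (real j + 1)) * (?c i n (real j + 1) - ?c i n (real j)))
      \<longlonglongrightarrow> (\<Sum>n<J. \<Sum>j<T. exp (\<mu> * (real j + 1)) * (G n (real j + 1) - G n (real j)))"
      by (intro tendsto_intros G_lim)
    have "(\<Sum>n<J. \<Sum>j<T. exp (\<mu> * (real j + 1)) * (?c i n (real j + 1) - ?c i n (real j))) \<le> exp \<mu> * C" for i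
    proof -
      have "(\<Sum>n<J. \<Sum>j<T. exp (\<mu> * (real j + 1)) * (?c i n (real j + 1) - ?c i n (real j)))
        \<le> (\<Sum>n<J. exp \<mu> * E.area_moment i \<mu> n)"
        by (intro sum_mono E.unit_cell_moment assms)
      also have "\<dots> \<le> exp \<mu> * C"
        unfolding sum_distrib_left[symmetric] using area_moment_le[OF C, of "{..<J}" i]
        by (intro mult_left_mono) auto
      finally show ?thesis .
    qed
    then show "\<exists>N. \<forall>i\<ge>N. (\<Sum>n<J. \<Sum>j<T. exp (\<mu> * (real j + 1)) * (?c i n (real j + 1) - ?c i n (real j))) \<le> exp \<mu> * C"
      by blast
  qed
  then show ?thesis by (rule that)
qed

definition den :: real where
  "den = \<beta> * (case N of enat M \<Rightarrow> real M * mass M | \<infinity> \<Rightarrow> 0) - 2 * (\<beta> + 1) * mass 2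
     + (\<Sum>n. real n * mass n)"

text \<open>
  The exponential moment in \<open>n\<close> dominates the series, so that Tannery's theorem applies; if \<open>N = \<infinity>\<close>, it also
  makes the truncation term \<open>N * X N\<close> disappear.
\<close>

lemma den_lim: "(\<lambda>i. E.den i) \<longlonglongrightarrow> den"
  and summable_size: "summable (\<lambda>n. real n * mass n)"
proof -
  obtain \<mu> where \<mu>: "0 < \<mu>" "\<mu> < ln (1 + 1 / \<beta>)" by (rule rate_exists)
  obtain C where C: "0 \<le> C" "\<And>i. E.size_moment i \<mu> \<le> C"
    by (rule exponential_bounds[OF \<mu>]; rule that; assumption)
  have bound: "real n * E.X i n \<le> C * exp (- \<mu>) ^ n" for n i
  proof (cases "n \<in> {2..Ns i}")
    case True
    then have "exp (\<mu> * real n) * (real n * E.X i n) \<le> (\<Sum>n=2..Ns i. exp (\<mu> * real n) * (real n * E.X i n))"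
      by (intro member_le_sum) (auto simp: E.X_nonneg)
    then have "exp (\<mu> * real n) * (real n * E.X i n) \<le> C" using C(2)[of i] unfolding E.size_moment_def by linarith
    have "exp (- \<mu>) ^ n = exp (real n * - \<mu>)" by (simp only: exp_of_nat_mult)
    then have "exp (- \<mu>) ^ n = inverse (exp (\<mu> * real n))"
      by (simp add: exp_minus mult.commute)
    then have eq: "exp (- \<mu>) ^ n * (exp (\<mu> * real n) * (real n * E.X i n)) = real n * E.X i n" by simp
    have "exp (- \<mu>) ^ n * (exp (\<mu> * real n) * (real n * E.X i n)) \<le> exp (- \<mu>) ^ n * C"
      using \<open>exp (\<mu> * real n) * (real n * E.X i n) \<le> C\<close> by (intro mult_left_mono) auto
    then show ?thesis unfolding eq by (simp only: mult.commute)
  next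
    case False
    then show ?thesis using C by (simp add: E.X_outside)
  qed
  have geo: "summable (\<lambda>n. C * exp (- \<mu>) ^ n)" "(\<lambda>n. C * exp (- \<mu>) ^ n) \<longlonglongrightarrow> 0"
    using \<mu> by (auto intro!: summable_mult summable_geometric summable_LIMSEQ_zero)
  have "(\<forall>\<^sub>F i in sequentially. summable (\<lambda>n. norm (real n * E.X i n))) \<and>
      summable (\<lambda>n. norm (real n * mass n)) \<and>
      (\<lambda>i. \<Sum>n. real n * E.X i n) \<longlonglongrightarrow> (\<Sum>n. real n * mass n)"
    using bound by (intro tannerys_theorem[OF _ _ geo(1)] tendsto_intros mass_lim)
      (auto intro!: always_eventually simp: E.X_nonneg)
  then have S: "summable (\<lambda>n. norm (real n * mass n))"
    "(\<lambda>i. \<Sum>n. real n * E.X i n) \<longlonglongrightarrow> (\<Sum>n. real n * mass n)" by auto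
  show "summable (\<lambda>n. real n * mass n)" using S(1) by (rule summable_norm_cancel)
  have suminf: "(\<Sum>n. real n * E.X i n) = (\<Sum>n=2..Ns i. real n * E.X i n)" for i
    by (rule suminf_finite) (auto simp: E.X_outside)
  have last: "(\<lambda>i. real (Ns i) * E.X i (Ns i)) \<longlonglongrightarrow> (case N of enat M \<Rightarrow> real M * mass M | \<infinity> \<Rightarrow> 0)"
  proof (cases N)
    case (enat M)
    then show ?thesis using tendsto_mult[OF tendsto_const mass_lim[of M], of "real M"] Ns_finite[OF enat] by simp
  next
    case infinity
    have "(\<lambda>i. real (Ns i) * E.X i (Ns i)) \<longlonglongrightarrow> 0"
    proof (rule tendsto_sandwich[where f = "\<lambda>_. 0" and h = "\<lambda>i. C * exp (- \<mu>) ^ Ns i"])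
      show "(\<lambda>i. C * exp (- \<mu>) ^ Ns i) \<longlonglongrightarrow> 0"
        by (rule filterlim_compose[OF geo(2) Ns_infinite[OF infinity]])
    qed (use bound E.X_nonneg in \<open>auto intro!: always_eventually\<close>)
    then show ?thesis using infinity by simp
  qed
  show "(\<lambda>i. E.den i) \<longlonglongrightarrow> den"
    unfolding E.den_def den_def suminf[symmetric] by (intro tendsto_intros last mass_lim S(2))
qed

lemma den_pos: "0 < den"
proof -
  have "4 - 2 * \<beta> \<le> den"
  proof (rule LIMSEQ_le[OF _ den_lim])
    show "(\<lambda>i. 4 - 2 * \<beta> - 1 / real (ms i)) \<longlonglongrightarrow> 4 - 2 * \<beta>"
      using tendsto_diff[OF tendsto_const mesh_lim, of "4 - 2 * \<beta>"] by simp
  qed (use E.den_bounds(1) in blast)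
  then show ?thesis using \<beta> by simp
qed

lemma num_den: "(\<Sum>n=2..5. (real n - 6)\<^sup>2 * b\<^sub>0 n) = \<gamma> * den"
proof (rule LIMSEQ_unique)
  show "(\<lambda>i. E.num i) \<longlonglongrightarrow> (\<Sum>n=2..5. (real n - 6)\<^sup>2 * b\<^sub>0 n)"
    unfolding E.num_def by (intro tendsto_intros b_lim)
  show "(\<lambda>i. E.num i) \<longlonglongrightarrow> \<gamma> * den"
    unfolding E.num_den using tendsto_add[OF tendsto_mult[OF \<gamma>_lim den_lim] mesh_lim] by simp
qed

end

lemma convergent_by_approximation:
  fixes f :: "nat \<Rightarrow> real"
  assumes "\<And>e. 0 < e \<Longrightarrow> \<exists>g. convergent g \<and> (\<forall>\<^sub>F i in sequentially. \<bar>f i - g i\<bar> \<le> e)"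
  shows "convergent f"
proof (rule Cauchy_convergent, rule CauchyI)
  fix e :: real assume "0 < e"
  then obtain g where g: "convergent g" "\<forall>\<^sub>F i in sequentially. \<bar>f i - g i\<bar> \<le> e / 4"
    using assms[of "e / 4"] by auto
  obtain M where M: "\<And>i. M \<le> i \<Longrightarrow> \<bar>f i - g i\<bar> \<le> e / 4"
    using g(2) by (auto simp: eventually_sequentially)
  obtain M' where M': "\<And>i j. M' \<le> i \<Longrightarrow> M' \<le> j \<Longrightarrow> \<bar>g i - g j\<bar> < e / 4"
    using CauchyD[OF convergent_Cauchy[OF g(1)], of "e / 4"] \<open>0 < e\<close> by auto
  show "\<exists>M. \<forall>i\<ge>M. \<forall>j\<ge>M. norm (f i - f j) < e"
  proof (intro exI[of _ "max M M'"] allI impI)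
    fix i j assume "max M M' \<le> i" "max M M' \<le> j"
    then show "norm (f i - f j) < e"
    proof -
      have "\<bar>f i - f j\<bar> \<le> \<bar>f i - g i\<bar> + \<bar>g i - g j\<bar> + \<bar>f j - g j\<bar>" by linarith
      moreover have "\<bar>f i - g i\<bar> \<le> e / 4" "\<bar>f j - g j\<bar> \<le> e / 4" "\<bar>g i - g j\<bar> < e / 4"
        using \<open>max M M' \<le> i\<close> \<open>max M M' \<le> j\<close> M[of i] M[of j] M'[of i j] by auto
      moreover have "D < e" if "D \<le> A + B + C" "A \<le> e / 4" "C \<le> e / 4" "B < e / 4" for A B C D :: real
        using that \<open>0 < e\<close> by linarith
      ultimately show ?thesis unfolding real_norm_def by blast
    qed
  qed
qed

text \<open>
  Rational rest points cause no difficulty, since convergence at rational points is assumed; an irrational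
  point has a positive distance from \<open>n - 6\<close>, and the Lipschitz bound compares it with a rational point nearby.
\<close>

lemma cdf_convergent:
  assumes E: "\<And>i. equilibrium \<beta> (Ns i) (ms i) (\<gamma>s i) (ws i)"
    and ms: "filterlim ms at_top sequentially"
    and rat: "\<And>r. r \<in> \<rat> \<Longrightarrow> 0 \<le> r \<Longrightarrow> convergent (\<lambda>i. cdf (ms i) (ws i) n r)"
  shows "convergent (\<lambda>i. cdf (ms i) (ws i) n x)"
proof (cases "2 \<le> n")
  case False
  have "cdf (ms i) (ws i) n x = 0" for i
    unfolding cdf_def using False
    by (intro sum.neutral ballI equilibrium.w_outside[OF E]) (simp add: states_def)
  then show ?thesis by (simp add: convergent_const)
next
  case n: True
  consider "x < 0" | "0 \<le> x" "x \<in> \<rat>" | "0 \<le> x" "x \<notin> \<rat>" by linarith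
  then show ?thesis
  proof cases
    case 1
    then have "cdf (ms i) (ws i) n x = 0" for i
      using cdf_negative equilibrium.m_pos(1)[OF E] by blast
    then show ?thesis by (simp add: convergent_const)
  next
    case 2
    then show ?thesis by (intro rat)
  next
    case 3
    have "real n - 6 \<in> \<rat>" by simp
    then have xa: "x \<noteq> real n - 6" using 3 by auto
    define \<delta> where "\<delta> = \<bar>x - (real n - 6)\<bar> / 2"
    have \<delta>: "0 < \<delta>" using xa by (simp add: \<delta>_def)
    have L: "0 < flux_bound \<beta> n / \<delta>" using equilibrium.flux_bound_ge_2[OF E, of n] \<delta> by simp
    show ?thesis
    proof (rule convergent_by_approximation)
      fix e :: real assume e: "0 < e"
      define h where "h = min \<delta> (e / (2 * (flux_bound \<beta> n / \<delta>)))"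
      have q: "0 < e / (2 * (flux_bound \<beta> n / \<delta>))" using e L by (intro divide_pos_pos mult_pos_pos[OF _ L]) auto
      have h: "0 < h" "h \<le> \<delta>" unfolding h_def min_less_iff_conj using \<delta> q by (simp_all only: min.cobounded1)
      obtain r where r: "r \<in> \<rat>" "x < r" "r < x + h"
        using Rats_dense_in_real[of x "x + h"] h by auto
      have away: "\<delta> \<le> \<bar>t - (real n - 6)\<bar>" if "x \<le> t" "t \<le> r" for t
      proof -
        have "\<bar>x - (real n - 6)\<bar> \<le> \<bar>x - t\<bar> + \<bar>t - (real n - 6)\<bar>" by linarith
        moreover have "\<bar>x - t\<bar> \<le> \<delta>" using that r h by linarith
        moreover have "A / 2 \<le> C" if "A \<le> B + C" "B \<le> A / 2" for A B C :: real
          using that by linarith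
        ultimately show ?thesis unfolding \<delta>_def by blast
      qed
      have "\<forall>\<^sub>F i in sequentially. 1 / real (ms i) < e / (2 * (flux_bound \<beta> n / \<delta>))"
        by (rule order_tendstoD(2)[OF filterlim_compose[OF lim_1_over_n ms] q])
      then have "\<forall>\<^sub>F i in sequentially. \<bar>cdf (ms i) (ws i) n x - cdf (ms i) (ws i) n r\<bar> \<le> e"
      proof eventually_elim
        case (elim i)
        have "cdf (ms i) (ws i) n r - cdf (ms i) (ws i) n x \<le> (r - x + 1 / real (ms i)) * (flux_bound \<beta> n / \<delta>)"
          using r by (intro equilibrium.cdf_lipschitz[OF E n _ \<delta>] away) auto
        also have "\<dots> \<le> (e / (2 * (flux_bound \<beta> n / \<delta>)) + e / (2 * (flux_bound \<beta> n / \<delta>))) * (flux_bound \<beta> n / \<delta>)"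
        proof (intro mult_right_mono add_mono)
          have "r - x \<le> h" using r by simp
          also have "h \<le> e / (2 * (flux_bound \<beta> n / \<delta>))" unfolding h_def by (rule min.cobounded2)
          finally show "r - x \<le> e / (2 * (flux_bound \<beta> n / \<delta>))" .
        qed (use elim L in auto)
        also have "\<dots> = e"
        proof -
          have "(e / (2 * l) + e / (2 * l)) * l = e" if "0 < l" for l :: real
            using that by (simp add: field_simps)
          from this[OF L] show ?thesis .
        qed
        finally show ?case using equilibrium.cdf_mono[OF E, of x r i n] r by simp
      qed
      then show "\<exists>g. convergent g \<and> (\<forall>\<^sub>F i in sequentially. \<bar>cdf (ms i) (ws i) n x - g i\<bar> \<le> e)"
        using rat[OF r(1)] r 3 by (intro exI[of _ "\<lambda>i. cdf (ms i) (ws i) n r"]) auto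
    qed
  qed
qed

lemma scaling_limit_exists:
  assumes \<beta>: "0 < \<beta>" "\<beta> < 2" and N: "6 < N"
  obtains Ns ms \<gamma>s ws \<gamma> b\<^sub>0 mass G where "scaling_limit \<beta> N Ns ms \<gamma>s ws \<gamma> b\<^sub>0 mass G"
proof -
  obtain m0 :: nat where m0: "1 / (2 - \<beta>) \<le> real m0" using real_arch_simple by blast
  define ms where "ms i = m0 + 2 + i" for i
  define Ns where "Ns i = (case N of enat M \<Rightarrow> M | \<infinity> \<Rightarrow> i + 7)" for i
  have Ns7: "7 \<le> Ns i" for i
  proof (cases N)
    case (enat M)
    then have "6 < M" using N by (metis enat_ord_simps(2) numeral_eq_enat)
    then show ?thesis using enat by (simp add: Ns_def)
  qed (simp add: Ns_def)
  have mesh: "1 / real (ms i) \<le> 2 - \<beta>" for i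
  proof -
    have "1 \<le> real m0 * (2 - \<beta>)" using m0 \<beta> by (simp add: field_simps)
    also have "\<dots> \<le> real (ms i) * (2 - \<beta>)" using \<beta> by (intro mult_right_mono) (auto simp: ms_def)
    finally show ?thesis by (simp add: ms_def field_simps)
  qed
  have "\<exists>\<gamma> w. discrete_equilibrium \<beta> (Ns i) (ms i) \<gamma> w" for i
  proof -
    have small: "1 / real (ms i) < 4 - 2 * \<beta>" using mesh[of i] \<beta> by simp
    have "0 < ms i" by (simp add: ms_def)
    then obtain \<gamma> w where "discrete_equilibrium \<beta> (Ns i) (ms i) \<gamma> w"
      by (rule discrete_equilibrium_exists[OF \<beta>(1) Ns7 _ small])
    then show ?thesis by blast
  qed
  then obtain \<gamma>s ws where eq: "\<And>i. discrete_equilibrium \<beta> (Ns i) (ms i) (\<gamma>s i) (ws i)" by metis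
  have E: "equilibrium \<beta> (Ns i) (ms i) (\<gamma>s i) (ws i)" for i
    using \<beta> Ns7 mesh eq by unfold_locales (auto simp: ms_def)
  let ?S = "UNIV \<times> (\<rat> :: real set) :: (nat \<times> real) set"
  \<comment> \<open>A single diagonal extraction serves all limits: the second components \<open>- 1\<close>, \<open>- 2\<close>, \<open>- 3\<close>, where the
    distribution functions vanish anyway, carry the remaining bounded quantities.\<close>
  define f where "f i p = (let n = fst p; x = snd p in
     if x = - 1 then (if n \<in> {2..5} then equilibrium.b (ms i) (ws i) n else 0) else if x = - 2 then \<gamma>s i
     else if x = - 3 then equilibrium.X (Ns i) (ms i) (ws i) n else cdf (ms i) (ws i) n x)" for i p
  have f_bound: "norm (f i p) \<le> 1 + 4 / (2 - \<beta>)" for i p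
  proof -
    interpret E: equilibrium \<beta> "Ns i" "ms i" "\<gamma>s i" "ws i" by (rule E)
    define n where "n = fst p"
    have "0 < 4 / (2 - \<beta>)" using \<beta> by simp
    moreover have "E.b n \<le> 1" if "n \<in> {2..5}"
    proof -
      have "1 * E.b n \<le> max (6 - real n) 0 * E.b n"
        using that by (intro mult_right_mono E.b_nonneg) auto
      then show ?thesis using E.outflow_le_1[of n] that by simp
    qed
    ultimately show ?thesis
      using E.b_nonneg[of n] E.\<gamma>_bounds(2) E.\<gamma>_pos E.X_nonneg[of n] E.X_le_1[of n]
        E.cdf_bounds[of n "snd p"]
      by (auto simp: f_def Let_def n_def[symmetric])
  qed
  have "countable ?S" by (intro countable_SIGMA countable_rat) simp
  obtain k where k: "strict_mono (k::nat\<Rightarrow>nat)"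
    and lim: "\<And>p. p \<in> ?S \<Longrightarrow> \<exists>l. (\<lambda>i. f (k i) p) \<longlonglongrightarrow> l"
  proof (rule function_convergent_subsequence[OF \<open>countable ?S\<close> f_bound])
    fix k :: "nat \<Rightarrow> nat"
    assume "strict_mono k" "\<And>p. p \<in> ?S \<Longrightarrow> \<exists>l. (\<lambda>i. f (k i) p) \<longlonglongrightarrow> l"
    then show thesis by (rule that)
  qed
  have conv: "convergent (\<lambda>i. f (k i) (n, x))" if "x \<in> \<rat>" for n x
    using lim[of "(n, x)"] that by (simp add: convergent_def)
  have b: "convergent (\<lambda>i. equilibrium.b (ms (k i)) (ws (k i)) n)" if "n \<in> {2..5}" for n
    using conv[of "- 1" n] that by (simp add: f_def)
  have \<gamma>: "convergent (\<lambda>i. \<gamma>s (k i))"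
    using conv[of "- 2" 0] by (simp add: f_def)
  have X: "convergent (\<lambda>i. equilibrium.X (Ns (k i)) (ms (k i)) (ws (k i)) n)" for n
    using conv[of "- 3" n] by (simp add: f_def)
  have ms_lim: "filterlim (\<lambda>i. ms (k i)) at_top sequentially"
    and Ns_lim: "N = \<infinity> \<Longrightarrow> filterlim (\<lambda>i. Ns (k i)) at_top sequentially"
  proof -
    have "filterlim ms at_top sequentially"
      by (rule filterlim_at_top_mono[OF filterlim_ident]) (simp add: ms_def)
    then show "filterlim (\<lambda>i. ms (k i)) at_top sequentially"
      by (rule filterlim_compose[OF _ filterlim_subseq[OF k]])
    assume "N = \<infinity>"
    then have "filterlim Ns at_top sequentially"
      by (intro filterlim_at_top_mono[OF filterlim_ident]) (simp add: Ns_def)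
    then show "filterlim (\<lambda>i. Ns (k i)) at_top sequentially"
      by (rule filterlim_compose[OF _ filterlim_subseq[OF k]])
  qed
  have c: "convergent (\<lambda>i. cdf (ms (k i)) (ws (k i)) n x)" for n x
  proof (rule cdf_convergent[OF E ms_lim])
    fix r :: real assume "r \<in> \<rat>" "0 \<le> r"
    then show "convergent (\<lambda>i. cdf (ms (k i)) (ws (k i)) n r)"
      using conv[of r n] by (simp add: f_def)
  qed
  have Ns_fin: "Ns (k i) = M" if "N = enat M" for i M using that by (simp add: Ns_def)
  have "scaling_limit \<beta> N (\<lambda>i. Ns (k i)) (\<lambda>i. ms (k i)) (\<lambda>i. \<gamma>s (k i)) (\<lambda>i. ws (k i)) (lim (\<lambda>i. \<gamma>s (k i)))
      (\<lambda>n. lim (\<lambda>i. equilibrium.b (ms (k i)) (ws (k i)) n))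
      (\<lambda>n. lim (\<lambda>i. equilibrium.X (Ns (k i)) (ms (k i)) (ws (k i)) n))
      (\<lambda>n x. lim (\<lambda>i. cdf (ms (k i)) (ws (k i)) n x))"
    by (rule scaling_limit.intro[OF N E ms_lim Ns_fin Ns_lim])
      (use b \<gamma> X c in \<open>auto simp: convergent_LIMSEQ_iff\<close>)
  then show thesis by (rule that)
qed

section \<open>Integration on the half-line\<close>

lemma set_integrable_interval:
  fixes f :: "real \<Rightarrow> real"
  assumes f: "f \<in> borel_measurable borel" "\<And>x. p \<le> x \<Longrightarrow> 0 \<le> f x" and "f integrable_on {p..q}"
  shows "set_integrable lborel {p..q} f"
proof -
  have "f absolutely_integrable_on {p..q}"
    using assms by (intro nonnegative_absolutely_integrable_1) auto
  then show ?thesis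
    unfolding set_integrable_def using f(1) by (subst (asm) integrable_completion) auto
qed

lemma set_integrable_half_line:
  fixes f :: "real \<Rightarrow> real"
  assumes f: "f \<in> borel_measurable borel" "\<And>x. 0 \<le> x \<Longrightarrow> 0 \<le> f x"
    and int: "\<And>T::nat. (f has_integral F T) {0..real T}" and F: "F \<longlonglongrightarrow> L"
  shows "set_integrable lborel {0<..} f" "(LBINT x:{0<..}. f x) = L"
proof -
  let ?u = "\<lambda>x. indicator {0::real..} x *\<^sub>R f x" and ?v = "\<lambda>x. indicator {0::real<..} x *\<^sub>R f x"
  let ?f = "\<lambda>i x. indicator {0..real i} x *\<^sub>R f x"
  have si: "set_integrable lborel {0..real i} f" for i
    using f int by (intro set_integrable_interval) auto
  have L: "integral\<^sup>L lborel (?f i) = F i" for i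
    using set_borel_integral_eq_integral(2)[OF si] int[of i]
    by (simp add: set_lebesgue_integral_def integral_unique)
  have inc: "mono (\<lambda>i. ?f i x)" for x
    by (rule monoI) (auto simp: indicator_def intro: f(2))
  have lim: "(\<lambda>i. ?f i x) \<longlonglongrightarrow> ?u x" for x
  proof (rule tendsto_eventually)
    obtain j :: nat where "x \<le> real j" using real_arch_simple by blast
    then show "\<forall>\<^sub>F i in sequentially. ?f i x = ?u x"
      by (intro eventually_sequentiallyI[of j]) (auto simp: indicator_def)
  qed
  have um: "?u \<in> borel_measurable lborel" using f(1) by simp
  have fi: "integrable lborel (?f i)" for i
    using si by (simp only: set_integrable_def)
  have intlim: "(\<lambda>i. integral\<^sup>L lborel (?f i)) \<longlonglongrightarrow> L" unfolding L by (rule F)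
  have u: "integrable lborel ?u" "integral\<^sup>L lborel ?u = L"
    by (rule integrable_monotone_convergence[OF fi AE_I2[OF inc] AE_I2[OF lim] intlim um],
        rule integral_monotone_convergence[OF fi AE_I2[OF inc] AE_I2[OF lim] intlim um])
  have ae: "AE x in lborel. ?u x = ?v x"
    by (rule AE_I'[of "{0}"]) (auto simp: indicator_def)
  have vm: "?v \<in> borel_measurable lborel" using f(1) by simp
  show "set_integrable lborel {0<..} f"
    unfolding set_integrable_def using integrable_cong_AE[OF um vm ae] u(1) by simp
  show "(LBINT x:{0<..}. f x) = L"
    unfolding set_lebesgue_integral_def using integral_cong_AE[OF um vm ae] u(2) by simp
qed

lemma set_integrable_times_compact:
  fixes f :: "real \<Rightarrow> real"
  assumes f: "f \<in> borel_measurable borel" "set_integrable lborel {0<..} f"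
    and \<psi>: "continuous_on {0..} \<psi>" "\<And>x. T < x \<Longrightarrow> \<psi> x = 0"
  shows "set_integrable lborel {0<..} (\<lambda>x. f x * \<psi> x)"
proof -
  have "compact (\<psi> ` {0..T})"
    by (intro compact_continuous_image continuous_on_subset[OF \<psi>(1)]) auto
  then have "bounded (\<psi> ` {0..T})" by (rule compact_imp_bounded)
  then obtain B where "0 < B" "\<forall>y\<in>\<psi> ` {0..T}. norm y \<le> B" unfolding bounded_pos by blast
  then have B: "0 < B" "\<And>x. x \<in> {0..T} \<Longrightarrow> \<bar>\<psi> x\<bar> \<le> B" by simp_all
  have b: "\<bar>\<psi> x\<bar> \<le> B" if "0 < x" for x
    using B(2)[of x] \<psi>(2)[of x] B(1) that by (cases "x \<le> T") auto
  have m: "(\<lambda>x. indicator {0<..} x *\<^sub>R \<psi> x) \<in> borel_measurable borel"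
    by (intro borel_measurable_continuous_on_indicator continuous_on_subset[OF \<psi>(1)]) auto
  have "(\<lambda>x. f x * (indicator {0<..} x *\<^sub>R \<psi> x)) \<in> borel_measurable borel"
    by (intro borel_measurable_times f(1) m)
  then have m': "set_borel_measurable lborel {0<..} (\<lambda>x. f x * \<psi> x)"
    unfolding set_borel_measurable_def by (simp add: mult.left_commute mult.commute)
  have i: "set_integrable lborel {0<..} (\<lambda>x. B * f x)" by (intro set_integrable_mult_right f(2))
  have "norm (f x * \<psi> x) \<le> norm (B * f x)" if "0 < x" for x
    using mult_left_mono[OF b[OF that], of "\<bar>f x\<bar>"] B(1) by (simp add: abs_mult mult.commute)
  then show ?thesis
    by (intro set_integrable_bound[OF i m'] AE_I2) simp
qed

text \<open>
  The coupling operator only reads values at indices in the admissible range.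
\<close>

lemma coupling_cong:
  assumes "n \<in> idx N" "\<And>j. j \<in> idx N \<Longrightarrow> f j = h j" "6 < N"
  shows "coupling \<beta> N f n = coupling \<beta> N h n"
proof -
  have 3: "3 \<in> idx N"
    using assms(3) unfolding idx_def by (cases N) (auto simp: numeral_eq_enat)
  have "n - 1 \<in> idx N" if "n \<noteq> 2"
    using assms(1) that by (cases N) (auto simp: idx_def)
  moreover have "n + 1 \<in> idx N" if "enat n \<noteq> N"
    using assms(1) that by (cases N) (auto simp: idx_def)
  ultimately show ?thesis
    using assms(1,2) 3 by (auto simp: coupling_def)
qed

lemma coupling_set_integrable:
  assumes "n \<in> idx N" "\<And>j. j \<in> idx N \<Longrightarrow> set_integrable M S (h j)" "6 < N"
  shows "set_integrable M S (\<lambda>x. coupling \<beta> N (\<lambda>j. h j x) n)"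
proof -
  define h' where "h' j = (if j \<in> idx N then h j else (\<lambda>_. 0))" for j
  have i: "set_integrable M S (h' j)" for j
    using assms(2) by (auto simp: h'_def set_integrable_def)
  have "coupling \<beta> N (\<lambda>j. h j x) n = coupling \<beta> N (\<lambda>j. h' j x) n" for x
    by (rule coupling_cong[OF assms(1) _ assms(3)]) (simp add: h'_def)
  moreover have "set_integrable M S (\<lambda>x. coupling \<beta> N (\<lambda>j. h' j x) n)"
    unfolding coupling_def
    by (cases "n = 2"; cases "enat n = N"; simp)
      (intro set_integral_add set_integral_diff set_integrable_mult_right i)+
  ultimately show ?thesis by simp
qed

lemma coupling_deriv:
  assumes "\<And>j. ((\<lambda>x. f j x) has_real_derivative f' j) (at x)"
  shows "((\<lambda>x. coupling \<beta> N (\<lambda>j. f j x) n) has_real_derivative coupling \<beta> N f' n) (at x)"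
  unfolding coupling_def
  by (cases "n = 2"; cases "enat n = N"; simp)
    (intro DERIV_add DERIV_diff DERIV_cmult assms)+

section \<open>The self-similar profile\<close>

context scaling_limit
begin

text \<open>
  By \<open>G_deriv\<close> this is the derivative of \<open>G n\<close>. In the rest point itself its value is \<open>0\<close>, by the convention for
  division by zero.
\<close>

definition g :: "nat \<Rightarrow> real \<Rightarrow> real" where
  "g n x = R n x / (x - (real n - 6))"

lemma G_continuous: "isCont (G n) x"
proof (cases "n \<in> idx N")
  case False
  then have "G n = (\<lambda>_. 0)" by (auto simp: G_outside)
  then show ?thesis by simp
qed (rule G_isCont)

lemma R_continuous: "continuous_on S (R n)"
proof -
  have G: "continuous_on S (\<lambda>x. G j x)" for j
    by (intro continuous_at_imp_continuous_on ballI G_continuous)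
  then have "continuous_on S (\<lambda>x. coupling \<beta> N (\<lambda>j. G j x) n)"
    unfolding coupling_def
    by (cases "n = 2"; cases "enat n = N"; simp) (intro continuous_intros G)+
  then show ?thesis unfolding R_def[abs_def] by (intro continuous_intros G)
qed

lemma g_measurable [measurable]: "g n \<in> borel_measurable borel"
proof -
  have "R n \<in> borel_measurable borel"
    using R_continuous by (rule borel_measurable_continuous_onI)
  then show ?thesis unfolding g_def[abs_def] by measurable
qed

lemma g_nonneg: "n \<in> idx N \<Longrightarrow> 0 \<le> x \<Longrightarrow> 0 \<le> g n x"
  using R_nonneg[of n x] R_nonpos[of n x] unfolding g_def
  by (cases "real n - 6 \<le> x") (auto intro: divide_nonneg_nonneg divide_nonpos_nonpos)

lemma G_zero: "G n 0 = 0"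
proof (rule LIMSEQ_unique)
  have "(\<lambda>k. - inverse (real (Suc k))) \<longlonglongrightarrow> 0"
    using tendsto_minus[OF LIMSEQ_inverse_real_of_nat] by simp
  then show "(\<lambda>k. G n (- inverse (real (Suc k)))) \<longlonglongrightarrow> G n 0"
    by (rule isCont_tendsto_compose[OF G_continuous])
  show "(\<lambda>k. G n (- inverse (real (Suc k)))) \<longlonglongrightarrow> 0"
    by (simp add: G_negative del: of_nat_Suc)
qed

lemma integers_between:
  assumes "0 \<le> p"
  obtains S where "finite S" "\<And>x. p < x \<Longrightarrow> x < q \<Longrightarrow> x \<notin> S \<Longrightarrow> 0 < x \<and> x \<notin> (\<int> :: real set)"
proof -
  have "x \<in> real ` {..nat \<lceil>q\<rceil>}" if "p < x" "x < q" "x \<in> \<int>" for x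
  proof -
    obtain i where i: "x = of_int i" using \<open>x \<in> \<int>\<close> by (auto elim: Ints_cases)
    then have "0 < i" "i \<le> \<lceil>q\<rceil>" using that assms by (auto simp: le_ceiling_iff)
    then show ?thesis using i by (intro image_eqI[of _ _ "nat i"]) auto
  qed
  then show ?thesis using assms by (intro that[of "real ` {..nat \<lceil>q\<rceil>}"]) auto
qed

text \<open>
  Since \<open>G n\<close> is continuous everywhere and differentiable off the integers, it has no singular part.
\<close>

lemma g_has_integral:
  assumes n: "n \<in> idx N" and pq: "0 \<le> p" "p \<le> q"
  shows "(g n has_integral (G n q - G n p)) {p..q}"
proof -
  obtain S where S: "finite S" "\<And>x. p < x \<Longrightarrow> x < q \<Longrightarrow> x \<notin> S \<Longrightarrow> 0 < x \<and> x \<notin> \<int>"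
    by (rule integers_between[OF pq(1), of q]) (rule that)
  show ?thesis
  proof (rule fundamental_theorem_of_calculus_interior_strong[OF S(1) pq(2)])
    fix x assume "x \<in> {p<..<q} - S"
    then have "0 < x" "x \<notin> \<int>" using S(2)[of x] by auto
    from G_deriv[OF n this] show "(G n has_vector_derivative g n x) (at x)"
      by (simp add: g_def has_real_derivative_iff_has_vector_derivative)
  qed (auto intro!: continuous_at_imp_continuous_on G_continuous)
qed

lemma g_integrable: "n \<in> idx N \<Longrightarrow> set_integrable lborel {0<..} (g n)"
  and g_integral: "n \<in> idx N \<Longrightarrow> (LBINT x:{0<..}. g n x) = mass n"
proof -
  assume n: "n \<in> idx N"
  have lim: "(\<lambda>T. G n (real T)) \<longlonglongrightarrow> mass n"
    by (rule filterlim_compose[OF G_at_top filterlim_real_sequentially])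
  have int: "(g n has_integral G n (real T)) {0..real T}" for T
    using g_has_integral[OF n, of 0 "real T"] by (simp add: G_zero)
  show "set_integrable lborel {0<..} (g n)" "(LBINT x:{0<..}. g n x) = mass n"
    using set_integrable_half_line[OF g_measurable g_nonneg[OF n] int lim] by auto
qed

text \<open>
  On \<open>[j, j + 1]\<close> the weight is at most \<open>exp (\<mu> * (j + 1))\<close>, so the integrals are bounded by the sums over unit
  cells, whose sum over \<open>n\<close> is finite.
\<close>

lemma g_exponential_integrals:
  assumes \<mu>: "0 < \<mu>" "\<mu> < ln (1 + 1 / \<beta>)"
  shows "n \<in> idx N \<Longrightarrow> set_integrable lborel {0<..} (\<lambda>x. exp (\<mu> * x) * g n x)"
    and "summable_idx N (\<lambda>n. LBINT x:{0<..}. exp (\<mu> * x) * g n x)"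
proof -
  obtain C where C: "\<And>J T. (\<Sum>n<J. \<Sum>j<T. exp (\<mu> * (real j + 1)) * (G n (real j + 1) - G n (real j))) \<le> C"
    by (rule unit_cell_moments[OF \<mu>]; rule that; assumption)
  define f where "f n x = exp (\<mu> * x) * g n x" for n x
  define F where "F n T = integral {0..real T} (f n)" for n T
  define B where "B n T = (\<Sum>j<T. exp (\<mu> * (real j + 1)) * (G n (real j + 1) - G n (real j)))" for n and T :: nat
  have BJ: "(\<Sum>n<J. B n T) \<le> C" for J T unfolding B_def by (rule C)
  have fm: "f n \<in> borel_measurable borel" for n unfolding f_def[abs_def] by measurable
  have f0: "0 \<le> f n x" if "n \<in> idx N" "0 \<le> x" for n x using g_nonneg[OF that] by (simp add: f_def)
  have fi: "f n integrable_on {p..q}" if n: "n \<in> idx N" and pq: "0 \<le> p" "p \<le> q" for n p q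
  proof -
    have "set_integrable lborel {p..q} (g n)"
      using g_has_integral[OF n pq] g_nonneg[OF n] pq by (intro set_integrable_interval) auto
    then have i: "set_integrable lborel {p..q} (\<lambda>x. exp (\<mu> * q) * g n x)"
      by (intro set_integrable_mult_right)
    have m: "set_borel_measurable lborel {p..q} (f n)"
      unfolding set_borel_measurable_def using fm by simp
    have "norm (f n x) \<le> norm (exp (\<mu> * q) * g n x)" if "x \<in> {p..q}" for x
    proof -
      have "exp (\<mu> * x) \<le> exp (\<mu> * q)" using that \<mu> by simp
      from mult_right_mono[OF this, of "\<bar>g n x\<bar>"] show ?thesis by (simp add: f_def abs_mult)
    qed
    then have "set_integrable lborel {p..q} (f n)"
      by (intro set_integrable_bound[OF i m] AE_I2) simp
    then show ?thesis by (rule set_borel_integral_eq_integral(1))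
  qed
  have step: "F n (Suc T) \<le> F n T + exp (\<mu> * (real T + 1)) * (G n (real T + 1) - G n (real T))"
    and inc: "F n T \<le> F n (Suc T)" if n: "n \<in> idx N" for n T
  proof -
    have "F n T + integral {real T..real (Suc T)} (f n) = F n (Suc T)"
      unfolding F_def by (intro Henstock_Kurzweil_Integration.integral_combine fi[OF n]) auto
    moreover have "integral {real T..real (Suc T)} (f n)
        \<le> integral {real T..real (Suc T)} (\<lambda>x. exp (\<mu> * (real T + 1)) * g n x)"
    proof (intro integral_le fi[OF n])
      show "(\<lambda>x. exp (\<mu> * (real T + 1)) * g n x) integrable_on {real T..real (Suc T)}"
        by (rule has_integral_integrable[OF has_integral_mult_right[OF g_has_integral[OF n]]]) auto
      show "f n x \<le> exp (\<mu> * (real T + 1)) * g n x" if "x \<in> {real T..real (Suc T)}" for x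
        using that \<mu> g_nonneg[OF n, of x] by (auto simp: f_def intro!: mult_right_mono)
    qed auto
    moreover have "integral {real T..real (Suc T)} (g n) = G n (real T + 1) - G n (real T)"
      using g_has_integral[OF n, of "real T" "real (Suc T)"] by (simp add: integral_unique add.commute)
    moreover have "0 \<le> integral {real T..real (Suc T)} (f n)"
      by (intro Henstock_Kurzweil_Integration.integral_nonneg fi[OF n] f0[OF n]) auto
    ultimately show "F n (Suc T) \<le> F n T + exp (\<mu> * (real T + 1)) * (G n (real T + 1) - G n (real T))"
      "F n T \<le> F n (Suc T)" by auto
  qed
  have FB: "F n T \<le> B n T" if "n \<in> idx N" for n T
  proof (induction T)
    case (Suc T)
    then show ?case using step[OF that, of T] by (simp add: B_def)
  qed (simp add: F_def B_def)
  have B0: "0 \<le> B n T" for n T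
    unfolding B_def by (intro sum_nonneg mult_nonneg_nonneg) (auto intro!: G_mono)
  have BC: "B n T \<le> C" for n T
  proof -
    have "B n T \<le> (\<Sum>i<Suc n. B i T)" by (intro member_le_sum) (auto simp: B0)
    then show ?thesis using BJ by (rule order_trans)
  qed
  define L where "L n = lim (F n)" for n
  have L: "F n \<longlonglongrightarrow> L n" if n: "n \<in> idx N" for n
  proof -
    have "incseq (F n)" by (rule incseq_SucI) (rule inc[OF n])
    moreover have "\<And>T. F n T \<le> C" using FB[OF n] BC order_trans by blast
    ultimately have "convergent (F n)" by (metis incseq_convergent convergentI)
    then show ?thesis by (simp add: L_def convergent_LIMSEQ_iff)
  qed
  have FI: "(f n has_integral F n T) {0..real T}" if "n \<in> idx N" for n T
    unfolding F_def by (intro integrable_integral fi[OF that]) auto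
  have res: "set_integrable lborel {0<..} (f n)" "(LBINT x:{0<..}. f n x) = L n" if n: "n \<in> idx N" for n
    using set_integrable_half_line[OF fm f0[OF n] FI[OF n] L[OF n]] by auto
  show "set_integrable lborel {0<..} (\<lambda>x. exp (\<mu> * x) * g n x)" if "n \<in> idx N"
    using res(1)[OF that] by (simp add: f_def[abs_def])
  define a where "a n = (if n \<in> idx N then LBINT x:{0<..}. f n x else 0)" for n
  have L0: "0 \<le> L n" if n: "n \<in> idx N" for n
  proof (rule LIMSEQ_le_const[OF L[OF n]])
    show "\<exists>T0. \<forall>T\<ge>T0. 0 \<le> F n T"
      unfolding F_def by (intro exI[of _ 0] allI impI Henstock_Kurzweil_Integration.integral_nonneg fi[OF n] f0[OF n]) auto
  qed
  have "summable a"
  proof (rule summableI_nonneg_bounded)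
    show "0 \<le> a n" for n using L0 by (simp add: a_def res)
    fix J
    show "(\<Sum>n<J. a n) \<le> C"
    proof (rule LIMSEQ_le_const2)
      show "(\<lambda>T. \<Sum>n<J. if n \<in> idx N then F n T else 0) \<longlonglongrightarrow> (\<Sum>n<J. a n)"
        by (intro tendsto_sum) (auto simp: a_def res L)
      have "(\<Sum>n<J. if n \<in> idx N then F n T else 0) \<le> (\<Sum>n<J. B n T)" for T
        by (intro sum_mono) (auto simp: FB B0)
      then have "(\<Sum>n<J. if n \<in> idx N then F n T else 0) \<le> C" for T
        using BJ by (rule order_trans)
      then show "\<exists>T0. \<forall>T\<ge>T0. (\<Sum>n<J. if n \<in> idx N then F n T else 0) \<le> C" by blast
    qed
  qed
  then show "summable_idx N (\<lambda>n. LBINT x:{0<..}. exp (\<mu> * x) * g n x)"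
    unfolding summable_idx_def a_def[abs_def] f_def[abs_def] .
qed

text \<open>
  Off the integers \<open>R n\<close> has the derivative \<open>- g n - \<gamma> * (J g)_n\<close>, and \<open>R n \<xi> = (\<xi> - (n - 6)) * g n \<xi>\<close>. So the weak
  equation is the fundamental theorem of calculus for \<open>R n * \<phi>\<close>; its value at \<open>0\<close> is the boundary term, since
  \<open>G\<close> vanishes there.
\<close>

lemma g_weak:
  assumes n: "n \<in> idx N" and \<phi>: "test_function \<phi>"
  shows "(LBINT \<xi>:{0<..}. g n \<xi> * ((\<xi> + 6 - real n) * deriv \<phi> \<xi> - \<phi> \<xi>))
       + max (6 - real n) 0 * b\<^sub>0 n * \<phi> 0
     = \<gamma> * (LBINT \<xi>:{0<..}. coupling \<beta> N (\<lambda>m. g m \<xi>) n * \<phi> \<xi>)"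
proof -
  obtain D r where D: "D 0 = \<phi>" "\<And>k x. 0 \<le> x \<Longrightarrow> (D k has_real_derivative D (Suc k) x) (at x within {0..})"
    and r: "\<And>x. r < x \<Longrightarrow> \<phi> x = 0"
    using \<phi> unfolding test_function_def by blast
  obtain T :: nat where T: "r < real T" using reals_Archimedean2 by blast
  define \<phi>' where "\<phi>' = D (Suc 0)"
  have der: "(\<phi> has_real_derivative \<phi>' x) (at x)" if "0 < x" for x
    using D(2)[of x 0] that at_within_interior[of x "{0..}"] by (simp add: D(1) \<phi>'_def interior_real_atLeast)
  have deriv: "deriv \<phi> x = \<phi>' x" if "0 < x" for x
    using der[OF that] by (rule DERIV_imp_deriv)
  have cont: "continuous_on {0..} \<phi>" "continuous_on {0..} \<phi>'"
    using DERIV_continuous_on[of "{0..}" "D 0" "D 1"] DERIV_continuous_on[of "{0..}" "D 1" "D 2"] D(2)[of _ 0] D(2)[of _ 1]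
    by (auto simp: D(1) \<phi>'_def numeral_2_eq_2)
  have \<phi>0: "\<phi> x = 0" if "real T \<le> x" for x using r T that by simp
  have \<phi>'0: "\<phi>' x = 0" if "real T < x" for x
  proof -
    have "(\<phi> has_real_derivative 0) (at x)"
      by (rule has_field_derivative_transform_within_open[of "\<lambda>_. 0" _ _ "{real T<..}"])
        (use that \<phi>0 in auto)
    then show ?thesis using der[of x] DERIV_unique that by (meson le_less_trans of_nat_0_le_iff)
  qed
  define K where "K x = g n x * ((x + 6 - real n) * \<phi>' x) - g n x * \<phi> x - \<gamma> * coupling \<beta> N (\<lambda>m. g m x * \<phi> x) n" for x
  have R0: "R n 0 = max (6 - real n) 0 * b\<^sub>0 n"
    by (simp add: R_def G_zero coupling_def)
  have "(K has_integral (R n (real T) * \<phi> (real T) - R n 0 * \<phi> 0)) {0..real T}"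
  proof -
    obtain S where S: "finite S" "\<And>x. 0 < x \<Longrightarrow> x < real T \<Longrightarrow> x \<notin> S \<Longrightarrow> 0 < x \<and> x \<notin> \<int>"
      by (rule integers_between[of 0 "real T"]) (simp, rule that)
    show ?thesis
    proof (rule fundamental_theorem_of_calculus_interior_strong[OF S(1)])
      fix x assume "x \<in> {0<..<real T} - S"
      then have x: "0 < x" "x \<notin> \<int>" using S(2)[of x] by auto
      define g0 where "g0 j = (if j \<in> idx N then g j x else 0)" for j
      have dG: "(G j has_real_derivative g0 j) (at x)" for j
      proof (cases "j \<in> idx N")
        case True
        then show ?thesis using G_deriv[OF True x] by (simp add: g0_def g_def)
      next
        case False
        then have "G j = (\<lambda>_. 0)" by (auto simp: G_outside)
        then show ?thesis using False by (simp add: g0_def)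
      qed
      have dC: "((\<lambda>x. coupling \<beta> N (\<lambda>j. G j x) n) has_real_derivative coupling \<beta> N g0 n) (at x)"
        by (rule coupling_deriv) (rule dG)
      have "coupling \<beta> N g0 n = coupling \<beta> N (\<lambda>j. g j x) n"
        by (rule coupling_cong[OF n _ N_gt_6]) (simp add: g0_def)
      then have "(R n has_real_derivative 0 - g n x - \<gamma> * coupling \<beta> N (\<lambda>j. g j x) n) (at x)"
        unfolding R_def[abs_def] using dC dG[of n] n
        by (intro DERIV_diff DERIV_cmult DERIV_const) (auto simp: g0_def)
      from DERIV_mult[OF this der[OF x(1)]]
      have "((\<lambda>x. R n x * \<phi> x) has_real_derivative
          (0 - g n x - \<gamma> * coupling \<beta> N (\<lambda>j. g j x) n) * \<phi> x + \<phi>' x * R n x) (at x)" .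
      moreover have "real n - 6 = of_int (int n - 6)" by simp
      then have "x - (real n - 6) \<noteq> 0" using x(2) by (metis Ints_of_int eq_iff_diff_eq_0)
      then have "R n x = g n x * (x + 6 - real n)" by (simp add: g_def field_simps)
      moreover have "coupling \<beta> N (\<lambda>m. g m x * \<phi> x) n = coupling \<beta> N (\<lambda>m. g m x) n * \<phi> x"
        by (simp add: coupling_def algebra_simps)
      ultimately show "((\<lambda>x. R n x * \<phi> x) has_vector_derivative K x) (at x)"
        unfolding has_real_derivative_iff_has_vector_derivative[symmetric]
        by (simp add: K_def algebra_simps)
    next
      show "continuous_on {0..real T} (\<lambda>x. R n x * \<phi> x)"
        by (intro continuous_intros R_continuous continuous_on_subset[OF cont(1)]) auto
    qed simp
  qed
  then have K: "(K has_integral - (R n 0 * \<phi> 0)) {0..real T}" by (simp add: \<phi>0)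
  have K0: "K x = 0" if "real T < x" for x
    using that by (simp add: K_def \<phi>0 \<phi>'0 coupling_def)
  have K1: "(K has_integral - (R n 0 * \<phi> 0)) {0<..}"
  proof (subst has_integral_spike_set_eq[of _ "{0..real T}"])
    have "K x = 0" if "x \<in> {0<..} - {0..real T}" for x using that by (intro K0) auto
    then have "{x \<in> {0<..} - {0..real T}. K x \<noteq> 0} = {}" by blast
    then show "negligible {x \<in> {0<..} - {0..real T}. K x \<noteq> 0}" by (simp only: negligible_empty)
    show "negligible {x \<in> {0..real T} - {0<..}. K x \<noteq> 0}"
      by (rule negligible_subset[of "{0}"]) auto
  qed (rule K)
  have i1: "set_integrable lborel {0<..} (\<lambda>x. g n x * ((x + 6 - real n) * \<phi>' x))"
    by (rule set_integrable_times_compact[OF g_measurable g_integrable[OF n], where T = "real T"])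
      (auto intro!: continuous_intros cont simp: \<phi>'0)
  have i2: "set_integrable lborel {0<..} (\<lambda>x. g j x * \<phi> x)" if "j \<in> idx N" for j
    by (rule set_integrable_times_compact[OF g_measurable g_integrable[OF that] cont(1), where T = "real T"])
      (auto simp: \<phi>0)
  have i3: "set_integrable lborel {0<..} (\<lambda>x. coupling \<beta> N (\<lambda>m. g m x * \<phi> x) n)"
    by (rule coupling_set_integrable[OF n i2 N_gt_6])
  have i12: "set_integrable lborel {0<..} (\<lambda>x. g n x * ((x + 6 - real n) * \<phi>' x) - g n x * \<phi> x)"
    by (intro set_integral_diff i1 i2 n)
  have iK: "set_integrable lborel {0<..} K"
    unfolding K_def[abs_def] by (intro set_integral_diff i1 i2 n set_integrable_mult_right i3)
  have "- (R n 0 * \<phi> 0) = (LBINT x:{0<..}. K x)"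
    using set_borel_integral_eq_integral(2)[OF iK] K1 by (simp add: integral_unique)
  also have "\<dots> = (LBINT x:{0<..}. g n x * ((x + 6 - real n) * \<phi>' x) - g n x * \<phi> x)
      - \<gamma> * (LBINT x:{0<..}. coupling \<beta> N (\<lambda>m. g m x * \<phi> x) n)"
    unfolding K_def[abs_def] by (subst set_integral_diff(2)) (use i12 i3 in auto)
  also have "(LBINT x:{0<..}. g n x * ((x + 6 - real n) * \<phi>' x) - g n x * \<phi> x)
      = (LBINT \<xi>:{0<..}. g n \<xi> * ((\<xi> + 6 - real n) * deriv \<phi> \<xi> - \<phi> \<xi>))"
    by (intro set_lebesgue_integral_cong) (auto simp: deriv algebra_simps)
  also have "(LBINT x:{0<..}. coupling \<beta> N (\<lambda>m. g m x * \<phi> x) n)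
      = (LBINT \<xi>:{0<..}. coupling \<beta> N (\<lambda>m. g m \<xi>) n * \<phi> \<xi>)"
    by (intro set_lebesgue_integral_cong) (auto simp: coupling_def algebra_simps)
  finally show ?thesis using R0 by simp
qed

lemma g_at_zero: "n \<in> {2..5} \<Longrightarrow> g n 0 = b\<^sub>0 n"
  by (auto simp: g_def R_def G_zero coupling_def divide_simps)

lemma small_idx: "n \<in> {2..7} \<Longrightarrow> n \<in> idx N"
  using N_gt_6 by (cases N) (auto simp: idx_def numeral_eq_enat)

lemma X_mom_g: "n \<in> idx N \<Longrightarrow> X_mom g n = mass n"
  by (simp add: X_mom_def g_integral)

lemma size_sum_g: "(\<lambda>n. if n \<in> idx N then real n * X_mom g n else 0) = (\<lambda>n. real n * mass n)"
  using mass_outside by (auto simp: X_mom_g)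

lemma Gamma_den_g: "Gamma_den \<beta> N g = den"
proof -
  have XM: "X_mom g M = mass M" if "N = enat M" for M
  proof -
    have "M \<in> idx N" using that N_gt_6 by (auto simp: idx_def numeral_eq_enat)
    then show ?thesis by (rule X_mom_g)
  qed
  have "(case N of enat M \<Rightarrow> real M * X_mom g M | \<infinity> \<Rightarrow> 0) = (case N of enat M \<Rightarrow> real M * mass M | \<infinity> \<Rightarrow> 0)"
    by (intro enat.case_cong refl) (drule XM, simp only:)
  moreover have "X_mom g 2 = mass 2" by (intro X_mom_g small_idx) simp
  ultimately show ?thesis
    by (simp only: Gamma_den_def den_def sum_idx_def size_sum_g)
qed

text \<open>
  The limit of \<open>num_den\<close> identifies the spectral parameter \<open>\<gamma>\<close> as the coupling weight of the profile.
\<close>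

lemma Gamma_weight_g: "Gamma_weight \<beta> N g = \<gamma>"
proof -
  have "Gamma_num g = \<gamma> * den"
    using num_den by (simp add: Gamma_num_def g_at_zero)
  then show ?thesis using den_pos by (simp add: Gamma_weight_def Gamma_den_g)
qed

lemma g_continuous_at_zero: "n \<in> {2..5} \<Longrightarrow> continuous (at 0 within {0..}) (g n)"
proof -
  assume n: "n \<in> {2..5}"
  have "continuous_on {0..} (g n)"
    unfolding g_def[abs_def] using n by (intro continuous_intros R_continuous) auto
  then show ?thesis by (simp add: continuous_on_eq_continuous_within)
qed

lemma g_solution: "weak_self_similar_solution \<beta> N g"
  unfolding weak_self_similar_solution_def
proof (intro conjI ballI allI impI)
  show "Gamma_well_defined \<beta> N g"
    using summable_size den_pos by (simp add: Gamma_well_defined_def summable_idx_def size_sum_g Gamma_den_g)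
  fix n \<phi> assume n: "n \<in> idx N" and \<phi>: "test_function \<phi>"
  have "max (6 - real n) 0 * g n 0 = max (6 - real n) 0 * b\<^sub>0 n"
    using g_at_zero[of n] n by (cases "n \<le> 5") (auto simp: idx_def)
  then show "(LBINT \<xi>:{0<..}. g n \<xi> * ((\<xi> + 6 - real n) * deriv \<phi> \<xi> - \<phi> \<xi>))
       + max (6 - real n) 0 * g n 0 * \<phi> 0
     = Gamma_weight \<beta> N g * (LBINT \<xi>:{0<..}. coupling \<beta> N (\<lambda>m. g m \<xi>) n * \<phi> \<xi>)"
    using g_weak[OF n \<phi>] by (simp only: Gamma_weight_g)
qed (auto simp: g_integrable g_continuous_at_zero Gamma_weight_g \<gamma>_pos)

text \<open>
  If all densities vanished, so would the denominator of the coupling weight, which is at least \<open>4 - 2 * \<beta>\<close>.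
\<close>

lemma g_nontrivial: "\<exists>n\<in>idx N. \<not> (AE \<xi> in lborel. \<xi> > 0 \<longrightarrow> g n \<xi> = 0)"
proof (rule ccontr)
  assume "\<not> ?thesis"
  then have ae: "AE \<xi> in lborel. \<xi> > 0 \<longrightarrow> g n \<xi> = 0" if "n \<in> idx N" for n using that by blast
  have "mass n = 0" for n
  proof (cases "n \<in> idx N")
    case True
    have "(LBINT \<xi>:{0<..}. g n \<xi>) = 0"
      unfolding set_lebesgue_integral_def
    proof (rule integral_eq_zero_AE)
      show "AE \<xi> in lborel. indicator {0<..} \<xi> *\<^sub>R g n \<xi> = 0"
        using ae[OF True] by eventually_elim (auto simp: indicator_def)
    qed
    then show ?thesis using g_integral[OF True] by simp
  qed (rule mass_outside)
  then have "den = 0" by (simp add: den_def split: enat.split)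
  then show False using den_pos by simp
qed

lemma g_finite_area: "finite_area N g"
  unfolding finite_area_def
proof
  obtain \<mu> where \<mu>: "0 < \<mu>" "\<mu> < ln (1 + 1 / \<beta>)" by (rule rate_exists)
  have le: "x * g n x \<le> 1 / \<mu> * (exp (\<mu> * x) * g n x)" if "n \<in> idx N" "0 < x" for n x
  proof -
    have "\<mu> * x \<le> exp (\<mu> * x)" using exp_ge_add_one_self[of "\<mu> * x"] by linarith
    then have "\<mu> * x * g n x \<le> exp (\<mu> * x) * g n x"
      using that by (intro mult_right_mono g_nonneg) auto
    then show ?thesis using \<mu> by (simp add: field_simps)
  qed
  have int: "set_integrable lborel {0<..} (\<lambda>x. 1 / \<mu> * (exp (\<mu> * x) * g n x))" if "n \<in> idx N" for n
    using g_exponential_integrals(1)[OF \<mu> that] by (intro set_integrable_mult_right)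
  have intY: "set_integrable lborel {0<..} (\<lambda>x. x * g n x)" if n: "n \<in> idx N" for n
  proof (rule set_integrable_bound[OF int[OF n]])
    show "set_borel_measurable lborel {0<..} (\<lambda>x. x * g n x)"
      unfolding set_borel_measurable_def by measurable
    have "norm (x * g n x) \<le> norm (1 / \<mu> * (exp (\<mu> * x) * g n x))" if "0 < x" for x
      using le[OF n that] g_nonneg[OF n, of x] that \<mu> by simp
    then show "AE x in lborel. x \<in> {0<..} \<longrightarrow> norm (x * g n x) \<le> norm (1 / \<mu> * (exp (\<mu> * x) * g n x))"
      by simp
  qed
  then show "\<forall>n\<in>idx N. set_integrable lborel {0<..} (\<lambda>\<xi>. \<xi> * g n \<xi>)" by blast
  define E where "E n = (LBINT x:{0<..}. exp (\<mu> * x) * g n x)" for n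
  have "0 \<le> Y_mom g n" "Y_mom g n \<le> 1 / \<mu> * E n" if n: "n \<in> idx N" for n
  proof -
    show "0 \<le> Y_mom g n"
      unfolding Y_mom_def set_lebesgue_integral_def
      by (intro integral_nonneg_AE) (auto intro!: AE_I2 simp: indicator_def g_nonneg[OF n])
    show "Y_mom g n \<le> 1 / \<mu> * E n"
      unfolding Y_mom_def E_def set_integral_mult_right[symmetric]
      by (intro set_integral_mono intY int n le) auto
  qed
  then have "norm (if n \<in> idx N then Y_mom g n else 0) \<le> 1 / \<mu> * (if n \<in> idx N then E n else 0)" for n
    by auto
  moreover have "summable (\<lambda>n. 1 / \<mu> * (if n \<in> idx N then E n else 0))"
    using g_exponential_integrals(2)[OF \<mu>] unfolding summable_idx_def E_def by (rule summable_mult)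
  ultimately show "summable_idx N (Y_mom g)"
    unfolding summable_idx_def by (rule summable_comparison_test'[where N = 0, rotated])
qed

lemma g_exponential_decay:
  assumes \<mu>: "0 < \<mu>" "\<mu> < ln (1 + 1 / \<beta>)"
  shows "summable_idx N (\<lambda>n. exp (\<mu> * real n) * X_mom g n + (LBINT \<xi>:{0<..}. exp (\<mu> * \<xi>) * g n \<xi>))"
proof -
  have "summable (\<lambda>n. if n \<in> idx N then exp (\<mu> * real n) * X_mom g n else 0)"
  proof (rule summable_comparison_test'[OF mass_moment[OF \<mu>], of 0])
    fix n :: nat
    show "norm (if n \<in> idx N then exp (\<mu> * real n) * X_mom g n else 0) \<le> exp (\<mu> * real n) * (real n * mass n)"
    proof (cases "n \<in> idx N")
      case True
      have "0 \<le> mass n" using G_bounds(1,2)[of n 0] by simp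
      moreover have "1 \<le> real n" using True by (simp add: idx_def)
      ultimately have "1 * mass n \<le> real n * mass n" by (intro mult_right_mono)
      then have "exp (\<mu> * real n) * mass n \<le> exp (\<mu> * real n) * (real n * mass n)" by simp
      then show ?thesis using True \<open>0 \<le> mass n\<close> by (simp add: X_mom_g)
    next
      case False
      then show ?thesis by (simp add: mass_outside)
    qed
  qed
  from summable_add[OF this g_exponential_integrals(2)[OF \<mu>, unfolded summable_idx_def]]
  have "summable (\<lambda>n. (if n \<in> idx N then exp (\<mu> * real n) * X_mom g n else 0)
      + (if n \<in> idx N then LBINT \<xi>:{0<..}. exp (\<mu> * \<xi>) * g n \<xi> else 0))" .
  moreover have "(\<lambda>n. (if n \<in> idx N then exp (\<mu> * real n) * X_mom g n else 0)
      + (if n \<in> idx N then LBINT \<xi>:{0<..}. exp (\<mu> * \<xi>) * g n \<xi> else 0))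
    = (\<lambda>n. if n \<in> idx N then exp (\<mu> * real n) * X_mom g n
        + (LBINT \<xi>:{0<..}. exp (\<mu> * \<xi>) * g n \<xi>) else 0)"
    by (simp add: fun_eq_iff)
  ultimately show ?thesis unfolding summable_idx_def by simp
qed

lemma g_support:
  "N = enat M \<Longrightarrow> n \<in> idx N \<Longrightarrow> 0 \<le> x \<Longrightarrow> real M - 6 < x \<Longrightarrow> g n x = 0"
proof -
  assume "N = enat M" "n \<in> idx N" "0 \<le> x" "real M - 6 < x"
  then have "R n x = 0" by (intro R_support) auto
  then show "g n x = 0" unfolding g_def by simp
qed

end

theorem theorem1:
  fixes \<beta> :: real and N :: enat
  assumes "0 < \<beta>" and "\<beta> < 2" and "6 < N"
  shows "\<exists>g :: nat \<Rightarrow> real \<Rightarrow> real.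
    weak_self_similar_solution \<beta> N g \<and>
    (\<exists>n\<in>idx N. \<not> (AE \<xi> in lborel. \<xi> > 0 \<longrightarrow> g n \<xi> = 0)) \<and>
    (\<forall>n\<in>idx N. \<forall>\<xi>\<ge>0. g n \<xi> \<ge> 0) \<and>
    finite_area N g \<and>
    (\<forall>lam. 0 < lam \<and> lam < ln (1 + 1 / \<beta>) \<longrightarrow>
       (\<forall>n\<in>idx N. set_integrable lborel {0<..} (\<lambda>\<xi>. exp (lam * \<xi>) * g n \<xi>)) \<and>
       summable_idx N (\<lambda>n. exp (lam * real n) * X_mom g n
                             + (LBINT \<xi>:{0<..}. exp (lam * \<xi>) * g n \<xi>))) \<and>
    (\<forall>M. N = enat M \<longrightarrow>
       (\<forall>n\<in>idx N. \<forall>\<xi>\<ge>0. \<xi> > real M - 6 \<longrightarrow> g n \<xi> = 0))"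
proof -
  obtain Ns ms \<gamma>s ws \<gamma> b\<^sub>0 mass G where "scaling_limit \<beta> N Ns ms \<gamma>s ws \<gamma> b\<^sub>0 mass G"
    by (rule scaling_limit_exists[OF assms])
  then interpret scaling_limit \<beta> N Ns ms \<gamma>s ws \<gamma> b\<^sub>0 mass G .
  show ?thesis
  proof (intro exI[of _ g] conjI allI impI ballI)
    show "weak_self_similar_solution \<beta> N g" by (rule g_solution)
    show "\<exists>n\<in>idx N. \<not> (AE \<xi> in lborel. \<xi> > 0 \<longrightarrow> g n \<xi> = 0)" by (rule g_nontrivial)
    show "finite_area N g" by (rule g_finite_area)
    show "0 \<le> g n \<xi>" if "n \<in> idx N" "0 \<le> \<xi>" for n \<xi> using that by (rule g_nonneg)
    show "g n \<xi> = 0" if "N = enat M" "n \<in> idx N" "0 \<le> \<xi>" "real M - 6 < \<xi>" for M n \<xi>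
      using that by (rule g_support)
    fix lam assume lam: "0 < lam \<and> lam < ln (1 + 1 / \<beta>)"
    then show "summable_idx N (\<lambda>n. exp (lam * real n) * X_mom g n
        + (LBINT \<xi>:{0<..}. exp (lam * \<xi>) * g n \<xi>))"
      by (intro g_exponential_decay) auto
    show "set_integrable lborel {0<..} (\<lambda>\<xi>. exp (lam * \<xi>) * g n \<xi>)" if "n \<in> idx N" for n
      using lam that by (intro g_exponential_integrals(1)) auto
  qed
qed

end
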